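(* Let $d>6$ and assume that $( * )$ (defined in the context) holds. Let $\varepsilon>0$. There exists $c=c(\varepsilon,d)>0$ such that, for every finite $S\subset \mathbb Z^d$, every $o\in S$ and every $x\in \mathbb Z^d$, $$\tau_{p_c}(o,x)\;\geq\; c\sum_{\substack{u\in S:\ |x-u|\geq \varepsilon|x-o|\\ v\notin S,\ u\sim v}}\tau_{S,p_c}(o,u)\cdot p_c\cdot\tau_{p_c}(v,x).$$
   Context: Setting: $\mathcal E$ is a fixed edge set on $\mathbb Z^d$, either nearest-neighbour, $\mathcal E=\{\{x,y\}:\|x-y\|_1=1\}$, or spread-out with parameter $L\ge 1$, $\mathcal E=\{\{x,y\}: x\neq y,\ \|x-y\|_1\le L\}$. Write $x\sim y$ if $\{x,y\}\in\mathcal E$. $\mathbb P_p$ is Bernoulli bond percolation (each edge of $\mathcal E$ open independently with probability $p$), and $p_c:=\inf\{p:\mathbb P_p[0\leftrightarrow\infty]>0\}\in(0,1)$. $\{x\xleftrightarrow{S}y\}$ is the event that there is an open path from $x$ to $y$ with all vertices in $S$; $\tau_{S,p}(x,y):=\mathbb P_p[x\xleftrightarrow{S}y]$; $\tau_p:=\tau_{\mathbb Z^d,p}$. $|\cdot|$ is the $\ell^\infty$ norm. Assumption $( * )$: there are constants $0<a\le b<\infty$ with $a(1\vee|x-y|)^{-(d-2)}\le\tau_{p_c}(x,y)\le b(1\vee|x-y|)^{-(d-2)}$ for all $x,y\in\mathbb Z^d$. Constants depend on the model (i.e. also on $L$ in the spread-out case) in addition to the displayed parameters; they do not depend on $S,o,x$.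 *)

theory Defs
  imports "HOL-Probability.Probability"
begin

text \<open>The lattice \<open>\<int>\<^sup>d\<close> is the type \<open>int ^ 'd\<close> with \<open>d = CARD('d)\<close>;
  an edge is an unordered pair, that is, a two-element set of vertices.\<close>

definition l1_norm :: "int ^ 'd \<Rightarrow> int" where
  "l1_norm x = (\<Sum>i\<in>UNIV. \<bar>x $ i\<bar>)"

definition linf_norm :: "int ^ 'd \<Rightarrow> int" where
  "linf_norm x = (MAX i. \<bar>x $ i\<bar>)"

definition nn_edges :: "(int ^ 'd) set set" where
  "nn_edges = {{x, y} | x y. l1_norm (x - y) = 1}"

definition spread_out_edges :: "real \<Rightarrow> (int ^ 'd) set set" where
  "spread_out_edges L = {{x, y} | x y. x \<noteq> y \<and> real_of_int (l1_norm (x - y)) \<le> L}"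

definition percolation_edge_set :: "(int ^ 'd) set set \<Rightarrow> bool" where
  "percolation_edge_set E \<longleftrightarrow> E = nn_edges \<or> (\<exists>L\<ge>1. E = spread_out_edges L)"

definition percolation :: "'v set set \<Rightarrow> real \<Rightarrow> ('v set \<Rightarrow> bool) measure" where
  "percolation E p = (\<Pi>\<^sub>M e\<in>E. measure_pmf (bernoulli_pmf p))"

text \<open>A path is a nonempty list of vertices, so for \<open>x \<in> S\<close> the trivial path connects
  \<open>x\<close> to itself in \<open>S\<close>, while nothing is connected in \<open>S\<close> to a vertex outside \<open>S\<close>.\<close>

definition connected_in :: "'v set set \<Rightarrow> 'v set \<Rightarrow> ('v set \<Rightarrow> bool) \<Rightarrow> 'v \<Rightarrow> 'v \<Rightarrow> bool" where
  "connected_in E S \<omega> x y \<longleftrightarrow>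
     (\<exists>\<gamma>. \<gamma> \<noteq> [] \<and> hd \<gamma> = x \<and> last \<gamma> = y \<and> set \<gamma> \<subseteq> S \<and>
          successively (\<lambda>u v. {u, v} \<in> E \<and> \<omega> {u, v}) \<gamma>)"

definition tau :: "'v set set \<Rightarrow> 'v set \<Rightarrow> real \<Rightarrow> 'v \<Rightarrow> 'v \<Rightarrow> real" where
  "tau E S p x y =
     measure (percolation E p) {\<omega> \<in> space (percolation E p). connected_in E S \<omega> x y}"

text \<open>The event \<open>0 \<leftrightarrow> \<infinity>\<close> says that the open cluster of the origin is infinite.\<close>

definition p_crit :: "(int ^ 'd) set set \<Rightarrow> real" where
  "p_crit E = Inf {p \<in> {0..1}.
     measure (percolation E p)
       {\<omega> \<in> space (percolation E p). infinite {x. connected_in E UNIV \<omega> 0 x}} > 0}"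

definition two_point_assumption :: "(int ^ 'd) set set \<Rightarrow> bool" where
  "two_point_assumption E \<longleftrightarrow>
     (\<exists>a b. 0 < a \<and> a \<le> b \<and>
        (\<forall>x y. let r = real_of_int (max 1 (linf_norm (x - y))) powr (- (real CARD('d) - 2))
               in a * r \<le> tau E UNIV (p_crit E) x y \<and> tau E UNIV (p_crit E) x y \<le> b * r))"

definition boundary_pairs :: "'v set set \<Rightarrow> 'v set \<Rightarrow> ('v \<times> 'v) set" where
  "boundary_pairs E S = {(u, v). u \<in> S \<and> v \<notin> S \<and> {u, v} \<in> E}"

text \<open>The following lemmas guard the conventions \<open>sum f A = 0\<close> for infinite \<open>A\<close> and
  \<open>measure M A = 0\<close> for nonmeasurable \<open>A\<close>.\<close>

lemma finite_l1_ball: "finite {y :: int ^ 'd. l1_norm (x - y) \<le> k}"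
proof (rule finite_subset)
  show "{y. l1_norm (x - y) \<le> k} \<subseteq> {y. \<forall>i. y $ i \<in> {x $ i - k..x $ i + k}}"
  proof safe
    fix y i assume "l1_norm (x - y) \<le> k"
    moreover have "\<bar>(x - y) $ i\<bar> \<le> l1_norm (x - y)"
      unfolding l1_norm_def by (rule member_le_sum) auto
    ultimately show "y $ i \<in> {x $ i - k..x $ i + k}" by auto
  qed
  have "finite (vec_nth -` (\<Pi>\<^sub>E i\<in>UNIV. {x $ i - k..x $ i + k}))"
    by (intro finite_vimageI finite_PiE) (auto simp: inj_def vec_eq_iff)
  then show "finite {y. \<forall>i. y $ i \<in> {x $ i - k..x $ i + k}}"
    by (rule rev_finite_subset) (auto simp: PiE_def)
qed

lemma l1_norm_minus_commute: "l1_norm (x - y) = l1_norm (y - x)"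
  by (simp add: l1_norm_def abs_minus_commute)

lemma finite_neighbours:
  fixes E :: "(int ^ 'd) set set"
  assumes "percolation_edge_set E"
  shows "finite {v. {u, v} \<in> E}"
proof -
  obtain L :: real where "E \<subseteq> {{x, y} | x y. real_of_int (l1_norm (x - y)) \<le> L}"
    using assms unfolding percolation_edge_set_def nn_edges_def spread_out_edges_def
    by (elim disjE exE) (force, blast)
  then have "{v. {u, v} \<in> E} \<subseteq> {v. l1_norm (u - v) \<le> \<lfloor>L\<rfloor>}"
    by (force simp: le_floor_iff doubleton_eq_iff l1_norm_minus_commute)
  then show ?thesis by (rule finite_subset[OF _ finite_l1_ball])
qed

lemma finite_boundary_pairs:
  fixes E :: "(int ^ 'd) set set"
  assumes "percolation_edge_set E" "finite S"
  shows "finite (boundary_pairs E S)"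
proof (rule finite_subset)
  show "boundary_pairs E S \<subseteq> Sigma S (\<lambda>u. {v. {u, v} \<in> E})"
    by (auto simp: boundary_pairs_def)
qed (use assms finite_neighbours in auto)

lemma connected_in_measurable:
  fixes E :: "(int ^ 'd) set set"
  shows "Measurable.pred (percolation E p) (\<lambda>\<omega>. connected_in E S \<omega> x y)"
proof -
  have edge: "Measurable.pred (percolation E p) (\<lambda>\<omega>. {u, v} \<in> E \<and> \<omega> {u, v})" for u v
  proof (cases "{u, v} \<in> E")
    case True
    then have "(\<lambda>\<omega>. \<omega> {u, v}) \<in> percolation E p \<rightarrow>\<^sub>M measure_pmf (bernoulli_pmf p)"
      unfolding percolation_def by (rule measurable_component_singleton)
    then show ?thesis using True by (simp cong: measurable_cong_sets)
  qed simp
  have "Measurable.pred (percolation E p)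
          (\<lambda>\<omega>. successively (\<lambda>u v. {u, v} \<in> E \<and> \<omega> {u, v}) \<gamma>)" for \<gamma>
  proof (induction \<gamma> rule: induct_list012)
    case (3 u v \<gamma>)
    show ?case
      unfolding successively.simps by (rule pred_intros_logic(3)[OF edge "3.IH"(2)])
  qed simp_all
  then show ?thesis unfolding connected_in_def
    by (intro pred_intros_countable pred_intros_logic) auto
qed

lemma infinite_cluster_measurable:
  fixes E :: "(int ^ 'd) set set"
  shows "Measurable.pred (percolation E p) (\<lambda>\<omega>. infinite {x. connected_in E UNIV \<omega> 0 x})"
proof -
  have eq: "infinite {x. P x} \<longleftrightarrow> (\<forall>xs :: (int ^ 'd) list. \<exists>x. P x \<and> x \<notin> set xs)" for P
  proof
    assume inf: "infinite {x. P x}"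
    show "\<forall>xs. \<exists>x. P x \<and> x \<notin> set xs"
    proof
      fix xs :: "(int ^ 'd) list"
      have "\<not> {x. P x} \<subseteq> set xs" using inf finite_subset by blast
      then show "\<exists>x. P x \<and> x \<notin> set xs" by blast
    qed
  next
    assume "\<forall>xs. \<exists>x. P x \<and> x \<notin> set xs"
    then show "infinite {x. P x}" by (metis finite_list mem_Collect_eq)
  qed
  show ?thesis unfolding eq
    by (intro pred_intros_countable pred_intros_logic connected_in_measurable) auto
qed

end

theory Submission
  imports Defs
begin

text \<open>
  Letting \<open>x\<close> tend to infinity shows that the theorem is equivalent to a bound on
  \<open>\<phi> = \<Sum>u. \<tau>\<^sub>S(o, u)\<close>, the sum running over the inner boundary of \<open>S\<close>, that is uniform in \<open>S\<close>.
  For a far away target \<open>z\<close>, a boundary point \<open>u\<close> and a point \<open>y\<close> at distance at most \<open>R\<close> from \<open>u\<close>, consider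
  the event that \<open>o\<close> is connected to \<open>u\<close> in \<open>S\<close> and \<open>y\<close> to \<open>z\<close> by distinct clusters. A surgery in the cube of
  radius \<open>R\<close> around \<open>u\<close> produces a cut vertex between \<open>o\<close> and \<open>z\<close>, outside \<open>S\<close> but adjacent to the cluster of
  \<open>o\<close> in \<open>S\<close>. There is at most one such cut vertex, so the probabilities of these events sum to
  at most a constant times \<open>\<tau>(o, z)\<close>.

  Conversely, exploring the cluster of \<open>o\<close> and applying the van den Berg--Kesten inequality bounds each
  probability from below by \<open>\<tau>\<^sub>S(o, u) \<tau>(y, z)\<close> minus a loop term. Averaged over \<open>y\<close>, the latter is governed by the
  sum of \<open>(max R \<bar>w - u\<bar>) powr (4 - d)\<close> over the vertices \<open>w\<close> of one selected open path from \<open>o\<close> to \<open>u\<close> in \<open>S\<close>.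
  Summed over \<open>u\<close>, the expected number of visits of this path to the cube of radius \<open>r\<close> around \<open>u\<close> is
  at most of order \<open>r powr (5/2)\<close> times \<open>\<phi>\<close>: a high moment of the number of visits is bounded by
  chains of disjoint connections, up to a loss polynomial in \<open>r\<close>, because a vertex of \<open>S\<close> near its
  boundary is connected in \<open>S\<close> to nearby boundary points with a probability that decays at most
  polynomially in \<open>r\<close>; a large enough moment absorbs this loss. As \<open>d > 6\<close>, the loop term is at most
  half of the main term once \<open>R\<close> is large.
\<close>

section \<open>Finite Bernoulli product measures\<close>

text \<open>The bound on \<open>\<phi>\<close> suffices because
  \<open>\<bar>x - u\<bar> \<ge> \<epsilon> \<bar>x - o\<bar>\<close> makes
  \<open>\<tau>(v, x)\<close> at most a constant times \<open>\<tau>(o, x)\<close>. The obstacle is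
  the loop term. With \<open>y = u\<close> it would be of the same order as the main term; spreading
  \<open>y\<close> over a cube cuts off the singularity at \<open>w = u\<close>. This helps only if
  few \<open>w\<close> count: all vertices of a cluster, typically of order \<open>r ^ 4\<close>
  within distance \<open>r\<close>, would not be summable against \<open>r powr (4 - d)\<close> for
  \<open>d = 7\<close>. A path visits about \<open>r\<^sup>2\<close> vertices, and any exponent
  below 3 is enough; 5/2 leaves room for the moment argument and gives the integer power
  \<open>s ^ 5\<close> once radii are written \<open>s\<^sup>2\<close>. As main term and loop term
  are both multiples of \<open>\<phi>\<close>, the latter can be absorbed. Configurations are sets
  of open edges of a finite graph with explicit weights, so that Harris, van den Berg--Kesten and
  finite energy become inductions on the edges; the product measure is reached through finite
  cubes.\<close>

definition expect :: "real \<Rightarrow> 'e set \<Rightarrow> ('e set \<Rightarrow> real) \<Rightarrow> real" where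
  "expect p F f = (\<Sum>\<omega>\<in>Pow F. (\<Prod>e\<in>F. if e \<in> \<omega> then p else 1 - p) * f \<omega>)"

definition pr :: "real \<Rightarrow> 'e set \<Rightarrow> ('e set \<Rightarrow> bool) \<Rightarrow> real" where
  "pr p F A = expect p F (\<lambda>\<omega>. of_bool (A \<omega>))"

definition increasing :: "('e set \<Rightarrow> bool) \<Rightarrow> bool" where
  "increasing A \<longleftrightarrow> (\<forall>\<omega> \<omega>'. \<omega> \<subseteq> \<omega>' \<longrightarrow> A \<omega> \<longrightarrow> A \<omega>')"

text \<open>For increasing events this is the usual disjoint occurrence: open edges alone certify
  such an event, so a witness is a set of open edges which, taken as a configuration, lies in the
  event.\<close>

definition disjoint_occurrence :: "('e set \<Rightarrow> bool) \<Rightarrow> ('e set \<Rightarrow> bool) \<Rightarrow> 'e set \<Rightarrow> bool" where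
  "disjoint_occurrence A B \<omega> \<longleftrightarrow> (\<exists>I J. I \<inter> J = {} \<and> I \<union> J \<subseteq> \<omega> \<and> A I \<and> B J)"

lemma increasing_disjoint_occurrence: "increasing (disjoint_occurrence A B)"
  unfolding increasing_def disjoint_occurrence_def by blast

lemma expect_empty [simp]: "expect p {} f = f {}"
  by (simp add: expect_def)

lemma expect_insert:
  assumes "finite F" "e \<notin> F"
  shows "expect p (insert e F) f = p * expect p F (\<lambda>\<omega>. f (insert e \<omega>)) + (1 - p) * expect p F f"
proof -
  let ?w = "\<lambda>F \<omega>. \<Prod>e\<in>F. if e \<in> \<omega> then p else 1 - p"
  have inj: "inj_on (insert e) (Pow F)" using assms by (auto simp: inj_on_def)
  have 0: "?w (insert e F) \<omega> = (1 - p) * ?w F \<omega>" if "\<omega> \<in> Pow F" for \<omega>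
    using that assms by auto
  have 1: "?w (insert e F) (insert e \<omega>) = p * ?w F \<omega>" if "\<omega> \<in> Pow F" for \<omega>
  proof -
    have "?w F (insert e \<omega>) = ?w F \<omega>" by (rule prod.cong) (use assms in auto)
    then show ?thesis using assms by simp
  qed
  have "expect p (insert e F) f = (\<Sum>\<omega>\<in>Pow F. ?w (insert e F) \<omega> * f \<omega>)
      + (\<Sum>\<omega>\<in>insert e ` Pow F. ?w (insert e F) \<omega> * f \<omega>)"
    unfolding expect_def Pow_insert by (rule sum.union_disjoint) (use assms in auto)
  also have "(\<Sum>\<omega>\<in>insert e ` Pow F. ?w (insert e F) \<omega> * f \<omega>)
      = (\<Sum>\<omega>\<in>Pow F. p * (?w F \<omega> * f (insert e \<omega>)))"
    unfolding sum.reindex[OF inj] o_def by (rule sum.cong[OF refl]) (simp only: 1 mult.assoc)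
  also have "(\<Sum>\<omega>\<in>Pow F. ?w (insert e F) \<omega> * f \<omega>) = (\<Sum>\<omega>\<in>Pow F. (1 - p) * (?w F \<omega> * f \<omega>))"
    by (rule sum.cong[OF refl]) (simp only: 0 mult.assoc)
  finally show ?thesis by (simp add: expect_def sum_distrib_left)
qed

lemma expect_cong: "(\<And>\<omega>. \<omega> \<subseteq> F \<Longrightarrow> f \<omega> = g \<omega>) \<Longrightarrow> expect p F f = expect p F g"
  unfolding expect_def by (rule sum.cong) auto

lemma expect_add: "expect p F (\<lambda>\<omega>. f \<omega> + g \<omega>) = expect p F f + expect p F g"
  unfolding expect_def by (simp add: distrib_left sum.distrib)

lemma expect_cmult: "expect p F (\<lambda>\<omega>. c * f \<omega>) = c * expect p F f"
  unfolding expect_def by (simp add: sum_distrib_left mult_ac)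

lemma expect_sum: "expect p F (\<lambda>\<omega>. \<Sum>i\<in>I. f i \<omega>) = (\<Sum>i\<in>I. expect p F (f i))"
  unfolding expect_def sum_distrib_left by (rule sum.swap)

lemma pr_empty [simp]: "pr p {} A = of_bool (A {})"
  by (simp add: pr_def)

lemma pr_insert:
  assumes "finite F" "e \<notin> F"
  shows "pr p (insert e F) A = p * pr p F (\<lambda>\<omega>. A (insert e \<omega>)) + (1 - p) * pr p F A"
  unfolding pr_def by (rule expect_insert[OF assms])

lemma pr_cong: "(\<And>\<omega>. \<omega> \<subseteq> F \<Longrightarrow> A \<omega> = B \<omega>) \<Longrightarrow> pr p F A = pr p F B"
  unfolding pr_def by (rule expect_cong) auto

lemma pr_False [simp]: "pr p F (\<lambda>_. False) = 0"
  by (simp add: pr_def expect_def)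

lemma pr_True: "finite F \<Longrightarrow> pr p F (\<lambda>_. True) = 1"
  by (induction F rule: finite_induct) (auto simp: pr_insert)

lemma pr_neg_add: "pr p F (\<lambda>\<omega>. A \<omega> \<and> \<not> B \<omega>) = pr p F A - pr p F (\<lambda>\<omega>. A \<omega> \<and> B \<omega>)"
proof -
  have "pr p F A = pr p F (\<lambda>\<omega>. A \<omega> \<and> \<not> B \<omega>) + pr p F (\<lambda>\<omega>. A \<omega> \<and> B \<omega>)"
    unfolding pr_def expect_add[symmetric] by (rule expect_cong) auto
  then show ?thesis by simp
qed

locale prob_weight =
  fixes p :: real
  assumes p_ge_0: "0 \<le> p" and p_le_1: "p \<le> 1"
begin

lemma expect_mono: "(\<And>\<omega>. \<omega> \<subseteq> F \<Longrightarrow> f \<omega> \<le> g \<omega>) \<Longrightarrow> expect p F f \<le> expect p F g"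
  unfolding expect_def using p_ge_0 p_le_1 by (intro sum_mono mult_left_mono prod_nonneg) auto

lemma pr_nonneg [simp]: "0 \<le> pr p F A"
  using expect_mono[of F "\<lambda>_. 0" "\<lambda>\<omega>. of_bool (A \<omega>)"] by (simp add: pr_def expect_def)

lemma pr_mono: "(\<And>\<omega>. \<omega> \<subseteq> F \<Longrightarrow> A \<omega> \<Longrightarrow> B \<omega>) \<Longrightarrow> pr p F A \<le> pr p F B"
  unfolding pr_def by (rule expect_mono) auto

lemma pr_union:
  assumes "finite I" "\<And>\<omega>. \<omega> \<subseteq> F \<Longrightarrow> A \<omega> \<Longrightarrow> \<exists>i\<in>I. B i \<omega>"
  shows "pr p F A \<le> (\<Sum>i\<in>I. pr p F (B i))"
proof -
  have "of_bool (A \<omega>) \<le> (\<Sum>i\<in>I. of_bool (B i \<omega>) :: real)" if \<omega>: "\<omega> \<subseteq> F" for \<omega>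
  proof (cases "A \<omega>")
    case True
    then obtain i where i: "i \<in> I" "B i \<omega>" using assms(2) \<omega> by blast
    have "(\<Sum>i\<in>{i}. of_bool (B i \<omega>)) \<le> (\<Sum>i\<in>I. of_bool (B i \<omega>) :: real)"
      by (rule sum_mono2) (use assms i in auto)
    then show ?thesis using i True by simp
  qed (simp add: sum_nonneg)
  then show ?thesis
    unfolding pr_def expect_sum[symmetric] by (rule expect_mono)
qed

lemma pr_split: "pr p F A \<le> pr p F B + pr p F (\<lambda>\<omega>. A \<omega> \<and> \<not> B \<omega>)"
  unfolding pr_neg_add using pr_mono[of F "\<lambda>\<omega>. A \<omega> \<and> B \<omega>" B] by simp

lemma pr_disjoint_union:
  assumes "finite I" "\<And>\<omega> i. \<omega> \<subseteq> F \<Longrightarrow> i \<in> I \<Longrightarrow> B i \<omega> \<Longrightarrow> A \<omega>"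
    and "\<And>\<omega> i j. \<omega> \<subseteq> F \<Longrightarrow> i \<in> I \<Longrightarrow> j \<in> I \<Longrightarrow> B i \<omega> \<Longrightarrow> B j \<omega> \<Longrightarrow> i = j"
  shows "(\<Sum>i\<in>I. pr p F (B i)) \<le> pr p F A"
proof -
  have "(\<Sum>i\<in>I. of_bool (B i \<omega>) :: real) \<le> of_bool (A \<omega>)" if \<omega>: "\<omega> \<subseteq> F" for \<omega>
  proof (cases "\<exists>i\<in>I. B i \<omega>")
    case True
    then obtain i where i: "i \<in> I" "B i \<omega>" by blast
    have "(\<Sum>i'\<in>I. of_bool (B i' \<omega>) :: real) = (\<Sum>i'\<in>I. if i' = i then 1 else 0)"
      by (rule sum.cong) (use assms(3)[OF \<omega>] i in auto)
    also have "\<dots> = 1" using i assms(1) by simp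
    finally show ?thesis using assms(2)[OF \<omega> i] by simp
  qed auto
  then show ?thesis
    unfolding pr_def expect_sum[symmetric] by (rule expect_mono)
qed

lemma pr_total:
  assumes "finite I" "\<And>\<omega>. \<omega> \<subseteq> F \<Longrightarrow> A \<omega> \<Longrightarrow> \<exists>!i. i \<in> I \<and> B i \<omega>"
  shows "pr p F A = (\<Sum>i\<in>I. pr p F (\<lambda>\<omega>. B i \<omega> \<and> A \<omega>))"
proof (rule antisym)
  show "pr p F A \<le> (\<Sum>i\<in>I. pr p F (\<lambda>\<omega>. B i \<omega> \<and> A \<omega>))"
    by (rule pr_union) (use assms in blast)+
  show "(\<Sum>i\<in>I. pr p F (\<lambda>\<omega>. B i \<omega> \<and> A \<omega>)) \<le> pr p F A"
    by (rule pr_disjoint_union) (use assms in blast)+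
qed

section \<open>Correlation inequalities, independence and finite energy\<close>

lemma pr_convex: "x \<le> x' \<Longrightarrow> y \<le> y' \<Longrightarrow> p * x + (1 - p) * y \<le> p * x' + (1 - p) * y'"
  using p_ge_0 p_le_1 by (intro add_mono mult_left_mono) auto

lemma increasing_section:
  "increasing A \<Longrightarrow> increasing (\<lambda>\<omega>. A (insert e \<omega>))"
  unfolding increasing_def
proof (intro allI impI)
  fix \<omega> \<omega>' assume "\<forall>\<omega> \<omega>'. \<omega> \<subseteq> \<omega>' \<longrightarrow> A \<omega> \<longrightarrow> A \<omega>'" "\<omega> \<subseteq> \<omega>'" "A (insert e \<omega>)"
  moreover have "insert e \<omega> \<subseteq> insert e \<omega>'" using \<open>\<omega> \<subseteq> \<omega>'\<close> by auto
  ultimately show "A (insert e \<omega>')" by blast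
qed

text \<open>Induction on the edges. An edge of \<open>U\<close> only contributes a factor
  \<open>p\<close>, since \<open>Q\<close> does not see it; any other edge is handled by the Harris
  inequality for a decreasing and an increasing event. Restoring \<open>U\<close> in
  \<open>Q\<close> at the end only increases its probability.\<close>

lemma harris_conditional:
  assumes "finite F" "U \<subseteq> F" "increasing (\<lambda>\<omega>. \<not> D \<omega>)" "increasing Q"
  shows "pr p F (\<lambda>\<omega>. U \<subseteq> \<omega> \<and> D \<omega> \<and> Q (\<omega> - U)) \<le> pr p F (\<lambda>\<omega>. U \<subseteq> \<omega> \<and> D \<omega>) * pr p F Q"
proof -
  have "pr p F (\<lambda>\<omega>. U \<subseteq> \<omega> \<and> D \<omega> \<and> Q (\<omega> - U))
     \<le> pr p F (\<lambda>\<omega>. U \<subseteq> \<omega> \<and> D \<omega>) * pr p F (\<lambda>\<omega>. Q (\<omega> - U))"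
    using assms
  proof (induction F arbitrary: U D Q rule: finite_induct)
    case empty
    then show ?case by auto
  next
    case (insert e F)
    note ins = pr_insert[OF insert.hyps(1,2)]
    have dec: "increasing (\<lambda>\<omega>. \<not> D (insert e \<omega>))" using increasing_section[OF insert.prems(2)] .
    show ?case
    proof (cases "e \<in> U")
      case True
      let ?U = "U - {e}"
      have U: "?U \<subseteq> F" using insert.prems by auto
      have z: "pr p F (\<lambda>\<omega>. U \<subseteq> \<omega> \<and> X \<omega>) = 0" for X
        using pr_cong[of F "\<lambda>\<omega>. U \<subseteq> \<omega> \<and> X \<omega>" "\<lambda>_. False" p] True insert.hyps by auto
      have d: "insert e \<omega> - U = \<omega> - U" for \<omega> using True by auto
      have f: "\<omega> - U = \<omega> - ?U" if "\<omega> \<subseteq> F" for \<omega> using that True insert.hyps(2) by auto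
      have c: "pr p F (\<lambda>\<omega>. Q (\<omega> - U)) = pr p F (\<lambda>\<omega>. Q (\<omega> - ?U))"
        by (rule pr_cong) (simp only: f)
      have c': "pr p F (\<lambda>\<omega>. U - {e} \<subseteq> \<omega> \<and> D (insert e \<omega>) \<and> Q (\<omega> - U))
         = pr p F (\<lambda>\<omega>. ?U \<subseteq> \<omega> \<and> D (insert e \<omega>) \<and> Q (\<omega> - ?U))"
        by (rule pr_cong) (simp only: f)
      have "pr p (insert e F) (\<lambda>\<omega>. U \<subseteq> \<omega> \<and> D \<omega> \<and> Q (\<omega> - U))
          = p * pr p F (\<lambda>\<omega>. ?U \<subseteq> \<omega> \<and> D (insert e \<omega>) \<and> Q (\<omega> - ?U))"
        unfolding ins z d by (simp add: subset_insert_iff True c')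
      also have "\<dots> \<le> p * (pr p F (\<lambda>\<omega>. ?U \<subseteq> \<omega> \<and> D (insert e \<omega>)) * pr p F (\<lambda>\<omega>. Q (\<omega> - ?U)))"
        using insert.IH[OF U dec insert.prems(3)] p_ge_0 by (rule mult_left_mono)
      also have "\<dots> = pr p (insert e F) (\<lambda>\<omega>. U \<subseteq> \<omega> \<and> D \<omega>) * pr p (insert e F) (\<lambda>\<omega>. Q (\<omega> - U))"
        unfolding ins z d c using True by (simp add: subset_insert_iff algebra_simps)
      finally show ?thesis .
    next
      case False
      have U: "U \<subseteq> F" using insert.prems False by auto
      let ?Q1 = "\<lambda>\<omega>. Q (insert e \<omega>)"
      have sec: "insert e \<omega> - U = insert e (\<omega> - U)" for \<omega> using False by auto
      have su: "U \<subseteq> insert e \<omega> \<longleftrightarrow> U \<subseteq> \<omega>" for \<omega> using False by auto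
      let ?a1 = "pr p F (\<lambda>\<omega>. U \<subseteq> \<omega> \<and> D (insert e \<omega>))" and ?a0 = "pr p F (\<lambda>\<omega>. U \<subseteq> \<omega> \<and> D \<omega>)"
      let ?b1 = "pr p F (\<lambda>\<omega>. ?Q1 (\<omega> - U))" and ?b0 = "pr p F (\<lambda>\<omega>. Q (\<omega> - U))"
      \<comment> \<open>Closing \<open>e\<close> favours \<open>D\<close> and opening it favours
        \<open>Q\<close>, so the cross term that separates the average of the products from the
        product of the averages has a sign.\<close>
      have "?a1 \<le> ?a0" "?b0 \<le> ?b1"
        using insert.prems(2,3) by (intro pr_mono; metis increasing_def subset_insertI)+
      then have *: "0 \<le> p * (1 - p) * ((?a0 - ?a1) * (?b1 - ?b0))"
        using p_ge_0 p_le_1 by auto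
      have "pr p (insert e F) (\<lambda>\<omega>. U \<subseteq> \<omega> \<and> D \<omega> \<and> Q (\<omega> - U))
          = p * pr p F (\<lambda>\<omega>. U \<subseteq> \<omega> \<and> D (insert e \<omega>) \<and> ?Q1 (\<omega> - U))
           + (1 - p) * pr p F (\<lambda>\<omega>. U \<subseteq> \<omega> \<and> D \<omega> \<and> Q (\<omega> - U))"
        unfolding ins sec su ..
      also have "\<dots> \<le> p * (?a1 * ?b1) + (1 - p) * (?a0 * ?b0)"
        using insert.IH[OF U dec increasing_section[OF insert.prems(3)]]
          insert.IH[OF U insert.prems(2,3)] by (rule pr_convex)
      also have "\<dots> \<le> (p * ?a1 + (1 - p) * ?a0) * (p * ?b1 + (1 - p) * ?b0)"
        using * by (simp add: algebra_simps)
      also have "\<dots> = pr p (insert e F) (\<lambda>\<omega>. U \<subseteq> \<omega> \<and> D \<omega>) * pr p (insert e F) (\<lambda>\<omega>. Q (\<omega> - U))"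
        unfolding ins sec su ..
      finally show ?thesis .
    qed
  qed
  also have "\<dots> \<le> pr p F (\<lambda>\<omega>. U \<subseteq> \<omega> \<and> D \<omega>) * pr p F Q"
    using assms(4) unfolding increasing_def by (intro mult_left_mono pr_mono) (metis Diff_subset, simp)
  finally show ?thesis .
qed

text \<open>The case \<open>U = {}\<close> of \<open>harris_conditional\<close>, with the complement
  of \<open>A\<close> as the decreasing event.\<close>

lemma harris:
  assumes "finite F" "increasing A" "increasing B"
  shows "pr p F A * pr p F B \<le> pr p F (\<lambda>\<omega>. A \<omega> \<and> B \<omega>)"
proof -
  have neg: "pr p F (\<lambda>\<omega>. \<not> A \<omega>) = 1 - pr p F A"
    using pr_neg_add[of p F "\<lambda>_. True" A] assms(1) by (simp add: pr_True)
  have "pr p F (\<lambda>\<omega>. \<not> A \<omega> \<and> B \<omega>) \<le> pr p F (\<lambda>\<omega>. \<not> A \<omega>) * pr p F B"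
    using harris_conditional[of F "{}" "\<lambda>\<omega>. \<not> A \<omega>" B] assms by simp
  moreover have "pr p F (\<lambda>\<omega>. \<not> A \<omega> \<and> B \<omega>) = pr p F B - pr p F (\<lambda>\<omega>. A \<omega> \<and> B \<omega>)"
    using pr_neg_add[of p F B A] by (simp add: conj_commute)
  ultimately show ?thesis using neg by (simp add: algebra_simps)
qed

lemma pr_indep:
  assumes "finite F" "\<And>\<omega>. A (\<omega> \<inter> D) = A \<omega>" "\<And>\<omega>. B (\<omega> - D) = B \<omega>"
  shows "pr p F (\<lambda>\<omega>. A \<omega> \<and> B \<omega>) = pr p F A * pr p F B"
  using assms
proof (induction F arbitrary: A B rule: finite_induct)
  case empty
  then show ?case by auto
next
  case (insert e F)
  note ins = pr_insert[OF insert.hyps(1,2)]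
  show ?case
  proof (cases "e \<in> D")
    case True
    have B: "B (insert e \<omega>) = B \<omega>" for \<omega>
      by (metis True insert.prems(2) insert_Diff1)
    have A: "A (insert e (\<omega> \<inter> D)) = A (insert e \<omega>)" for \<omega>
      by (metis True Int_insert_left_if1 insert.prems(1))
    show ?thesis unfolding ins B
      using insert.IH[of A B] insert.prems insert.IH[of "\<lambda>\<omega>. A (insert e \<omega>)" B] A insert.prems(2)
      by (simp add: algebra_simps)
  next
    case False
    have A: "A (insert e \<omega>) = A \<omega>" for \<omega>
      by (metis False insert.prems(1) Int_insert_left_if0)
    have B: "B (insert e (\<omega> - D)) = B (insert e \<omega>)" for \<omega>
      by (metis False insert.prems(2) insert_Diff_if)
    show ?thesis unfolding ins A
      using insert.IH[of A B] insert.prems insert.IH[of A "\<lambda>\<omega>. B (insert e \<omega>)"] B insert.prems(1)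
      by (simp add: algebra_simps)
  qed
qed

text \<open>For \<open>W I J \<longleftrightarrow> A I \<and> B J\<close> this is the van den Berg--Kesten inequality; the general form
  is what makes the induction on the edges go through.\<close>

lemma bk_pairs:
  assumes "finite F"
    and "\<And>I J I' J'. W I J \<Longrightarrow> I \<subseteq> I' \<Longrightarrow> J \<subseteq> J' \<Longrightarrow> W I' J'"
  shows "pr p F (\<lambda>\<omega>. \<exists>I J. I \<inter> J = {} \<and> I \<union> J \<subseteq> \<omega> \<and> W I J)
    \<le> expect p F (\<lambda>\<omega>. pr p F (W \<omega>))"
  using assms
proof (induction F arbitrary: W rule: finite_induct)
  case empty
  then show ?case by auto
next
  case (insert e F)
  note ins = pr_insert[OF insert.hyps(1,2)]
  let ?L = "\<lambda>W \<omega>. \<exists>I J. I \<inter> J = {} \<and> I \<union> J \<subseteq> \<omega> \<and> W I J"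
  let ?R = "\<lambda>F W. expect p F (\<lambda>\<omega>. pr p F (W \<omega>))"
  let ?Wx = "\<lambda>I J. W (insert e I) J" and ?Wy = "\<lambda>I J. W I (insert e J)"
  let ?Wxy = "\<lambda>I J. W (insert e I) (insert e J)"
  let ?Wor = "\<lambda>I J. ?Wx I J \<or> ?Wy I J"
  have up: "W I J \<Longrightarrow> I \<subseteq> I' \<Longrightarrow> J \<subseteq> J' \<Longrightarrow> W I' J'" for I J I' J'
    using insert.prems by blast
  have R: "?R (insert e F) W = p * (p * ?R F ?Wxy + (1 - p) * ?R F ?Wx) + (1 - p) * (p * ?R F ?Wy + (1 - p) * ?R F W)"
    unfolding expect_insert[OF insert.hyps(1,2)] ins by (simp only: expect_add expect_cmult)
  \<comment> \<open>Disjointness enters here: the open edge \<open>e\<close> can serve only one of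
    \<open>I\<close> and \<open>J\<close>. The section is thus a union of two relations, which is
    not of product form even if \<open>W\<close> is.\<close>
  have L1: "?L W (insert e \<omega>) = ?L ?Wor \<omega>" if "\<omega> \<subseteq> F" for \<omega>
  proof
    assume "?L W (insert e \<omega>)"
    then obtain I J where IJ: "I \<inter> J = {}" "I \<union> J \<subseteq> insert e \<omega>" "W I J" by blast
    have "I - {e} \<union> (J - {e}) \<subseteq> \<omega>" "(I - {e}) \<inter> (J - {e}) = {}" using IJ by auto
    moreover have "?Wor (I - {e}) (J - {e})"
    proof (cases "e \<in> I")
      case True
      then have "J - {e} = J" using IJ by auto
      then show ?thesis using IJ True by (simp add: insert_absorb)
    next
      case False
      then show ?thesis using up[OF IJ(3), of "I - {e}" "insert e (J - {e})"] by auto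
    qed
    ultimately show "?L ?Wor \<omega>" by blast
  next
    assume "?L ?Wor \<omega>"
    then obtain I J where IJ: "I \<inter> J = {}" "I \<union> J \<subseteq> \<omega>" "?Wor I J" by blast
    have e: "e \<notin> \<omega>" using that insert.hyps by auto
    from IJ(3) show "?L W (insert e \<omega>)"
    proof
      assume "W (insert e I) J"
      moreover have "insert e I \<inter> J = {}" "insert e I \<union> J \<subseteq> insert e \<omega>" using IJ e by auto
      ultimately show ?thesis by blast
    next
      assume "W I (insert e J)"
      moreover have "I \<inter> insert e J = {}" "I \<union> insert e J \<subseteq> insert e \<omega>" using IJ e by auto
      ultimately show ?thesis by blast
    qed
  qed
  \<comment> \<open>On the right \<open>e\<close> is sampled independently for each argument. For
    \<open>W\<close> false the two sides agree if exactly one of \<open>?Wx\<close>,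
    \<open>?Wy\<close> holds; if both hold, the right side gains \<open>p * (1 - p)\<close>.\<close>
  have ineq: "p * pr p F (?Wor \<omega>) + (1 - p) * pr p F (W \<omega>)
    \<le> p * (p * pr p F (?Wxy \<omega>) + (1 - p) * pr p F (?Wx \<omega>)) + (1 - p) * (p * pr p F (?Wy \<omega>) + (1 - p) * pr p F (W \<omega>))"
    for \<omega>
  proof -
    have "(p * of_bool (?Wor \<omega> \<eta>) + (1 - p) * of_bool (W \<omega> \<eta>) :: real)
      \<le> p * (p * of_bool (?Wxy \<omega> \<eta>) + (1 - p) * of_bool (?Wx \<omega> \<eta>))
        + (1 - p) * (p * of_bool (?Wy \<omega> \<eta>) + (1 - p) * of_bool (W \<omega> \<eta>))" for \<eta>
    proof -
      have h: "0 \<le> p * (1 - p)" using p_ge_0 p_le_1 by simp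
      have "W \<omega> \<eta> \<Longrightarrow> ?Wx \<omega> \<eta>" "W \<omega> \<eta> \<Longrightarrow> ?Wy \<omega> \<eta>" "?Wx \<omega> \<eta> \<Longrightarrow> ?Wxy \<omega> \<eta>" "?Wy \<omega> \<eta> \<Longrightarrow> ?Wxy \<omega> \<eta>"
        using up by (meson subset_insertI subset_refl)+
      then show ?thesis using h
        by (cases "W \<omega> \<eta>"; cases "?Wx \<omega> \<eta>"; cases "?Wy \<omega> \<eta>"; cases "?Wxy \<omega> \<eta>")
           (auto simp: algebra_simps)
    qed
    then show ?thesis
      unfolding pr_def expect_cmult[symmetric] expect_add[symmetric] by (rule expect_mono)
  qed
  have "pr p (insert e F) (?L W) = p * pr p F (?L ?Wor) + (1 - p) * pr p F (?L W)"
    unfolding ins using pr_cong[of F "\<lambda>\<omega>. ?L W (insert e \<omega>)" "?L ?Wor" p, OF L1] by simp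
  also have "\<dots> \<le> p * ?R F ?Wor + (1 - p) * ?R F W"
  proof (rule pr_convex)
    show "pr p F (?L W) \<le> ?R F W" by (rule insert.IH) (rule up)
    show "pr p F (?L ?Wor) \<le> ?R F ?Wor"
    proof (rule insert.IH)
      fix I J I' J' assume "?Wor I J" and *: "I \<subseteq> I'" "J \<subseteq> J'"
      moreover have "insert e I \<subseteq> insert e I'" "insert e J \<subseteq> insert e J'" using * by auto
      ultimately show "?Wor I' J'" using up by blast
    qed
  qed
  also have "\<dots> = expect p F (\<lambda>\<omega>. p * pr p F (?Wor \<omega>) + (1 - p) * pr p F (W \<omega>))"
    by (simp only: expect_add expect_cmult)
  also have "\<dots> \<le> expect p F (\<lambda>\<omega>. p * (p * pr p F (?Wxy \<omega>) + (1 - p) * pr p F (?Wx \<omega>)) + (1 - p) * (p * pr p F (?Wy \<omega>) + (1 - p) * pr p F (W \<omega>)))"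
    by (rule expect_mono) (rule ineq)
  also have "\<dots> = ?R (insert e F) W"
    unfolding R by (simp only: expect_add expect_cmult)
  finally show ?case .
qed

lemma bk:
  assumes "finite F" "increasing A" "increasing B"
  shows "pr p F (disjoint_occurrence A B) \<le> pr p F A * pr p F B"
proof -
  have "pr p F (disjoint_occurrence A B) \<le> expect p F (\<lambda>\<omega>. pr p F (\<lambda>\<eta>. A \<omega> \<and> B \<eta>))"
    unfolding disjoint_occurrence_def using assms
    by (intro bk_pairs[of F "\<lambda>\<omega> \<eta>. A \<omega> \<and> B \<eta>"]) (auto simp: increasing_def)
  also have "\<dots> = expect p F (\<lambda>\<omega>. pr p F B * of_bool (A \<omega>))"
    by (rule expect_cong) auto
  also have "\<dots> = pr p F A * pr p F B" unfolding expect_cmult pr_def by (rule mult.commute)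
  finally show ?thesis .
qed

text \<open>Finite energy: given the edges off \<open>D\<close>, each configuration on
  \<open>D\<close> has probability at least \<open>q ^ card D\<close>. If some completion lies in
  \<open>G\<close>, some completion lies in \<open>A\<close>, so no count of preimages of the
  surgery is needed.\<close>

lemma pr_surgery:
  assumes "finite F" "D \<subseteq> F" and q: "0 \<le> q" "q \<le> p" "q \<le> 1 - p"
    and "\<And>\<omega>. \<omega> \<subseteq> F \<Longrightarrow> G \<omega> \<Longrightarrow> \<exists>\<omega>'. \<omega>' \<subseteq> F \<and> \<omega>' - D = \<omega> - D \<and> A \<omega>'"
  shows "q ^ card D * pr p F G \<le> pr p F A"
  using assms(1,2,6)
proof (induction F arbitrary: D G A rule: finite_induct)
  case empty
  then show ?case by auto
next
  case (insert e F)
  note ins = pr_insert[OF insert.hyps(1,2)]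
  show ?case
  proof (cases "e \<in> D")
    case True
    \<comment> \<open>Both events are relaxed by letting the state of \<open>e\<close> be chosen
      freely; returning from the relaxed \<open>A\<close> to \<open>A\<close> costs one factor
      \<open>q\<close>.\<close>
    let ?D = "D - {e}"
    let ?G = "\<lambda>\<omega>. G \<omega> \<or> G (insert e \<omega>)" and ?A = "\<lambda>\<omega>. A \<omega> \<or> A (insert e \<omega>)"
    have "q ^ card ?D * pr p F ?G \<le> pr p F ?A"
    proof (rule insert.IH)
      show "?D \<subseteq> F" using insert.prems by auto
      fix \<omega> assume \<omega>: "\<omega> \<subseteq> F" "?G \<omega>"
      have e: "e \<notin> \<omega>" using \<omega> insert.hyps by auto
      have "\<exists>\<omega>'. \<omega>' \<subseteq> insert e F \<and> \<omega>' - D = \<omega> - D \<and> A \<omega>'"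
        using insert.prems(2)[of \<omega>] insert.prems(2)[of "insert e \<omega>"] \<omega> True by auto
      then obtain \<omega>' where w: "\<omega>' \<subseteq> insert e F" "\<omega>' - D = \<omega> - D" "A \<omega>'" by blast
      have "?A (\<omega>' - {e})" using w by (cases "e \<in> \<omega>'") (auto simp: insert_absorb)
      moreover have "\<omega>' - {e} \<subseteq> F" "(\<omega>' - {e}) - ?D = \<omega> - ?D" using w e by auto
      ultimately show "\<exists>\<omega>'. \<omega>' \<subseteq> F \<and> \<omega>' - ?D = \<omega> - ?D \<and> ?A \<omega>'" by blast
    qed
    moreover have "pr p (insert e F) G \<le> pr p F ?G"
    proof -
      have "pr p (insert e F) G \<le> p * pr p F ?G + (1 - p) * pr p F ?G"
        unfolding ins by (intro pr_convex pr_mono) auto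
      then show ?thesis by (simp add: algebra_simps)
    qed
    moreover have "q * pr p F ?A \<le> pr p (insert e F) A"
    proof -
      have "pr p F ?A \<le> (\<Sum>i\<in>UNIV. pr p F (\<lambda>\<omega>. if i then A \<omega> else A (insert e \<omega>)))"
        by (rule pr_union) auto
      then have "pr p F ?A \<le> pr p F A + pr p F (\<lambda>\<omega>. A (insert e \<omega>))"
        by (simp add: UNIV_bool)
      then have "q * pr p F ?A \<le> q * pr p F (\<lambda>\<omega>. A (insert e \<omega>)) + q * pr p F A"
        using q(1) mult_left_mono[of "pr p F ?A" "pr p F A + pr p F (\<lambda>\<omega>. A (insert e \<omega>))" q] by (simp only: distrib_left add.commute)
      also have "\<dots> \<le> p * pr p F (\<lambda>\<omega>. A (insert e \<omega>)) + (1 - p) * pr p F A"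
        using q by (intro add_mono mult_right_mono) auto
      finally show ?thesis unfolding ins .
    qed
    moreover have "card D = Suc (card ?D)"
      using True insert.prems(1) insert.hyps(1) finite_subset
      by (metis card.remove finite_insert)
    ultimately show ?thesis
    proof -
      assume a: "q ^ card ?D * pr p F ?G \<le> pr p F ?A" "pr p (insert e F) G \<le> pr p F ?G"
        "q * pr p F ?A \<le> pr p (insert e F) A" "card D = Suc (card ?D)"
      have "q ^ card D * pr p (insert e F) G \<le> q * (q ^ card ?D * pr p F ?G)"
        using a(2) q(1) unfolding a(4) by (simp add: mult.assoc mult_left_mono)
      also have "\<dots> \<le> q * pr p F ?A" using a(1) q(1) by (rule mult_left_mono)
      finally show ?thesis using a(3) by linarith
    qed
  next
    case False
    then have D: "D \<subseteq> F" using insert.prems by auto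
    have 1: "q ^ card D * pr p F (\<lambda>\<omega>. G (insert e \<omega>)) \<le> pr p F (\<lambda>\<omega>. A (insert e \<omega>))"
    proof (rule insert.IH[OF D])
      fix \<omega> assume \<omega>: "\<omega> \<subseteq> F" "G (insert e \<omega>)"
      then obtain \<omega>' where w: "\<omega>' \<subseteq> insert e F" "\<omega>' - D = insert e \<omega> - D" "A \<omega>'"
        using insert.prems(2)[of "insert e \<omega>"] by auto
      have "e \<in> \<omega>'" using w False by auto
      then have "insert e (\<omega>' - {e}) = \<omega>'" by auto
      moreover have "e \<notin> \<omega>" using \<omega> insert.hyps by auto
      ultimately have "A (insert e (\<omega>' - {e}))" "\<omega>' - {e} \<subseteq> F" "(\<omega>' - {e}) - D = \<omega> - D"
        using w False by auto
      then show "\<exists>\<omega>'. \<omega>' \<subseteq> F \<and> \<omega>' - D = \<omega> - D \<and> A (insert e \<omega>')" by blast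
    qed
    have 0: "q ^ card D * pr p F G \<le> pr p F A"
    proof (rule insert.IH[OF D])
      fix \<omega> assume \<omega>: "\<omega> \<subseteq> F" "G \<omega>"
      then obtain \<omega>' where w: "\<omega>' \<subseteq> insert e F" "\<omega>' - D = \<omega> - D" "A \<omega>'"
        using insert.prems(2)[of \<omega>] by auto
      have "e \<notin> \<omega>" using \<omega> insert.hyps by auto
      then have "\<omega>' \<subseteq> F" using w False by auto
      then show "\<exists>\<omega>'. \<omega>' \<subseteq> F \<and> \<omega>' - D = \<omega> - D \<and> A \<omega>'" using w by blast
    qed
    show ?thesis unfolding ins using pr_convex[OF 1 0] by (simp add: algebra_simps)
  qed
qed

end

section \<open>Open paths\<close>

fun path_edges :: "'v list \<Rightarrow> 'v set set" where
  "path_edges (x # y # \<gamma>) = insert {x, y} (path_edges (y # \<gamma>))"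
| "path_edges _ = {}"

definition conn :: "'v set set \<Rightarrow> 'v set \<Rightarrow> 'v \<Rightarrow> 'v \<Rightarrow> bool" where
  "conn \<omega> A x y \<longleftrightarrow>
     (\<exists>\<gamma>. \<gamma> \<noteq> [] \<and> hd \<gamma> = x \<and> last \<gamma> = y \<and> set \<gamma> \<subseteq> A \<and> path_edges \<gamma> \<subseteq> \<omega>)"

lemma path_edges_Cons: "\<gamma> \<noteq> [] \<Longrightarrow> path_edges (x # \<gamma>) = insert {x, hd \<gamma>} (path_edges \<gamma>)"
  by (cases \<gamma>) auto

lemma path_edges_append:
  "\<alpha> \<noteq> [] \<Longrightarrow> \<beta> \<noteq> [] \<Longrightarrow>
   path_edges (\<alpha> @ \<beta>) = path_edges \<alpha> \<union> insert {last \<alpha>, hd \<beta>} (path_edges \<beta>)"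
  by (induction \<alpha> rule: path_edges.induct) (auto simp: path_edges_Cons)

lemma path_edges_join: "path_edges (\<alpha> @ v # \<beta>) = path_edges (\<alpha> @ [v]) \<union> path_edges (v # \<beta>)"
  by (cases "\<alpha> = []") (auto simp: path_edges_append)

lemma path_edges_rev: "path_edges (rev \<gamma>) = path_edges \<gamma>"
proof (induction \<gamma> rule: path_edges.induct)
  case (1 x y \<gamma>)
  have "path_edges (rev (x # y # \<gamma>)) = path_edges (rev (y # \<gamma>) @ [x])" by simp
  also have "\<dots> = path_edges (rev (y # \<gamma>)) \<union> {{y, x}}"
    by (subst path_edges_append) (auto simp: last_rev)
  also have "\<dots> = path_edges (x # y # \<gamma>)" using 1 by (auto simp: insert_commute)
  finally show ?case .
qed auto

lemma path_edges_subset: "e \<in> path_edges \<gamma> \<Longrightarrow> e \<subseteq> set \<gamma>"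
  by (induction \<gamma> rule: path_edges.induct) auto

lemma card_path_edge: "distinct \<gamma> \<Longrightarrow> e \<in> path_edges \<gamma> \<Longrightarrow> card e = 2"
  by (induction \<gamma> rule: path_edges.induct) auto

text \<open>The two pieces share only the vertex \<open>v\<close>, whereas an edge of a
  self-avoiding path has two endpoints.\<close>

lemma path_edges_disjoint:
  assumes "distinct (\<alpha> @ v # \<beta>)"
  shows "path_edges (\<alpha> @ [v]) \<inter> path_edges (v # \<beta>) = {}"
proof safe
  fix e assume e: "e \<in> path_edges (\<alpha> @ [v])" "e \<in> path_edges (v # \<beta>)"
  have "e \<subseteq> {v}" using path_edges_subset[OF e(1)] path_edges_subset[OF e(2)] assms by auto
  then have "card e \<le> 1" using card_mono[of "{v}" e] by simp
  moreover have "card e = 2" using card_path_edge[OF _ e(1)] assms by auto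
  ultimately show "e \<in> {}" by simp
qed

lemma connI:
  "\<gamma> \<noteq> [] \<Longrightarrow> set \<gamma> \<subseteq> A \<Longrightarrow> path_edges \<gamma> \<subseteq> \<omega> \<Longrightarrow> conn \<omega> A (hd \<gamma>) (last \<gamma>)"
  unfolding conn_def by blast

lemma conn_refl: "x \<in> A \<Longrightarrow> conn \<omega> A x x"
  using connI[of "[x]"] by simp

lemma conn_edge: "x \<in> A \<Longrightarrow> y \<in> A \<Longrightarrow> {x, y} \<in> \<omega> \<Longrightarrow> conn \<omega> A x y"
  using connI[of "[x, y]"] by simp

lemma conn_sym: "conn \<omega> A x y \<Longrightarrow> conn \<omega> A y x"
  unfolding conn_def
proof (elim exE conjE)
  fix \<gamma> assume "\<gamma> \<noteq> []" "hd \<gamma> = x" "last \<gamma> = y" "set \<gamma> \<subseteq> A" "path_edges \<gamma> \<subseteq> \<omega>"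
  then show "\<exists>\<gamma>. \<gamma> \<noteq> [] \<and> hd \<gamma> = y \<and> last \<gamma> = x \<and> set \<gamma> \<subseteq> A \<and> path_edges \<gamma> \<subseteq> \<omega>"
    by (intro exI[of _ "rev \<gamma>"]) (auto simp: hd_rev last_rev path_edges_rev)
qed

lemma conn_in: "conn \<omega> A x y \<Longrightarrow> x \<in> A \<and> y \<in> A"
  unfolding conn_def by (elim exE conjE) (blast dest: hd_in_set last_in_set)

lemma conn_mono: "conn \<omega> A x y \<Longrightarrow> \<omega> \<subseteq> \<omega>' \<Longrightarrow> A \<subseteq> B \<Longrightarrow> conn \<omega>' B x y"
  unfolding conn_def by (elim exE conjE) blast

lemma increasing_conn: "increasing (\<lambda>\<omega>. conn \<omega> A x y)"
  unfolding increasing_def by (intro allI impI) (rule conn_mono[OF _ _ order_refl])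

lemma conn_trans:
  assumes "conn \<omega> A x y" "conn \<omega> A y z" shows "conn \<omega> A x z"
proof -
  obtain \<alpha> where a: "\<alpha> \<noteq> []" "hd \<alpha> = x" "last \<alpha> = y" "set \<alpha> \<subseteq> A" "path_edges \<alpha> \<subseteq> \<omega>"
    using assms(1) unfolding conn_def by blast
  obtain \<beta> where b: "\<beta> \<noteq> []" "hd \<beta> = y" "last \<beta> = z" "set \<beta> \<subseteq> A" "path_edges \<beta> \<subseteq> \<omega>"
    using assms(2) unfolding conn_def by blast
  obtain \<beta>' where b': "\<beta> = y # \<beta>'" using b by (cases \<beta>) auto
  obtain \<alpha>' where a': "\<alpha> = \<alpha>' @ [y]" using a by (metis append_butlast_last_id)
  have "path_edges (\<alpha>' @ \<beta>) \<subseteq> \<omega>" using a(5) b(5) unfolding a' b' by (subst path_edges_join) auto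
  moreover have "hd (\<alpha>' @ \<beta>) = x" using a b' unfolding a' by (cases \<alpha>') auto
  ultimately show ?thesis using connI[of "\<alpha>' @ \<beta>" A \<omega>] a b unfolding a' by auto
qed

lemma conn_step: "conn \<omega> A x z \<Longrightarrow> z' \<in> A \<Longrightarrow> {z, z'} \<in> \<omega> \<Longrightarrow> conn \<omega> A x z'"
  by (rule conn_trans[OF _ conn_edge]) (auto dest: conn_in)

text \<open>The form in which connections are excluded: exhibit a set that contains the start, not
  the end, and that no open edge leaves.\<close>

lemma conn_closed:
  assumes "conn \<omega> A x y" "x \<in> Z"
    and "\<And>z z'. z \<in> Z \<Longrightarrow> z \<in> A \<Longrightarrow> z' \<in> A \<Longrightarrow> {z, z'} \<in> \<omega> \<Longrightarrow> z' \<in> Z"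
  shows "y \<in> Z"
proof -
  have "\<lbrakk>\<gamma> \<noteq> []; hd \<gamma> \<in> Z; set \<gamma> \<subseteq> A; path_edges \<gamma> \<subseteq> \<omega>\<rbrakk> \<Longrightarrow> last \<gamma> \<in> Z" for \<gamma>
  proof (induction \<gamma> rule: path_edges.induct)
    case (1 x y \<gamma>)
    then show ?case using assms(3)[of x y] by auto
  qed auto
  then show ?thesis using assms(1,2) unfolding conn_def by blast
qed

lemma conn_distinct:
  assumes "conn \<omega> A x y"
  obtains \<gamma> where "\<gamma> \<noteq> []" "hd \<gamma> = x" "last \<gamma> = y" "set \<gamma> \<subseteq> A" "path_edges \<gamma> \<subseteq> \<omega>" "distinct \<gamma>"
proof -
  let ?P = "\<lambda>\<gamma>. \<gamma> \<noteq> [] \<and> hd \<gamma> = x \<and> last \<gamma> = y \<and> set \<gamma> \<subseteq> A \<and> path_edges \<gamma> \<subseteq> \<omega>"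
  obtain \<gamma>0 where "?P \<gamma>0" using assms unfolding conn_def by blast
  from ex_has_least_nat[of ?P, OF this, of length] obtain \<gamma> where \<gamma>: "?P \<gamma>" and min: "\<And>\<gamma>'. ?P \<gamma>' \<Longrightarrow> length \<gamma> \<le> length \<gamma>'"
    by metis
  have "distinct \<gamma>"
  proof (rule ccontr)
    assume "\<not> distinct \<gamma>"
    then obtain xs v ys zs where d: "\<gamma> = xs @ [v] @ ys @ [v] @ zs"
      using not_distinct_decomp by blast
    have "path_edges (xs @ v # zs) \<subseteq> path_edges \<gamma>"
      using path_edges_join[of xs v zs] path_edges_join[of xs v "ys @ v # zs"]
        path_edges_join[of "v # ys" v zs] d by auto
    moreover have "hd (xs @ v # zs) = x" using \<gamma> d by (cases xs) auto
    moreover have "last (xs @ v # zs) = y" using \<gamma> d by simp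
    ultimately have "?P (xs @ v # zs)" using \<gamma> d by auto
    from min[OF this] show False using d by simp
  qed
  then show ?thesis using \<gamma> that by blast
qed

lemma conn_sub_path:
  assumes "path_edges (\<alpha> @ v # \<beta>) \<subseteq> \<omega>" "set (\<alpha> @ v # \<beta>) \<subseteq> A"
  shows "conn \<omega> A (hd (\<alpha> @ [v])) v" "conn \<omega> A v (last (v # \<beta>))"
  using assms connI[of "\<alpha> @ [v]" A \<omega>] connI[of "v # \<beta>" A \<omega>] path_edges_join[of \<alpha> v \<beta>] by auto

lemma disjoint_occurrence_path:
  assumes "distinct (\<alpha> @ v # \<beta>)" "path_edges (\<alpha> @ v # \<beta>) \<subseteq> \<omega>" "A (path_edges (\<alpha> @ [v]))" "B (path_edges (v # \<beta>))"
  shows "disjoint_occurrence A B \<omega>"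
  unfolding disjoint_occurrence_def
  using assms path_edges_disjoint[OF assms(1)] path_edges_join[of \<alpha> v \<beta>]
  by (intro exI[of _ "path_edges (\<alpha> @ [v])"] exI[of _ "path_edges (v # \<beta>)"]) auto

text \<open>A self-avoiding open path must meet \<open>C\<close>; cutting it at a common vertex
  gives edge-disjoint witnesses.\<close>

lemma conn_via:
  assumes "conn \<omega> A x y" "\<not> conn \<omega> (A - C) x y"
  obtains a where "a \<in> C" "a \<in> A" "disjoint_occurrence (\<lambda>\<omega>. conn \<omega> A x a) (\<lambda>\<omega>. conn \<omega> A a y) \<omega>"
proof -
  obtain \<gamma> where \<gamma>: "\<gamma> \<noteq> []" "hd \<gamma> = x" "last \<gamma> = y" "set \<gamma> \<subseteq> A" "path_edges \<gamma> \<subseteq> \<omega>" "distinct \<gamma>"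
    using conn_distinct[OF assms(1)] .
  have "\<not> set \<gamma> \<subseteq> A - C" using connI[of \<gamma> "A - C" \<omega>] \<gamma> assms(2) by auto
  then obtain a where a: "a \<in> set \<gamma>" "a \<in> C" using \<gamma>(4) by blast
  then obtain \<alpha> \<beta> where d: "\<gamma> = \<alpha> @ a # \<beta>" using split_list[of a \<gamma>] by auto
  have "disjoint_occurrence (\<lambda>\<omega>. conn \<omega> A x a) (\<lambda>\<omega>. conn \<omega> A a y) \<omega>"
  proof (rule disjoint_occurrence_path)
    have "hd (\<alpha> @ [a]) = x" using \<gamma>(2) d by (cases \<alpha>) auto
    then show "conn (path_edges (\<alpha> @ [a])) A x a"
      using connI[of "\<alpha> @ [a]" A "path_edges (\<alpha> @ [a])"] \<gamma>(4) d by auto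
    show "conn (path_edges (a # \<beta>)) A a y"
      using connI[of "a # \<beta>" A "path_edges (a # \<beta>)"] \<gamma>(3,4) d by auto
  qed (use \<gamma> d in auto)
  then show ?thesis using that a \<gamma>(4) by blast
qed

text \<open>Cut a self-avoiding path at the last vertex \<open>u\<close> before it first leaves
  \<open>S\<close>: the initial piece stays in \<open>S\<close>, and both pieces are
  edge-disjoint.\<close>

lemma conn_first_exit:
  assumes "conn \<omega> A w v" "w \<in> S" "v \<notin> S"
  obtains u z where "u \<in> S" "z \<notin> S" "{u, z} \<in> \<omega>" "conn \<omega> (S \<inter> A) w u"
    "disjoint_occurrence (\<lambda>\<omega>. conn \<omega> A w u) (\<lambda>\<omega>. conn \<omega> A u v) \<omega>"
proof -
  obtain \<gamma> where \<gamma>: "\<gamma> \<noteq> []" "hd \<gamma> = w" "last \<gamma> = v" "set \<gamma> \<subseteq> A" "path_edges \<gamma> \<subseteq> \<omega>" "distinct \<gamma>"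
    using conn_distinct[OF assms(1)] .
  have "\<exists>z\<in>set \<gamma>. z \<notin> S" using \<gamma> assms(3) last_in_set by blast
  then obtain \<alpha> z \<beta> where d: "\<gamma> = \<alpha> @ z # \<beta>" "z \<notin> S" "\<forall>a\<in>set \<alpha>. a \<in> S"
    using split_list_first_prop[of \<gamma> "\<lambda>z. z \<notin> S"] by blast
  have "\<alpha> \<noteq> []" using d \<gamma>(2) assms(2) by (cases \<alpha>) auto
  then obtain \<alpha>' u where a: "\<alpha> = \<alpha>' @ [u]" by (metis append_butlast_last_id)
  have u: "u \<in> S" using d a by auto
  have d': "\<gamma> = \<alpha>' @ u # z # \<beta>" using d a by simp
  have hd: "hd (\<alpha>' @ [u]) = w" using \<gamma>(2) d' by (cases \<alpha>') auto
  have e: "path_edges \<gamma> = path_edges (\<alpha>' @ [u]) \<union> insert {u, z} (path_edges (z # \<beta>))"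
    unfolding d' path_edges_join[of \<alpha>' u "z # \<beta>"] by simp
  have "conn \<omega> (S \<inter> A) w u"
    using connI[of "\<alpha>' @ [u]" "S \<inter> A" \<omega>] hd \<gamma>(4,5) e d a d' by auto
  moreover have "disjoint_occurrence (\<lambda>\<omega>. conn \<omega> A w u) (\<lambda>\<omega>. conn \<omega> A u v) \<omega>"
  proof (rule disjoint_occurrence_path)
    show "conn (path_edges (\<alpha>' @ [u])) A w u"
      using connI[of "\<alpha>' @ [u]" A "path_edges (\<alpha>' @ [u])"] \<gamma>(4) d' hd by auto
    show "conn (path_edges (u # z # \<beta>)) A u v"
      using connI[of "u # z # \<beta>" A "path_edges (u # z # \<beta>)"] \<gamma>(3,4) d' by auto
  qed (use \<gamma> d' in auto)
  ultimately show ?thesis using that[OF u d(2)] \<gamma>(5) e by blast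
qed

section \<open>The selected path and chains of its vertices\<close>

definition saws :: "'v set \<Rightarrow> 'v \<Rightarrow> 'v \<Rightarrow> 'v list set" where
  "saws S x y = {\<gamma>. distinct \<gamma> \<and> \<gamma> \<noteq> [] \<and> hd \<gamma> = x \<and> last \<gamma> = y \<and> set \<gamma> \<subseteq> S}"

text \<open>Any injective numbering would do: the selected path is the open one of least rank. For
  finite \<open>S\<close> such a numbering exists (\<open>inj_path_rank\<close>).\<close>

definition path_rank :: "'v set \<Rightarrow> 'v list \<Rightarrow> nat" where
  "path_rank S = (SOME f. inj_on f {\<gamma>. distinct \<gamma> \<and> set \<gamma> \<subseteq> S})"

text \<open>That \<open>\<gamma>\<close> is the selected path means that it is open and that a decreasing event occurs, so the
  selection does not make connections off \<open>\<gamma>\<close> more likely (\<open>harris_conditional\<close>).\<close>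

definition selected :: "'v set \<Rightarrow> 'v \<Rightarrow> 'v \<Rightarrow> 'v list \<Rightarrow> 'v set set \<Rightarrow> bool" where
  "selected S x y \<gamma> \<omega> \<longleftrightarrow> path_edges \<gamma> \<subseteq> \<omega> \<and>
     (\<forall>\<gamma>'\<in>saws S x y. path_rank S \<gamma>' < path_rank S \<gamma> \<longrightarrow> \<not> path_edges \<gamma>' \<subseteq> \<omega>)"

lemma finite_distinct_lists: "finite S \<Longrightarrow> finite {\<gamma>. distinct \<gamma> \<and> set \<gamma> \<subseteq> S}"
proof (rule finite_subset)
  show "{\<gamma>. distinct \<gamma> \<and> set \<gamma> \<subseteq> S} \<subseteq> {\<gamma>. set \<gamma> \<subseteq> S \<and> length \<gamma> \<le> card S}" if "finite S"
    using that by (auto simp: distinct_card[symmetric] card_mono)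
qed (rule finite_lists_length_le)

lemma finite_saws: "finite S \<Longrightarrow> finite (saws S x y)"
  by (rule finite_subset[OF _ finite_distinct_lists[of S]]) (auto simp: saws_def)

lemma inj_path_rank: "finite S \<Longrightarrow> inj_on (path_rank S) (saws S x y)"
proof -
  assume "finite S"
  then have "\<exists>f::'a list \<Rightarrow> nat. inj_on f {\<gamma>. distinct \<gamma> \<and> set \<gamma> \<subseteq> S}"
    using finite_imp_inj_to_nat_seg[OF finite_distinct_lists] by metis
  then have "inj_on (path_rank S) {\<gamma>. distinct \<gamma> \<and> set \<gamma> \<subseteq> S}"
    unfolding path_rank_def by (rule someI_ex)
  then show ?thesis by (rule inj_on_subset) (auto simp: saws_def)
qed

lemma conn_iff_saws: "conn \<omega> S x y \<longleftrightarrow> (\<exists>\<gamma>\<in>saws S x y. path_edges \<gamma> \<subseteq> \<omega>)"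
proof
  assume "conn \<omega> S x y"
  then obtain \<gamma> where "\<gamma> \<noteq> []" "hd \<gamma> = x" "last \<gamma> = y" "set \<gamma> \<subseteq> S" "path_edges \<gamma> \<subseteq> \<omega>" "distinct \<gamma>"
    by (rule conn_distinct)
  then show "\<exists>\<gamma>\<in>saws S x y. path_edges \<gamma> \<subseteq> \<omega>" unfolding saws_def by blast
qed (auto simp: saws_def conn_def)

lemma selected_unique:
  assumes "finite S" "conn \<omega> S x y"
  shows "\<exists>!\<gamma>. \<gamma> \<in> saws S x y \<and> selected S x y \<gamma> \<omega>"
proof -
  let ?P = "\<lambda>\<gamma>. \<gamma> \<in> saws S x y \<and> path_edges \<gamma> \<subseteq> \<omega>"
  obtain \<gamma> where \<gamma>: "?P \<gamma>" "\<And>\<gamma>'. ?P \<gamma>' \<Longrightarrow> path_rank S \<gamma> \<le> path_rank S \<gamma>'"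
    using assms(2) ex_has_least_nat[of ?P _ "path_rank S"] unfolding conn_iff_saws by blast
  show ?thesis
  proof (rule ex1I[of _ \<gamma>])
    show "\<gamma> \<in> saws S x y \<and> selected S x y \<gamma> \<omega>"
      using \<gamma> unfolding selected_def by (meson not_le)
    fix \<gamma>' assume "\<gamma>' \<in> saws S x y \<and> selected S x y \<gamma>' \<omega>"
    then have *: "\<gamma>' \<in> saws S x y" "path_edges \<gamma>' \<subseteq> \<omega>" "\<not> path_rank S \<gamma> < path_rank S \<gamma>'"
      using \<gamma> unfolding selected_def by blast+
    then have "path_rank S \<gamma>' = path_rank S \<gamma>" using \<gamma>(2)[of \<gamma>'] by auto
    then show "\<gamma>' = \<gamma>" using inj_path_rank[OF assms(1), of x y] *(1) \<gamma>(1)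
      unfolding inj_on_def by blast
  qed
qed

text \<open>Take \<open>w\<close> to be the last vertex on \<open>\<gamma>\<close> of a
  self-avoiding path to \<open>a\<close>. An edge of \<open>\<gamma>\<close> used after
  \<open>w\<close> would have both ends on \<open>\<gamma>\<close>, which is impossible.\<close>

lemma conn_off_path:
  assumes "conn \<omega> V x a" "x \<in> set \<gamma>"
  obtains w where "w \<in> set \<gamma>" "conn (\<omega> - path_edges \<gamma>) V w a"
proof -
  obtain \<pi> where \<pi>: "\<pi> \<noteq> []" "hd \<pi> = x" "last \<pi> = a" "set \<pi> \<subseteq> V" "path_edges \<pi> \<subseteq> \<omega>" "distinct \<pi>"
    using conn_distinct[OF assms(1)] .
  have "\<exists>w\<in>set \<pi>. w \<in> set \<gamma>" using \<pi> assms(2) hd_in_set by blast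
  then obtain \<alpha> w \<beta> where d: "\<pi> = \<alpha> @ w # \<beta>" "w \<in> set \<gamma>" "\<forall>z\<in>set \<beta>. z \<notin> set \<gamma>"
    using split_list_last_prop[of \<pi> "\<lambda>z. z \<in> set \<gamma>"] by blast
  have "path_edges (w # \<beta>) \<inter> path_edges \<gamma> = {}"
  proof safe
    fix e assume e: "e \<in> path_edges (w # \<beta>)" "e \<in> path_edges \<gamma>"
    have "e \<subseteq> {w}" using path_edges_subset[OF e(1)] path_edges_subset[OF e(2)] d by auto
    then have "card e \<le> 1" using card_mono[of "{w}" e] by simp
    moreover have "card e = 2" using card_path_edge[OF _ e(1)] \<pi> d by auto
    ultimately show "e \<in> {}" by simp
  qed
  then have "path_edges (w # \<beta>) \<subseteq> \<omega> - path_edges \<gamma>"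
    using \<pi>(5) d path_edges_join[of \<alpha> w \<beta>] by auto
  then have "conn (\<omega> - path_edges \<gamma>) V w a"
    using connI[of "w # \<beta>" V "\<omega> - path_edges \<gamma>"] \<pi> d by auto
  then show ?thesis using that d(2) by blast
qed

text \<open>Nested to the right so that \<open>bk\<close> removes one link at a time. The stretch
  from the last listed vertex to the endpoint of the path is dropped on purpose, so the endpoint
  does not enter.\<close>

fun chain :: "'v set \<Rightarrow> 'v \<Rightarrow> 'v list \<Rightarrow> 'v set set \<Rightarrow> bool" where
  "chain S x [] = (\<lambda>_. True)"
| "chain S x (w # ws) = disjoint_occurrence (\<lambda>\<omega>. conn \<omega> S x w) (chain S w ws)"

lemma increasing_chain: "increasing (chain S x ws)"
  by (cases ws) (auto simp: increasing_disjoint_occurrence, simp add: increasing_def)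

lemma chain_subseq:
  assumes "distinct \<gamma>" "\<gamma> \<noteq> []" "set \<gamma> \<subseteq> S" "path_edges \<gamma> \<subseteq> \<omega>" "subseq ws \<gamma>"
  shows "chain S (hd \<gamma>) ws \<omega>"
  using assms
proof (induction ws arbitrary: \<gamma> \<omega>)
  case (Cons w ws)
  obtain \<alpha> \<beta> where d: "\<gamma> = \<alpha> @ w # \<beta>" "subseq ws \<beta>"
    using Cons.prems(5) by (auto dest: list_emb_ConsD)
  have "chain S (hd (w # \<beta>)) ws (path_edges (w # \<beta>))"
    by (rule Cons.IH) (use Cons.prems d subseq_order.order_trans[of ws \<beta> "w # \<beta>"] in auto)
  moreover have "hd (\<alpha> @ [w]) = hd \<gamma>" unfolding d by (cases \<alpha>) auto
  then have "conn (path_edges (\<alpha> @ [w])) S (hd \<gamma>) w"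
    using connI[of "\<alpha> @ [w]" S "path_edges (\<alpha> @ [w])"] Cons.prems(3) d by auto
  ultimately show ?case unfolding chain.simps
    by (intro disjoint_occurrence_path[of \<alpha> w \<beta>]) (use Cons.prems d in auto)
qed simp

text \<open>Filtering \<open>\<gamma>\<close> by an \<open>m\<close>-subset of its vertices in
  \<open>B\<close> is injective, so binomial moments of the number of visits count ordered
  visits.\<close>

lemma card_subseq_ge:
  assumes "distinct \<gamma>"
  shows "card (set \<gamma> \<inter> B) choose m \<le> card {ws. length ws = m \<and> set ws \<subseteq> B \<and> subseq ws \<gamma>}"
proof -
  let ?P = "{T. T \<subseteq> set \<gamma> \<inter> B \<and> card T = m}"
  let ?Q = "{ws. length ws = m \<and> set ws \<subseteq> B \<and> subseq ws \<gamma>}"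
  let ?f = "\<lambda>T. filter (\<lambda>w. w \<in> T) \<gamma>"
  have "card (set \<gamma> \<inter> B) choose m = card ?P"
    by (rule n_subsets[symmetric]) auto
  also have "\<dots> \<le> card ?Q"
  proof (rule card_inj_on_le)
    show "inj_on ?f ?P"
    proof (rule inj_onI)
      fix T T' assume *: "T \<in> ?P" "T' \<in> ?P"
        "?f T = ?f T'"
      have "set (?f T) = T" "set (?f T') = T'" using *(1,2) by auto
      then show "T = T'" using *(3) by simp
    qed
    show "?f ` ?P \<subseteq> ?Q"
    proof safe
      fix T assume T: "T \<subseteq> set \<gamma> \<inter> B" "m = card T"
      have "set (?f T) = T" using T by auto
      then show "length (?f T) = card T"
        using distinct_card[of "?f T"] assms by simp
    qed auto
    show "finite ?Q"
      by (rule finite_subset[OF _ finite_lists_length_eq[of "set \<gamma>" m]]) (auto dest: list_emb_set)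
  qed
  finally show ?thesis .
qed

section \<open>Connection probabilities in a finite graph\<close>

lemma increasing_not_selected_part:
  "increasing (\<lambda>\<omega>. \<not> (\<forall>\<gamma>'\<in>saws S x y. path_rank S \<gamma>' < path_rank S \<gamma> \<longrightarrow> \<not> path_edges \<gamma>' \<subseteq> \<omega>))"
  unfolding increasing_def by (intro allI impI) blast

text \<open>The event that the cluster of \<open>x\<close> equals \<open>C\<close> is determined by
  the edges touching \<open>C\<close>; together with \<open>conn_agree\<close> this leaves the other
  edges independent in \<open>exploration\<close>.\<close>

lemma cluster_agree:
  assumes "x \<in> V" "\<And>e. e \<inter> C \<noteq> {} \<Longrightarrow> e \<in> \<omega> \<longleftrightarrow> e \<in> \<omega>'" "{z. conn \<omega> V x z} = C"
  shows "{z. conn \<omega>' V x z} = C"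
proof (rule antisym; rule subsetI)
  fix z assume "z \<in> {z. conn \<omega>' V x z}"
  then have "conn \<omega>' V x z" by simp
  then show "z \<in> C"
  proof (rule conn_closed)
    show "x \<in> C" using assms(3) conn_refl[OF assms(1)] by auto
    fix z z' assume "z \<in> C" "z \<in> V" "z' \<in> V" "{z, z'} \<in> \<omega>'"
    then show "z' \<in> C" using assms(2)[of "{z, z'}"] assms(3) conn_step[of \<omega> V x z z'] by auto
  qed
next
  fix z assume "z \<in> C"
  then have "conn \<omega> V x z" using assms(3) by blast
  then have "z \<in> {z. conn \<omega>' V x z \<and> z \<in> C}"
  proof (rule conn_closed)
    show "x \<in> {z. conn \<omega>' V x z \<and> z \<in> C}" using assms(3) conn_refl[OF assms(1)] by auto
    fix z z' assume z: "z \<in> {z. conn \<omega>' V x z \<and> z \<in> C}" "z \<in> V" "z' \<in> V" "{z, z'} \<in> \<omega>"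
    then have "{z, z'} \<in> \<omega>'" using assms(2)[of "{z, z'}"] by auto
    then have "conn \<omega>' V x z'" using z conn_step[of \<omega>' V x z z'] by simp
    moreover have "conn \<omega> V x z'"
      using z assms(3) conn_step[of \<omega> V x z z'] by blast
    ultimately show "z' \<in> {z. conn \<omega>' V x z \<and> z \<in> C}" using assms(3) by blast
  qed
  then show "z \<in> {z. conn \<omega>' V x z}" by blast
qed

lemma conn_agree:
  assumes "\<And>e. e \<inter> C \<noteq> {} \<Longrightarrow> e \<in> \<omega> \<longleftrightarrow> e \<in> \<omega>'" "{z. conn \<omega> V x z} = C" "S \<subseteq> V" "conn \<omega> S x u"
  shows "conn \<omega>' S x u"
proof -
  have x: "x \<in> S" using conn_in[OF assms(4)] by simp
  have "u \<in> {z. conn \<omega>' S x z \<and> z \<in> C}" using assms(4)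
  proof (rule conn_closed)
    show "x \<in> {z. conn \<omega>' S x z \<and> z \<in> C}" using x assms(2,3) conn_refl[of x] by auto
    fix z z' assume z: "z \<in> {z. conn \<omega>' S x z \<and> z \<in> C}" "z \<in> S" "z' \<in> S" "{z, z'} \<in> \<omega>"
    then have "{z, z'} \<in> \<omega>'" using assms(1)[of "{z, z'}"] by auto
    then have "conn \<omega>' S x z'" using z conn_step[of \<omega>' S x z z'] by simp
    moreover have "z \<in> V" "z' \<in> V" using z assms(3) by auto
    then have "conn \<omega> V x z'"
      using z assms(2) conn_step[of \<omega> V x z z'] by blast
    ultimately show "z' \<in> {z. conn \<omega>' S x z \<and> z \<in> C}" using assms(2) by blast
  qed
  then show ?thesis by blast
qed

locale finite_percolation = prob_weight p for p :: real +
  fixes F :: "'v set set" and V :: "'v set"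
  assumes finite_F: "finite F" and finite_V: "finite V"
begin

definition T :: "'v set \<Rightarrow> 'v \<Rightarrow> 'v \<Rightarrow> real" where
  "T A x y = pr p F (\<lambda>\<omega>. conn \<omega> A x y)"

definition inner_boundary :: "'v set \<Rightarrow> 'v set" where
  "inner_boundary S = {u \<in> S. \<exists>z. z \<notin> S \<and> {u, z} \<in> F}"

text \<open>At most one path is selected, so this is the probability that \<open>x\<close> and
  \<open>y\<close> are connected in \<open>S\<close> and the selected path passes through
  \<open>w\<close>, without conditioning on the connection.\<close>

definition visit :: "'v set \<Rightarrow> 'v \<Rightarrow> 'v \<Rightarrow> 'v \<Rightarrow> real" where
  "visit S x y w = (\<Sum>\<gamma>\<in>{\<gamma> \<in> saws S x y. w \<in> set \<gamma>}. pr p F (selected S x y \<gamma>))"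

lemma T_nonneg [simp]: "0 \<le> T A x y" by (simp add: T_def)

lemma T_mono: "A \<subseteq> B \<Longrightarrow> T A x y \<le> T B x y"
  unfolding T_def by (rule pr_mono) (rule conn_mono[OF _ order_refl])

lemma T_refl: "x \<in> A \<Longrightarrow> T A x x = 1"
  unfolding T_def by (simp add: conn_refl pr_True finite_F)

lemma T_harris: "T A x y * T A y z \<le> T A x z"
proof -
  have "T A x y * T A y z \<le> pr p F (\<lambda>\<omega>. conn \<omega> A x y \<and> conn \<omega> A y z)"
    unfolding T_def by (rule harris) (auto simp: finite_F increasing_conn)
  also have "\<dots> \<le> T A x z" unfolding T_def by (rule pr_mono) (blast intro: conn_trans)
  finally show ?thesis .
qed

lemma T_disjoint_occurrence:
  "pr p F (disjoint_occurrence (\<lambda>\<omega>. conn \<omega> A x a) (\<lambda>\<omega>. conn \<omega> B b y)) \<le> T A x a * T B b y"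
  unfolding T_def by (rule bk) (auto simp: finite_F increasing_conn)

text \<open>Meant as a lower bound for connections that avoid an already explored cluster
  \<open>C\<close>; the error is van den Berg--Kesten at a vertex of \<open>C\<close>.\<close>

lemma T_via:
  assumes "finite C"
  shows "T A x y \<le> T (A - C) x y + (\<Sum>a\<in>C. T A x a * T A a y)"
proof -
  have "T A x y \<le> pr p F (\<lambda>\<omega>. conn \<omega> (A - C) x y) + pr p F (\<lambda>\<omega>. conn \<omega> A x y \<and> \<not> conn \<omega> (A - C) x y)"
    unfolding T_def by (rule pr_split)
  also have "pr p F (\<lambda>\<omega>. conn \<omega> A x y \<and> \<not> conn \<omega> (A - C) x y)
     \<le> (\<Sum>a\<in>C. pr p F (disjoint_occurrence (\<lambda>\<omega>. conn \<omega> A x a) (\<lambda>\<omega>. conn \<omega> A a y)))"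
    by (rule pr_union[OF assms]) (blast elim: conn_via)
  also have "\<dots> \<le> (\<Sum>a\<in>C. T A x a * T A a y)"
    by (intro sum_mono T_disjoint_occurrence)
  finally show ?thesis by (simp add: T_def)
qed

text \<open>Either some boundary point in \<open>D\<close> is reached inside \<open>S\<close>, or
  the path leaves \<open>S\<close> through a point outside \<open>D\<close>, which splits it into
  two disjoint connections.\<close>

lemma T_first_exit:
  assumes "S \<subseteq> V" "w \<in> S" "v \<notin> S"
  shows "T V w v \<le> (\<Sum>u\<in>inner_boundary S \<inter> D. T S w u) + (\<Sum>t\<in>S - D. T V w t * T V t v)"
proof -
  have fin: "finite S" using assms finite_V finite_subset by blast
  let ?A = "\<lambda>\<omega>. \<exists>u\<in>inner_boundary S \<inter> D. conn \<omega> S w u"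
  have fin': "finite (inner_boundary S \<inter> D)" using fin by (auto simp: inner_boundary_def)
  have "T V w v \<le> pr p F ?A + pr p F (\<lambda>\<omega>. conn \<omega> V w v \<and> \<not> ?A \<omega>)"
    unfolding T_def by (rule pr_split)
  also have "pr p F ?A \<le> (\<Sum>u\<in>inner_boundary S \<inter> D. T S w u)"
    unfolding T_def by (rule pr_union[OF fin'])
  also have "pr p F (\<lambda>\<omega>. conn \<omega> V w v \<and> \<not> ?A \<omega>)
     \<le> (\<Sum>t\<in>S - D. pr p F (disjoint_occurrence (\<lambda>\<omega>. conn \<omega> V w t) (\<lambda>\<omega>. conn \<omega> V t v)))"
  proof (rule pr_union)
    fix \<omega> assume \<omega>: "\<omega> \<subseteq> F" "conn \<omega> V w v \<and> \<not> ?A \<omega>"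
    then obtain u z where u: "u \<in> S" "z \<notin> S" "{u, z} \<in> \<omega>" "conn \<omega> (S \<inter> V) w u"
      "disjoint_occurrence (\<lambda>\<omega>. conn \<omega> V w u) (\<lambda>\<omega>. conn \<omega> V u v) \<omega>"
      using conn_first_exit[of \<omega> V w v S] assms by blast
    then have "u \<in> inner_boundary S" using \<omega>(1) by (auto simp: inner_boundary_def)
    moreover have "conn \<omega> S w u" using u(4) assms(1) by (simp add: Int_absorb2)
    ultimately have "u \<notin> D" using \<omega>(2) by blast
    then show "\<exists>t\<in>S - D. disjoint_occurrence (\<lambda>\<omega>. conn \<omega> V w t) (\<lambda>\<omega>. conn \<omega> V t v) \<omega>"
      using u by blast
  qed (use fin in auto)
  also have "\<dots> \<le> (\<Sum>t\<in>S - D. T V w t * T V t v)"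
    by (intro sum_mono T_disjoint_occurrence)
  finally show ?thesis by simp
qed

lemma visit_nonneg [simp]: "0 \<le> visit S x y w"
  unfolding visit_def by (intro sum_nonneg) simp

lemma selected_disjoint_union:
  assumes "finite S" "I \<subseteq> saws S x y" "\<And>\<gamma> \<omega>. \<gamma> \<in> I \<Longrightarrow> selected S x y \<gamma> \<omega> \<Longrightarrow> A \<omega>"
  shows "(\<Sum>\<gamma>\<in>I. pr p F (selected S x y \<gamma>)) \<le> pr p F A"
proof (rule pr_disjoint_union)
  show "finite I" using assms finite_saws finite_subset by metis
  fix \<omega> \<gamma> \<gamma>' assume *: "\<gamma> \<in> I" "\<gamma>' \<in> I" "selected S x y \<gamma> \<omega>" "selected S x y \<gamma>' \<omega>"
  then have "conn \<omega> S x y" using assms(2) unfolding conn_iff_saws selected_def by blast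
  then show "\<gamma> = \<gamma>'" using selected_unique[OF assms(1)] * assms(2) by blast
qed (use assms(3) in blast)

lemma sum_selected:
  assumes "finite S"
  shows "(\<Sum>\<gamma>\<in>saws S x y. pr p F (selected S x y \<gamma>)) \<le> T S x y"
  unfolding T_def
  by (rule selected_disjoint_union[OF assms order_refl]) (auto simp: conn_iff_saws selected_def)

text \<open>A path to \<open>a\<close> finally leaves the selected path at some \<open>w\<close>,
  and by \<open>harris_conditional\<close> the selection does not help the connection from
  \<open>w\<close> to \<open>a\<close>. Thus branch points are counted along one path rather than
  along the whole cluster.\<close>

lemma conn_both_le_visit:
  assumes "S \<subseteq> V"
  shows "pr p F (\<lambda>\<omega>. conn \<omega> S x u \<and> conn \<omega> V x a) \<le> (\<Sum>w\<in>S. visit S x u w * T V w a)"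
proof -
  have fin: "finite S" using assms finite_V finite_subset by blast
  let ?I = "Sigma (saws S x u) set"
  have finI: "finite ?I" using finite_saws[OF fin] by auto
  have "pr p F (\<lambda>\<omega>. conn \<omega> S x u \<and> conn \<omega> V x a)
     \<le> (\<Sum>(\<gamma>, w)\<in>?I. pr p F (\<lambda>\<omega>. selected S x u \<gamma> \<omega> \<and> conn (\<omega> - path_edges \<gamma>) V w a))"
    unfolding case_prod_beta
  proof (rule pr_union[OF finI])
    fix \<omega> assume \<omega>: "conn \<omega> S x u \<and> conn \<omega> V x a"
    obtain \<gamma> where \<gamma>: "\<gamma> \<in> saws S x u" "selected S x u \<gamma> \<omega>"
      using selected_unique[OF fin] \<omega> by metis
    have "x \<in> set \<gamma>" using \<gamma> unfolding saws_def by auto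
    then obtain w where "w \<in> set \<gamma>" "conn (\<omega> - path_edges \<gamma>) V w a"
      using conn_off_path \<omega> by metis
    then show "\<exists>i\<in>?I. selected S x u (fst i) \<omega> \<and> conn (\<omega> - path_edges (fst i)) V (snd i) a"
      using \<gamma> by (intro bexI[of _ "(\<gamma>, w)"]) auto
  qed
  also have "\<dots> \<le> (\<Sum>(\<gamma>, w)\<in>?I. pr p F (selected S x u \<gamma>) * T V w a)"
  proof (rule sum_mono, clarify)
    fix \<gamma> w assume "\<gamma> \<in> saws S x u" "w \<in> set \<gamma>"
    let ?D = "\<lambda>\<omega>. \<forall>\<gamma>'\<in>saws S x u. path_rank S \<gamma>' < path_rank S \<gamma> \<longrightarrow> \<not> path_edges \<gamma>' \<subseteq> \<omega>"
    show "pr p F (\<lambda>\<omega>. selected S x u \<gamma> \<omega> \<and> conn (\<omega> - path_edges \<gamma>) V w a) \<le> pr p F (selected S x u \<gamma>) * T V w a"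
    proof (cases "path_edges \<gamma> \<subseteq> F")
      case True
      have "pr p F (\<lambda>\<omega>. path_edges \<gamma> \<subseteq> \<omega> \<and> ?D \<omega> \<and> conn (\<omega> - path_edges \<gamma>) V w a)
        \<le> pr p F (\<lambda>\<omega>. path_edges \<gamma> \<subseteq> \<omega> \<and> ?D \<omega>) * pr p F (\<lambda>\<omega>. conn \<omega> V w a)"
        by (rule harris_conditional[OF finite_F True increasing_not_selected_part increasing_conn])
      then show ?thesis unfolding T_def selected_def by simp
    next
      case False
      have "pr p F (\<lambda>\<omega>. selected S x u \<gamma> \<omega> \<and> conn (\<omega> - path_edges \<gamma>) V w a) = pr p F (\<lambda>_. False)"
        by (rule pr_cong) (use False in \<open>auto simp: selected_def\<close>)
      then show ?thesis by simp
    qed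
  qed
  also have "\<dots> = (\<Sum>\<gamma>\<in>saws S x u. \<Sum>w\<in>set \<gamma>. pr p F (selected S x u \<gamma>) * T V w a)"
    by (rule sum.Sigma[symmetric]) (use finite_saws[OF fin] in auto)
  also have "\<dots> = (\<Sum>\<gamma>\<in>saws S x u. \<Sum>w\<in>{w\<in>S. w \<in> set \<gamma>}. pr p F (selected S x u \<gamma>) * T V w a)"
    by (intro sum.cong refl) (auto simp: saws_def)
  also have "\<dots> = (\<Sum>w\<in>S. \<Sum>\<gamma>\<in>{\<gamma>\<in>saws S x u. w \<in> set \<gamma>}. pr p F (selected S x u \<gamma>) * T V w a)"
    by (rule sum.swap_restrict) (use fin finite_saws in auto)
  also have "\<dots> = (\<Sum>w\<in>S. visit S x u w * T V w a)"
    unfolding visit_def by (simp add: sum_distrib_right)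
  finally show ?thesis .
qed

text \<open>Truncation at \<open>n\<close>: beyond it, \<open>N \<le> N ^ m / n ^ (m - 1)\<close>
  and \<open>(N / m) ^ m \<le> N choose m\<close>.\<close>

lemma le_binomial:
  fixes n :: real
  assumes "1 \<le> m" "real m \<le> n"
  shows "real N \<le> n + real m ^ m / n ^ (m - 1) * real (N choose m)"
proof (cases "real N \<le> n")
  case True
  then show ?thesis using assms by (simp add: add_increasing2)
next
  case False
  then have N: "m \<le> N" "n \<le> N" using assms by auto
  have "(real N / real m) ^ m \<le> real (N choose m)"
    by (rule binomial_ge_n_over_k_pow_k[OF N(1)])
  then have 1: "real N ^ m \<le> real m ^ m * real (N choose m)"
    using assms by (simp add: power_divide divide_le_eq mult.commute)
  have "real N * n ^ (m - 1) \<le> real N * real N ^ (m - 1)"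
    using N assms by (intro mult_left_mono power_mono) auto
  also have "\<dots> = real N ^ m" using assms(1) by (cases m) auto
  finally have "real N \<le> real m ^ m * real (N choose m) / n ^ (m - 1)"
    using 1 assms by (subst pos_le_divide_eq) auto
  then show ?thesis using assms by auto
qed

text \<open>\<open>le_binomial\<close> with \<open>N\<close> the number of visits of the selected
  path to \<open>B\<close>; every \<open>m\<close> visited vertices, in their order on the path,
  form a chain.\<close>

lemma sum_visit_le:
  fixes n :: real
  assumes "finite S" "B \<subseteq> S" "1 \<le> m" "real m \<le> n"
  shows "(\<Sum>w\<in>B. visit S x u w) \<le> n * T S x u +
    real m ^ m / n ^ (m - 1) * (\<Sum>ws\<in>{ws. set ws \<subseteq> B \<and> length ws = m}. pr p F (chain S x ws))"
proof -
  have finB: "finite B" using assms finite_subset by blast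
  let ?L = "{ws. set ws \<subseteq> B \<and> length ws = m}" and ?q = "\<lambda>\<gamma>. pr p F (selected S x u \<gamma>)"
  let ?c = "real m ^ m / n ^ (m - 1)"
  have finL: "finite ?L" by (rule finite_lists_length_eq[OF finB])
  have c: "0 \<le> ?c" using assms by auto
  have "(\<Sum>w\<in>B. visit S x u w) = (\<Sum>\<gamma>\<in>saws S x u. \<Sum>w\<in>{w\<in>B. w \<in> set \<gamma>}. ?q \<gamma>)"
    unfolding visit_def by (rule sum.swap_restrict) (use finB finite_saws assms(1) in auto)
  also have "\<dots> = (\<Sum>\<gamma>\<in>saws S x u. real (card (set \<gamma> \<inter> B)) * ?q \<gamma>)"
    by (intro sum.cong refl) (simp add: Int_def conj_commute)
  also have "\<dots> \<le> (\<Sum>\<gamma>\<in>saws S x u. (n + ?c * real (card (set \<gamma> \<inter> B) choose m)) * ?q \<gamma>)"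
    by (intro sum_mono mult_right_mono le_binomial) (use assms in auto)
  also have "\<dots> = n * (\<Sum>\<gamma>\<in>saws S x u. ?q \<gamma>) + ?c * (\<Sum>\<gamma>\<in>saws S x u. real (card (set \<gamma> \<inter> B) choose m) * ?q \<gamma>)"
    by (simp add: distrib_right sum.distrib sum_distrib_left mult.assoc)
  also have "(\<Sum>\<gamma>\<in>saws S x u. real (card (set \<gamma> \<inter> B) choose m) * ?q \<gamma>)
     \<le> (\<Sum>\<gamma>\<in>saws S x u. real (card {ws\<in>?L. subseq ws \<gamma>}) * ?q \<gamma>)"
  proof (intro sum_mono mult_right_mono)
    fix \<gamma> assume "\<gamma> \<in> saws S x u"
    then have "card (set \<gamma> \<inter> B) choose m \<le> card {ws. length ws = m \<and> set ws \<subseteq> B \<and> subseq ws \<gamma>}"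
      by (intro card_subseq_ge) (auto simp: saws_def)
    also have "{ws. length ws = m \<and> set ws \<subseteq> B \<and> subseq ws \<gamma>} = {ws\<in>?L. subseq ws \<gamma>}" by auto
    finally show "real (card (set \<gamma> \<inter> B) choose m) \<le> real (card {ws\<in>?L. subseq ws \<gamma>})" by simp
  qed simp
  also have "\<dots> = (\<Sum>\<gamma>\<in>saws S x u. \<Sum>ws\<in>{ws\<in>?L. subseq ws \<gamma>}. ?q \<gamma>)" by simp
  also have "\<dots> = (\<Sum>ws\<in>?L. \<Sum>\<gamma>\<in>{\<gamma>\<in>saws S x u. subseq ws \<gamma>}. ?q \<gamma>)"
    by (rule sum.swap_restrict) (use finL finite_saws assms(1) in auto)
  also have "\<dots> \<le> (\<Sum>ws\<in>?L. pr p F (chain S x ws))"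
  proof (intro sum_mono selected_disjoint_union[OF assms(1)])
    fix ws \<gamma> \<omega> assume *: "\<gamma> \<in> {\<gamma> \<in> saws S x u. subseq ws \<gamma>}" "selected S x u \<gamma> \<omega>"
    then show "chain S x ws \<omega>"
      using chain_subseq[of \<gamma> S \<omega> ws] unfolding saws_def selected_def by auto
  qed auto
  finally show ?thesis using sum_selected[OF assms(1), of x u] assms c
    by (smt (verit, ccfv_SIG) mult_left_mono of_nat_0_le_iff)
qed

lemma sum_lists_Suc:
  "(\<Sum>ws\<in>{ws. set ws \<subseteq> B \<and> length ws = Suc m}. f ws)
    = (\<Sum>w\<in>B. \<Sum>ws\<in>{ws. set ws \<subseteq> B \<and> length ws = m}. f (w # ws))"
proof -
  have "{ws. set ws \<subseteq> B \<and> length ws = Suc m} = (\<lambda>(w, ws). w # ws) ` (B \<times> {ws. set ws \<subseteq> B \<and> length ws = m})"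
    by (auto simp: length_Suc_conv image_iff)
  moreover have "inj_on (\<lambda>(w, ws). w # ws) (B \<times> {ws. set ws \<subseteq> B \<and> length ws = m})"
    by (auto simp: inj_on_def)
  ultimately show ?thesis
    by (simp only: sum.reindex sum.cartesian_product) (simp add: case_prod_beta)
qed

text \<open>By van den Berg--Kesten each link after the first contributes at most a factor
  \<open>K\<close>.\<close>

lemma sum_chain_le:
  assumes "\<And>w. w \<in> B \<Longrightarrow> (\<Sum>z\<in>B. T S w z) \<le> K" "0 \<le> K"
  shows "(\<Sum>ws\<in>{ws. set ws \<subseteq> B \<and> length ws = Suc m}. pr p F (chain S x ws)) \<le> (\<Sum>w\<in>B. T S x w) * K ^ m"
proof (induction m arbitrary: x)
  case 0
  have [simp]: "{ws. set ws \<subseteq> B \<and> ws = []} = {[]}" by auto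
  have "pr p F (disjoint_occurrence (\<lambda>\<omega>. conn \<omega> S x w) (\<lambda>_. True)) \<le> T S x w" for w
    unfolding T_def disjoint_occurrence_def by (rule pr_mono) (blast intro: conn_mono)
  then show ?case unfolding sum_lists_Suc by (auto intro!: sum_mono)
next
  case (Suc m)
  let ?L = "{ws. set ws \<subseteq> B \<and> length ws = Suc m}"
  have "(\<Sum>ws\<in>{ws. set ws \<subseteq> B \<and> length ws = Suc (Suc m)}. pr p F (chain S x ws))
     = (\<Sum>w\<in>B. \<Sum>ws\<in>?L. pr p F (chain S x (w # ws)))"
    by (rule sum_lists_Suc)
  also have "\<dots> \<le> (\<Sum>w\<in>B. \<Sum>ws\<in>?L. T S x w * pr p F (chain S w ws))"
    unfolding chain.simps T_def
    by (intro sum_mono bk) (auto simp: finite_F increasing_conn increasing_chain)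
  also have "\<dots> = (\<Sum>w\<in>B. T S x w * (\<Sum>ws\<in>?L. pr p F (chain S w ws)))"
    by (simp add: sum_distrib_left)
  also have "\<dots> \<le> (\<Sum>w\<in>B. T S x w * (K * K ^ m))"
  proof (intro sum_mono mult_left_mono T_nonneg)
    fix w assume "w \<in> B"
    then show "(\<Sum>ws\<in>?L. pr p F (chain S w ws)) \<le> K * K ^ m"
      using Suc.IH[of w] assms mult_right_mono[OF assms(1), of w "K ^ m"] by fastforce
  qed
  finally show ?case by (simp add: sum_distrib_right)
qed

text \<open>Decompose by the cluster \<open>C\<close> of \<open>x\<close>. The edges off
  \<open>C\<close> are fresh, so \<open>y\<close> reaches \<open>z\<close> there with probability
  \<open>T (V - C) y z\<close>, to which \<open>T_via\<close> applies; averaging its error over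
  \<open>C\<close> gives the subtracted sum.\<close>

lemma exploration:
  assumes "S \<subseteq> V" "x \<in> S" "y \<in> V"
  shows "T S x u * T V y z - (\<Sum>a\<in>V. pr p F (\<lambda>\<omega>. conn \<omega> S x u \<and> conn \<omega> V x a) * (T V y a * T V a z))
    \<le> pr p F (\<lambda>\<omega>. conn \<omega> S x u \<and> \<not> conn \<omega> V x y \<and> conn \<omega> V y z)"
proof -
  let ?C = "\<lambda>\<omega>. {z. conn \<omega> V x z}"
  let ?G = "\<lambda>\<omega>. conn \<omega> S x u \<and> \<not> conn \<omega> V x y \<and> conn \<omega> V y z"
  let ?H = "\<lambda>C \<omega>. ?C \<omega> = C \<and> conn \<omega> S x u"
  let ?h = "\<lambda>C. pr p F (?H C)"
  have finP: "finite (Pow V)" using finite_V by simp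
  have x: "x \<in> V" using assms by auto
  have CV: "?C \<omega> \<in> Pow V" for \<omega> using conn_in by fastforce
  have tot: "pr p F (\<lambda>\<omega>. conn \<omega> S x u \<and> A \<omega>) = (\<Sum>C\<in>Pow V. pr p F (\<lambda>\<omega>. ?C \<omega> = C \<and> (conn \<omega> S x u \<and> A \<omega>)))" for A
    by (rule pr_total[OF finP]) (use CV in blast)
  have T1: "T S x u = (\<Sum>C\<in>Pow V. ?h C)"
    using tot[of "\<lambda>_. True"] by (simp add: T_def)
  have T2: "pr p F (\<lambda>\<omega>. conn \<omega> S x u \<and> conn \<omega> V x a) = (\<Sum>C\<in>{C\<in>Pow V. a \<in> C}. ?h C)" for a
  proof -
    have "pr p F (\<lambda>\<omega>. conn \<omega> S x u \<and> conn \<omega> V x a)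
       = (\<Sum>C\<in>Pow V. pr p F (\<lambda>\<omega>. ?C \<omega> = C \<and> (conn \<omega> S x u \<and> conn \<omega> V x a)))" by (rule tot)
    also have "\<dots> = (\<Sum>C\<in>Pow V. if a \<in> C then ?h C else 0)"
    proof (rule sum.cong[OF refl])
      fix C
      show "pr p F (\<lambda>\<omega>. ?C \<omega> = C \<and> (conn \<omega> S x u \<and> conn \<omega> V x a)) = (if a \<in> C then ?h C else 0)"
      proof (cases "a \<in> C")
        case True
        then show ?thesis by (auto intro!: pr_cong)
      next
        case False
        have "pr p F (\<lambda>\<omega>. ?C \<omega> = C \<and> (conn \<omega> S x u \<and> conn \<omega> V x a)) = pr p F (\<lambda>_. False)"
          by (rule pr_cong) (use False in auto)
        then show ?thesis using False by simp
      qed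
    qed
    also have "\<dots> = (\<Sum>C\<in>{C\<in>Pow V. a \<in> C}. ?h C)"
      by (rule sum.inter_filter[OF finP, symmetric])
    finally show ?thesis .
  qed
  \<comment> \<open>The cluster event reads only edges touching \<open>C\<close>, a path inside
    \<open>V - C\<close> only the remaining ones.\<close>
  have ind: "?h C * T (V - C) y z = pr p F (\<lambda>\<omega>. ?H C \<omega> \<and> conn \<omega> (V - C) y z)" for C
  proof -
    let ?D = "{e. e \<inter> C \<noteq> {}}"
    have agree: "e \<inter> C \<noteq> {} \<Longrightarrow> e \<in> \<omega> \<longleftrightarrow> e \<in> \<omega> \<inter> ?D" for e \<omega> by auto
    have A: "?H C (\<omega> \<inter> ?D) = ?H C \<omega>" for \<omega>
    proof
      assume *: "?H C \<omega>"
      show "?H C (\<omega> \<inter> ?D)"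
        using cluster_agree[OF x agree[of _ \<omega>]] conn_agree[OF agree[of _ \<omega>] _ assms(1)] * by blast
    next
      assume *: "?H C (\<omega> \<inter> ?D)"
      have agree': "e \<inter> C \<noteq> {} \<Longrightarrow> e \<in> \<omega> \<inter> ?D \<longleftrightarrow> e \<in> \<omega>" for e by auto
      show "?H C \<omega>"
        using cluster_agree[OF x agree'] conn_agree[OF agree' _ assms(1)] * by blast
    qed
    have B: "conn (\<omega> - ?D) (V - C) y z = conn \<omega> (V - C) y z" for \<omega>
    proof
      assume "conn \<omega> (V - C) y z"
      then obtain \<gamma> where \<gamma>: "\<gamma> \<noteq> []" "hd \<gamma> = y" "last \<gamma> = z" "set \<gamma> \<subseteq> V - C" "path_edges \<gamma> \<subseteq> \<omega>"
        unfolding conn_def by blast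
      then have "path_edges \<gamma> \<subseteq> \<omega> - ?D" using path_edges_subset by fast
      then show "conn (\<omega> - ?D) (V - C) y z" using connI[OF \<gamma>(1,4)] \<gamma> by blast
    qed (rule conn_mono, auto)
    show ?thesis unfolding T_def by (rule pr_indep[of F "?H C" ?D "\<lambda>\<omega>. conn \<omega> (V - C) y z", OF finite_F A B, symmetric])
  qed
  let ?g = "\<lambda>a. T V y a * T V a z"
  have g: "0 \<le> ?g a" for a by simp
  have key: "?h C * (T V y z - (\<Sum>a\<in>C. ?g a))
    \<le> pr p F (\<lambda>\<omega>. ?C \<omega> = C \<and> ?G \<omega>)" if C: "C \<in> Pow V" for C
  proof (cases "y \<in> C")
    case True
    have finC: "finite C" using C finite_V finite_subset by blast
    \<comment> \<open>For \<open>y\<close> in the cluster the term \<open>a = y\<close> alone is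
      \<open>T V y z\<close>, so the left side is not positive.\<close>
    have "?g y \<le> (\<Sum>a\<in>C. ?g a)" by (rule member_le_sum) (use True finC in auto)
    then have "T V y z - (\<Sum>a\<in>C. ?g a) \<le> 0" using T_refl[OF assms(3)] by simp
    then have "?h C * (T V y z - (\<Sum>a\<in>C. ?g a)) \<le> 0" by (simp add: mult_nonneg_nonpos)
    then show ?thesis using pr_nonneg order_trans by blast
  next
    case False
    have finC: "finite C" using C finite_V finite_subset by blast
    have "?h C * (T V y z - (\<Sum>a\<in>C. ?g a)) \<le> ?h C * T (V - C) y z"
      using T_via[OF finC, of V y z] by (intro mult_left_mono) auto
    also have "\<dots> = pr p F (\<lambda>\<omega>. ?H C \<omega> \<and> conn \<omega> (V - C) y z)" by (rule ind)
    also have "\<dots> \<le> pr p F (\<lambda>\<omega>. ?C \<omega> = C \<and> ?G \<omega>)"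
    proof (rule pr_mono)
      fix \<omega> assume *: "?H C \<omega> \<and> conn \<omega> (V - C) y z"
      then have "\<not> conn \<omega> V x y" using False by auto
      moreover have "conn \<omega> V y z" using * conn_mono[of \<omega> "V - C" y z \<omega> V] by auto
      ultimately show "?C \<omega> = C \<and> ?G \<omega>" using * by blast
    qed
    finally show ?thesis .
  qed
  have "(\<Sum>a\<in>V. pr p F (\<lambda>\<omega>. conn \<omega> S x u \<and> conn \<omega> V x a) * ?g a) = (\<Sum>a\<in>V. \<Sum>C\<in>{C\<in>Pow V. a \<in> C}. ?h C * ?g a)"
    unfolding T2 sum_distrib_right ..
  also have "\<dots> = (\<Sum>C\<in>Pow V. \<Sum>a\<in>{a\<in>V. a \<in> C}. ?h C * ?g a)"
    by (rule sum.swap_restrict) (use finite_V in auto)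
  also have "\<dots> = (\<Sum>C\<in>Pow V. ?h C * (\<Sum>a\<in>C. ?g a))"
    unfolding sum_distrib_left by (intro sum.cong refl) auto
  finally have "T S x u * T V y z - (\<Sum>a\<in>V. pr p F (\<lambda>\<omega>. conn \<omega> S x u \<and> conn \<omega> V x a) * ?g a)
     = (\<Sum>C\<in>Pow V. ?h C * (T V y z - (\<Sum>a\<in>C. ?g a)))"
    unfolding T1 by (simp add: sum_distrib_right sum_subtractf right_diff_distrib)
  also have "\<dots> \<le> (\<Sum>C\<in>Pow V. pr p F (\<lambda>\<omega>. ?C \<omega> = C \<and> ?G \<omega>))"
    by (rule sum_mono) (rule key)
  also have "\<dots> = pr p F ?G" by (rule tot[symmetric])
  finally show ?thesis .
qed

end

section \<open>Cut vertices outside a set\<close>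

definition exit_cut :: "'v set \<Rightarrow> 'v set \<Rightarrow> 'v \<Rightarrow> 'v \<Rightarrow> 'v \<Rightarrow> 'v set set \<Rightarrow> bool" where
  "exit_cut V S x z v \<omega> \<longleftrightarrow> v \<notin> S \<and> (\<exists>u. {u, v} \<in> \<omega> \<and> conn \<omega> S x u) \<and>
     conn \<omega> V x z \<and> \<not> conn \<omega> (V - {v}) x z"

text \<open>If \<open>v'\<close> follows \<open>v\<close> on a path to \<open>z\<close>, then going
  to \<open>u'\<close> inside \<open>S\<close>, which avoids \<open>v\<close>, stepping to
  \<open>v'\<close> and continuing along the path bypasses \<open>v\<close>.\<close>

lemma exit_cut_bypass:
  assumes "S \<subseteq> V" "distinct (\<alpha> @ v # \<beta>)" "v' \<in> set \<beta>" "path_edges (\<alpha> @ v # \<beta>) \<subseteq> \<omega>"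
    "set (\<alpha> @ v # \<beta>) \<subseteq> V" "last (\<alpha> @ v # \<beta>) = z"
    "{u', v'} \<in> \<omega>" "conn \<omega> S x u'" "v \<notin> S"
  shows "conn \<omega> (V - {v}) x z"
proof -
  obtain \<delta> \<eta> where d: "\<beta> = \<delta> @ v' # \<eta>" using split_list assms(3) by metis
  have u': "conn \<omega> (V - {v}) x u'" by (rule conn_mono[OF assms(8)]) (use assms in auto)
  have "v' \<in> V - {v}" using assms d by auto
  from conn_step[OF u' this assms(7)] have xv': "conn \<omega> (V - {v}) x v'" .
  have "path_edges (v' # \<eta>) \<subseteq> \<omega>"
    using assms(4) path_edges_join[of "\<alpha> @ v # \<delta>" v' \<eta>] d by auto
  moreover have "set (v' # \<eta>) \<subseteq> V - {v}" "last (v' # \<eta>) = z" using assms(2,5,6) d by auto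
  ultimately have "conn \<omega> (V - {v}) v' z"
    using connI[of "v' # \<eta>" "V - {v}" \<omega>] by simp
  with xv' show ?thesis by (rule conn_trans)
qed

text \<open>Both vertices lie on every open path from \<open>x\<close> to \<open>z\<close>; by
  \<open>exit_cut_bypass\<close> the earlier one on such a path is not a cut vertex.\<close>

lemma exit_cut_unique:
  assumes "S \<subseteq> V" "exit_cut V S x z v \<omega>" "exit_cut V S x z v' \<omega>"
  shows "v = v'"
proof (rule ccontr)
  assume ne: "v \<noteq> v'"
  have "conn \<omega> V x z" using assms(2) by (simp add: exit_cut_def)
  then obtain \<gamma> where \<gamma>: "\<gamma> \<noteq> []" "hd \<gamma> = x" "last \<gamma> = z" "set \<gamma> \<subseteq> V" "path_edges \<gamma> \<subseteq> \<omega>" "distinct \<gamma>"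
    by (rule conn_distinct)
  have mem: "a \<in> set \<gamma>" if "exit_cut V S x z a \<omega>" for a
    using connI[of \<gamma> "V - {a}" \<omega>] \<gamma> that unfolding exit_cut_def by auto
  obtain \<alpha> \<beta> where d: "\<gamma> = \<alpha> @ v # \<beta>" using split_list[OF mem[OF assms(2)]] by blast
  have "v' \<in> set \<alpha> \<or> v' \<in> set \<beta>" using mem[OF assms(3)] d ne by auto
  then show False
  proof
    assume "v' \<in> set \<beta>"
    then show False
      using exit_cut_bypass[OF assms(1), of \<alpha> v \<beta> v' \<omega> z _ x] \<gamma> d assms(2,3)
      unfolding exit_cut_def by blast
  next
    assume "v' \<in> set \<alpha>"
    then obtain \<delta> \<eta> where a: "\<alpha> = \<delta> @ v' # \<eta>" using split_list by metis
    have "\<gamma> = \<delta> @ v' # (\<eta> @ v # \<beta>)" "v \<in> set (\<eta> @ v # \<beta>)" using d a by auto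
    then show False
      using exit_cut_bypass[OF assms(1), of \<delta> v' "\<eta> @ v # \<beta>" v \<omega> z _ x] \<gamma> assms(2,3)
      unfolding exit_cut_def by blast
  qed
qed

text \<open>The edges touching \<open>B\<close> are closed, except for a self-avoiding path that joins the
  two clusters through a vertex \<open>v\<close> outside \<open>S\<close>. Its first vertex outside \<open>S\<close> is then a cut vertex.\<close>

lemma exit_cut_surgery:
  assumes S: "S \<subseteq> V" "x \<in> S" and B: "B \<subseteq> V" "z \<notin> B" "v \<notin> S" "u \<in> B" "y \<in> B"
    and fan: "\<And>a b. a \<in> B \<Longrightarrow> b \<in> B \<Longrightarrow> a \<noteq> b \<Longrightarrow> a \<noteq> v \<Longrightarrow>
      \<exists>\<rho>. \<rho> \<noteq> [] \<and> distinct \<rho> \<and> hd \<rho> = a \<and> last \<rho> = b \<and> set \<rho> \<subseteq> B \<and> path_edges \<rho> \<subseteq> F \<and> v \<in> set \<rho>"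
    and \<omega>: "\<omega> \<subseteq> F" "conn \<omega> S x u" "\<not> conn \<omega> V x y" "conn \<omega> V y z"
  defines "D \<equiv> {e \<in> F. e \<inter> B \<noteq> {}}"
  shows "\<exists>\<omega>'. \<omega>' \<subseteq> F \<and> \<omega>' - D = \<omega> - D \<and> (\<exists>v'\<in>B. exit_cut V S x z v' \<omega>')"
proof -
  obtain \<sigma> where \<sigma>: "\<sigma> \<noteq> []" "hd \<sigma> = x" "last \<sigma> = u" "set \<sigma> \<subseteq> S" "path_edges \<sigma> \<subseteq> \<omega>" "distinct \<sigma>"
    using conn_distinct[OF \<omega>(2)] .
  \<comment> \<open>Only \<open>\<sigma>\<close> up to its first vertex \<open>a\<close> in
    \<open>B\<close> and \<open>\<tau>\<close> from its last vertex \<open>b\<close> in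
    \<open>B\<close> onwards are kept; apart from \<open>a\<close> and \<open>b\<close> they avoid
    \<open>B\<close>.\<close>
  have "\<exists>a\<in>set \<sigma>. a \<in> B" using \<sigma> B last_in_set by blast
  then obtain \<alpha> a \<alpha>' where a: "\<sigma> = \<alpha> @ a # \<alpha>'" "a \<in> B" "\<forall>w\<in>set \<alpha>. w \<notin> B"
    using split_list_first_prop[of \<sigma> "\<lambda>w. w \<in> B"] by blast
  obtain \<tau> where \<tau>: "\<tau> \<noteq> []" "hd \<tau> = y" "last \<tau> = z" "set \<tau> \<subseteq> V" "path_edges \<tau> \<subseteq> \<omega>" "distinct \<tau>"
    using conn_distinct[OF \<omega>(4)] .
  have "\<exists>b\<in>set \<tau>. b \<in> B" using \<tau> B hd_in_set by blast
  then obtain \<beta>' b \<beta> where b: "\<tau> = \<beta>' @ b # \<beta>" "b \<in> B" "\<forall>w\<in>set \<beta>. w \<notin> B"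
    using split_list_last_prop[of \<tau> "\<lambda>w. w \<in> B"] by blast
  have \<beta>ne: "\<beta> \<noteq> []" using b \<tau>(3) B(2) by auto
  have hda: "hd (\<alpha> @ [a]) = x" using \<sigma>(2) a(1) by (cases \<alpha>) auto
  have ea: "path_edges (\<alpha> @ [a]) \<subseteq> \<omega>" using \<sigma>(5) a(1) path_edges_join[of \<alpha> a \<alpha>'] by auto
  have eb: "path_edges (b # \<beta>) \<subseteq> \<omega>" using \<tau>(5) b(1) path_edges_join[of \<beta>' b \<beta>] by auto
  have in_x: "conn \<omega> V x w" if w: "w \<in> set (\<alpha> @ [a])" for w
  proof -
    obtain \<delta> \<eta> where d: "\<alpha> @ [a] = \<delta> @ w # \<eta>" using split_list[OF w] by blast
    have "hd (\<delta> @ [w]) = x" using hda d by (cases \<delta>) auto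
    moreover have "set (\<delta> @ w # \<eta>) \<subseteq> V" using d[symmetric] \<sigma>(4) a(1) S(1) by auto
    ultimately show ?thesis using conn_sub_path(1)[of \<delta> w \<eta> \<omega> V] ea d by auto
  qed
  have in_z: "conn \<omega> V w z" if w: "w \<in> set (b # \<beta>)" for w
  proof -
    obtain \<delta> \<eta> where d: "b # \<beta> = \<delta> @ w # \<eta>" using split_list[OF w] by blast
    have "last (w # \<eta>) = z" using \<tau>(3) b(1) d by (metis last_appendR list.distinct(1))
    moreover have "set (\<delta> @ w # \<eta>) \<subseteq> V" using d[symmetric] \<tau>(4) b(1) by auto
    ultimately show ?thesis using conn_sub_path(2)[of \<delta> w \<eta> \<omega> V] eb d by auto
  qed
  have nxz: "\<not> conn \<omega> V x z" using \<omega>(3,4) conn_trans conn_sym by metis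
  have disj: "\<not> conn \<omega> V x w" if "w \<in> set (b # \<beta>)" for w
    using in_z[OF that] nxz conn_trans by metis
  have "a \<noteq> b" using in_x[of a] disj[of b] by auto
  moreover have aS: "a \<in> S" using \<sigma>(4) a(1) by auto
  ultimately obtain \<rho> where \<rho>: "\<rho> \<noteq> []" "distinct \<rho>" "hd \<rho> = a" "last \<rho> = b" "set \<rho> \<subseteq> B"
      "path_edges \<rho> \<subseteq> F" "v \<in> set \<rho>"
    using fan[of a b] a(2) b(2) B(3) by metis
  \<comment> \<open>The path through \<open>v\<close> may have left \<open>S\<close> before
    \<open>v\<close>. Its first vertex \<open>v'\<close> outside \<open>S\<close> is used instead:
    everything before \<open>v'\<close> lies in \<open>S\<close>, so \<open>v'\<close> is adjacent
    to the cluster of \<open>x\<close> in \<open>S\<close>.\<close>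
  obtain \<rho>1 v' \<rho>2 where r: "\<rho> = \<rho>1 @ v' # \<rho>2" "v' \<notin> S" "\<forall>w\<in>set \<rho>1. w \<in> S"
    using split_list_first_prop[of \<rho> "\<lambda>w. w \<notin> S"] \<rho>(7) B(3) by blast
  have r1: "\<rho>1 \<noteq> []" using r \<rho>(3) aS by (cases \<rho>1) auto
  then obtain \<rho>1' where ra: "\<rho>1 = a # \<rho>1'" using r \<rho>(3) by (cases \<rho>1) auto
  have rb: "last (v' # \<rho>2) = b" using r \<rho>(4) by simp
  define P where "P = \<alpha> @ \<rho>1"
  define Q where "Q = \<rho>2 @ \<beta>"
  have e\<rho>: "path_edges (\<alpha> @ \<rho>) \<subseteq> path_edges (\<alpha> @ [a]) \<union> path_edges \<rho>"
    using path_edges_join[of \<alpha> a "\<rho>1' @ v' # \<rho>2"] r(1) ra by auto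
  have full: "path_edges (\<alpha> @ \<rho> @ \<beta>) \<subseteq> path_edges (\<alpha> @ [a]) \<union> path_edges \<rho> \<union> path_edges (b # \<beta>)"
  proof -
    obtain \<rho>3 where r3: "\<rho> = \<rho>3 @ [b]" using \<rho>(1,4) by (metis append_butlast_last_id)
    show ?thesis using e\<rho> path_edges_join[of "\<alpha> @ \<rho>3" b \<beta>] unfolding r3 by auto
  qed
  have PQ: "\<alpha> @ \<rho> @ \<beta> = P @ v' # Q" using r by (simp add: P_def Q_def)
  define \<omega>' where "\<omega>' = (\<omega> - D) \<union> path_edges (P @ v' # Q)"
  have sub: "path_edges (P @ v' # Q) \<subseteq> F"
    using full ea eb \<rho>(6) \<omega>(1) unfolding PQ by blast
  have w1: "\<omega>' \<subseteq> F" using \<omega>(1) sub unfolding \<omega>'_def by auto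
  have w2: "\<omega>' - D = \<omega> - D"
  proof -
    have "path_edges \<rho> \<subseteq> D"
    proof
      fix e assume e: "e \<in> path_edges \<rho>"
      then have "e \<subseteq> B" "card e = 2" using path_edges_subset[OF e] \<rho>(5) card_path_edge[OF \<rho>(2) e] by auto
      then show "e \<in> D" using e \<rho>(6) unfolding D_def by (cases "e = {}") auto
    qed
    then have "path_edges (P @ v' # Q) - D \<subseteq> \<omega>" using full ea eb unfolding PQ by auto
    then show ?thesis unfolding \<omega>'_def by auto
  qed
  have distP: "distinct (P @ v' # Q)"
  proof -
    have "set \<alpha> \<inter> set \<rho> = {}" "set \<beta> \<inter> set \<rho> = {}" using a(3) b(3) \<rho>(5) by auto
    moreover have "set \<alpha> \<inter> set \<beta> = {}" using in_x disj by auto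
    moreover have "distinct \<alpha>" "distinct \<beta>" using \<sigma>(6) \<tau>(6) a b by auto
    ultimately show ?thesis unfolding PQ[symmetric] using \<rho>(2) by auto
  qed
  have setPQ: "set (P @ v' # Q) \<subseteq> V"
    using PQ[symmetric] a(1) b(1) \<sigma>(4) \<tau>(4) \<rho>(5) S(1) B(1) by auto
  have Pne: "P \<noteq> []" and hdP: "hd P = x" using r1 ra hda by (cases \<alpha>; auto simp: P_def)+
  have lastQ: "last (P @ v' # Q) = z" using PQ[symmetric] \<beta>ne \<tau>(3) b(1) by auto
  have PS: "set P \<subseteq> S" using \<sigma>(4) a(1) r(3) unfolding P_def by auto
  have eP: "path_edges (P @ v' # Q) = path_edges P \<union> insert {last P, v'} (path_edges (v' # Q))"
    using path_edges_append[OF Pne, of "v' # Q"] by simp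
  have 1: "conn \<omega>' S x (last P)"
    using connI[OF Pne PS, of \<omega>'] eP hdP unfolding \<omega>'_def by auto
  have 2: "{last P, v'} \<in> \<omega>'" using eP unfolding \<omega>'_def by auto
  have 3: "conn \<omega>' V x z"
    using connI[of "P @ v' # Q" V \<omega>'] setPQ lastQ hdP Pne unfolding \<omega>'_def by auto
  have v'B: "v' \<in> B" using r(1) \<rho>(5) by auto
  have 4: "\<not> conn \<omega>' (V - {v'}) x z"
  proof
    assume c: "conn \<omega>' (V - {v'}) x z"
    \<comment> \<open>What \<open>x\<close> can still reach without \<open>v'\<close>: its old
      cluster off \<open>B\<close> and the new path before \<open>v'\<close>. The part from
      \<open>v'\<close> on belongs to \<open>B\<close> or to the other old cluster.\<close>
    define Z where "Z = ({w. conn \<omega> V x w} - B) \<union> set P"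
    have "z \<in> Z" using c
    proof (rule conn_closed)
      show "x \<in> Z" using hdP Pne unfolding Z_def by auto
      fix w w' assume w: "w \<in> Z" "w \<in> V - {v'}" "w' \<in> V - {v'}" "{w, w'} \<in> \<omega>'"
      have wnot: "w \<notin> set (v' # Q)"
      proof
        assume wQ: "w \<in> set (v' # Q)"
        then have "w \<notin> set P" using distP by auto
        then have wx: "conn \<omega> V x w" "w \<notin> B" using w(1) unfolding Z_def by auto
        then have "w \<in> set \<beta>" using wQ v'B r(1) \<rho>(5) unfolding Q_def by auto
        then show False using disj[of w] wx by auto
      qed
      from w(4) consider "{w, w'} \<in> \<omega> - D" | "{w, w'} \<in> path_edges (P @ v' # Q)"
        unfolding \<omega>'_def by blast
      then show "w' \<in> Z"
      proof cases
        case 1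
        then have nB: "w \<notin> B" "w' \<notin> B" using \<omega>(1) unfolding D_def by auto
        have "conn \<omega> V x w"
        proof (cases "w \<in> set P")
          case True
          then have "w \<in> set \<alpha>" using nB r(1) \<rho>(5) unfolding P_def by auto
          then show ?thesis using in_x by simp
        qed (use w(1) Z_def in auto)
        then have "conn \<omega> V x w'" using conn_step w(3) 1 by (metis DiffD1)
        then show ?thesis using nB unfolding Z_def by simp
      next
        case 2
        then consider "{w, w'} \<in> path_edges P" | "{w, w'} = {last P, v'}" | "{w, w'} \<in> path_edges (v' # Q)"
          unfolding eP by blast
        then show ?thesis
        proof cases
          case 1
          then show ?thesis using path_edges_subset[OF 1] unfolding Z_def by auto
        next
          case 2
          then show ?thesis using w(2,3) by (auto simp: doubleton_eq_iff)
        next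
          case 3
          then show ?thesis using path_edges_subset[OF 3] wnot by auto
        qed
      qed
    qed
    moreover have "z \<notin> set P"
    proof -
      have "z \<in> set \<beta>" using \<beta>ne \<tau>(3) b(1) by auto
      then show ?thesis using distP unfolding Q_def by auto
    qed
    ultimately show False using nxz unfolding Z_def by auto
  qed
  have "exit_cut V S x z v' \<omega>'"
    unfolding exit_cut_def using r(2) 1 2 3 4 by blast
  then show ?thesis using w1 w2 v'B by blast
qed

context finite_percolation
begin

text \<open>Double counting: each \<open>i\<close> is charged, through \<open>pr_surgery\<close>, to
  a cut vertex in its cube; a vertex is charged by at most \<open>N\<close> indices, and the cut
  events of different vertices are disjoint.\<close>

lemma surgery_sum:
  fixes cube :: "'i \<Rightarrow> 'v set"
  assumes S: "S \<subseteq> V" "x \<in> S" and I: "finite I"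
    and q: "0 < q" "q \<le> p" "q \<le> 1 - p"
    and cube: "\<And>i. i \<in> I \<Longrightarrow> cube i \<subseteq> V" "\<And>i. i \<in> I \<Longrightarrow> z \<notin> cube i"
      "\<And>i. i \<in> I \<Longrightarrow> u i \<in> cube i" "\<And>i. i \<in> I \<Longrightarrow> y i \<in> cube i"
    and fan: "\<And>i. i \<in> I \<Longrightarrow> \<exists>v. v \<notin> S \<and> (\<forall>a\<in>cube i. \<forall>b\<in>cube i. a \<noteq> b \<longrightarrow> a \<noteq> v \<longrightarrow>
      (\<exists>\<rho>. \<rho> \<noteq> [] \<and> distinct \<rho> \<and> hd \<rho> = a \<and> last \<rho> = b \<and> set \<rho> \<subseteq> cube i \<and> path_edges \<rho> \<subseteq> F \<and> v \<in> set \<rho>))"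
    and M: "\<And>i. i \<in> I \<Longrightarrow> card {e \<in> F. e \<inter> cube i \<noteq> {}} \<le> M"
    and N: "\<And>v. card {i \<in> I. v \<in> cube i} \<le> N"
  shows "q ^ M * (\<Sum>i\<in>I. pr p F (\<lambda>\<omega>. conn \<omega> S x (u i) \<and> \<not> conn \<omega> V x (y i) \<and> conn \<omega> V (y i) z))
    \<le> real N * T V x z"
proof -
  have q1: "q \<le> 1" using q by linarith
  have one: "q ^ M * pr p F (\<lambda>\<omega>. conn \<omega> S x (u i) \<and> \<not> conn \<omega> V x (y i) \<and> conn \<omega> V (y i) z)
    \<le> (\<Sum>v\<in>{v\<in>V. v \<in> cube i}. pr p F (exit_cut V S x z v))" if i: "i \<in> I" for i
  proof -
    let ?D = "{e \<in> F. e \<inter> cube i \<noteq> {}}"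
    let ?G = "\<lambda>\<omega>. conn \<omega> S x (u i) \<and> \<not> conn \<omega> V x (y i) \<and> conn \<omega> V (y i) z"
    obtain v where v: "v \<notin> S" "\<forall>a\<in>cube i. \<forall>b\<in>cube i. a \<noteq> b \<longrightarrow> a \<noteq> v \<longrightarrow>
      (\<exists>\<rho>. \<rho> \<noteq> [] \<and> distinct \<rho> \<and> hd \<rho> = a \<and> last \<rho> = b \<and> set \<rho> \<subseteq> cube i \<and> path_edges \<rho> \<subseteq> F \<and> v \<in> set \<rho>)"
      using fan[OF i] by blast
    have "q ^ M * pr p F ?G \<le> q ^ card ?D * pr p F ?G"
      using M[OF i] q q1 by (intro mult_right_mono power_decreasing) auto
    also have "\<dots> \<le> pr p F (\<lambda>\<omega>. \<exists>v\<in>{v\<in>V. v \<in> cube i}. exit_cut V S x z v \<omega>)"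
    proof (rule pr_surgery[OF finite_F])
      fix \<omega> assume \<omega>: "\<omega> \<subseteq> F" "?G \<omega>"
      have "\<exists>\<omega>'. \<omega>' \<subseteq> F \<and> \<omega>' - ?D = \<omega> - ?D \<and> (\<exists>v'\<in>cube i. exit_cut V S x z v' \<omega>')"
        by (rule exit_cut_surgery[where u="u i" and y="y i" and v=v])
          (use S cube[OF i] v \<omega> in auto)
      then show "\<exists>\<omega>'. \<omega>' \<subseteq> F \<and> \<omega>' - ?D = \<omega> - ?D \<and> (\<exists>v\<in>{v\<in>V. v \<in> cube i}. exit_cut V S x z v \<omega>')"
        using cube(1)[OF i] by blast
    qed (use q in auto)
    also have "\<dots> \<le> (\<Sum>v\<in>{v\<in>V. v \<in> cube i}. pr p F (exit_cut V S x z v))"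
      by (rule pr_union) (use finite_V in auto)
    finally show ?thesis .
  qed
  have "q ^ M * (\<Sum>i\<in>I. pr p F (\<lambda>\<omega>. conn \<omega> S x (u i) \<and> \<not> conn \<omega> V x (y i) \<and> conn \<omega> V (y i) z))
    \<le> (\<Sum>i\<in>I. \<Sum>v\<in>{v\<in>V. v \<in> cube i}. pr p F (exit_cut V S x z v))"
    unfolding sum_distrib_left by (rule sum_mono) (rule one)
  also have "\<dots> = (\<Sum>v\<in>V. \<Sum>i\<in>{i\<in>I. v \<in> cube i}. pr p F (exit_cut V S x z v))"
    by (rule sum.swap_restrict[OF I finite_V])
  also have "\<dots> \<le> (\<Sum>v\<in>V. real N * pr p F (exit_cut V S x z v))"
    using N by (auto intro!: sum_mono mult_right_mono)
  also have "\<dots> = real N * (\<Sum>v\<in>V. pr p F (exit_cut V S x z v))" by (simp add: sum_distrib_left)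
  also have "(\<Sum>v\<in>V. pr p F (exit_cut V S x z v)) \<le> T V x z"
    unfolding T_def
  proof (rule pr_disjoint_union[OF finite_V])
    show "conn \<omega> V x z" if "exit_cut V S x z v \<omega>" for v \<omega>
      using that by (simp add: exit_cut_def)
    show "v = v'" if "exit_cut V S x z v \<omega>" "exit_cut V S x z v' \<omega>" for v v' \<omega>
      using exit_cut_unique[OF S(1)] that by blast
  qed
  finally show ?thesis by (simp add: mult_left_mono)
qed

end

section \<open>Self-avoiding paths in boxes\<close>

text \<open>Fan lemma for graphs without cut vertices: the set of vertices lying on a self-avoiding path
  from \<open>a\<close> to \<open>b\<close> is closed under taking neighbours.\<close>

lemma saw_through:
  assumes ab: "a \<in> B" "b \<in> B" "a \<noteq> b" and v: "v \<in> B"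
    and con: "\<And>x y. x \<in> B \<Longrightarrow> y \<in> B \<Longrightarrow> conn F B x y"
    and con2: "\<And>t x y. x \<in> B \<Longrightarrow> y \<in> B \<Longrightarrow> x \<noteq> t \<Longrightarrow> y \<noteq> t \<Longrightarrow> conn F (B - {t}) x y"
  shows "\<exists>\<rho>\<in>saws B a b. path_edges \<rho> \<subseteq> F \<and> v \<in> set \<rho>"
proof -
  define Z where "Z = {v. \<exists>\<rho>\<in>saws B a b. path_edges \<rho> \<subseteq> F \<and> v \<in> set \<rho>}"
  have "v \<in> Z" using con[OF ab(1) v]
  proof (rule conn_closed)
    obtain \<rho> where "\<rho> \<in> saws B a b" "path_edges \<rho> \<subseteq> F"
      using con[OF ab(1,2)] unfolding conn_iff_saws by blast
    moreover have "a \<in> set \<rho>" using \<open>\<rho> \<in> saws B a b\<close> by (auto simp: saws_def)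
    ultimately show "a \<in> Z" unfolding Z_def by blast
  next
    fix t t' assume t: "t \<in> Z" "t \<in> B" "t' \<in> B" "{t, t'} \<in> F"
    obtain W where W: "distinct W" "W \<noteq> []" "hd W = a" "last W = b" "set W \<subseteq> B" "path_edges W \<subseteq> F" "t \<in> set W"
      using t(1) unfolding Z_def saws_def by blast
    show "t' \<in> Z"
    proof (cases "t' \<in> set W")
      case True
      then show ?thesis using W unfolding Z_def saws_def by blast
    next
      case t': False
      obtain W1 W2 where w: "W = W1 @ t # W2" using split_list[OF W(7)] by blast
      obtain s where s: "s \<in> set W" "s \<noteq> t"
        using ab(3) W(2,3,4) hd_in_set last_in_set by metis
      have "t' \<noteq> t" using t' W(7) by auto
      \<comment> \<open>A route from \<open>t'\<close> avoiding \<open>t\<close> is followed to its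
        first vertex \<open>c\<close> on \<open>W\<close>. With the edge \<open>{t, t'}\<close> it
        replaces the stretch of \<open>W\<close> between \<open>t\<close> and \<open>c\<close>; the
        two cases below are \<open>c\<close> after \<open>t\<close> and \<open>c\<close> before
        \<open>t\<close>.\<close>
      then have "conn F (B - {t}) t' s" using con2[of t' s t] t(3) s W(5) by auto
      then obtain P where P: "P \<noteq> []" "hd P = t'" "last P = s" "set P \<subseteq> B - {t}" "path_edges P \<subseteq> F" "distinct P"
        by (rule conn_distinct)
      have "\<exists>c\<in>set P. c \<in> set W" using P(1,3) s last_in_set by blast
      then obtain P1 c P2 where p: "P = P1 @ c # P2" "c \<in> set W" "\<forall>z\<in>set P1. z \<notin> set W"
        using split_list_first_prop[of P "\<lambda>c. c \<in> set W"] by blast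
      have P1ne: "P1 \<noteq> []" using p P(2) t' by (cases P1) auto
      then have P1: "hd P1 = t'" using p P(2) by simp
      have pe: "path_edges (P1 @ [c]) \<subseteq> F" using P(5) path_edges_join[of P1 c P2] p by auto
      have c: "c \<in> set W1 \<or> c \<in> set W2" using p(1,2) P(4) w by auto
      have PB: "set P1 \<subseteq> B" "distinct P1" using P p by auto
      show ?thesis
      proof (cases "c \<in> set W2")
        case True
        then obtain X Y where x: "W2 = X @ c # Y" using split_list by metis
        let ?N = "W1 @ t # P1 @ c # Y"
        have "path_edges (c # Y) \<subseteq> F" "path_edges (W1 @ [t]) \<subseteq> F"
          using W(6) path_edges_join[of "W1 @ t # X" c Y] path_edges_join[of W1 t W2] w x by auto
        moreover have "path_edges ?N = path_edges (W1 @ [t]) \<union> insert {t, t'} (path_edges (P1 @ [c]) \<union> path_edges (c # Y))"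
          using path_edges_join[of W1 t "P1 @ c # Y"] path_edges_join[of P1 c Y]
            path_edges_Cons[of "P1 @ c # Y" t] P1 P1ne by auto
        ultimately have "path_edges ?N \<subseteq> F" using pe t(4) by auto
        moreover have "?N \<in> saws B a b"
          using W(1,3,4,5) p(3) PB unfolding saws_def w x by (cases W1) auto
        moreover have "t' \<in> set ?N" using P1 P1ne by auto
        ultimately show ?thesis unfolding Z_def by blast
      next
        case False
        then have "c \<in> set W1" using c by blast
        then obtain X Y where x: "W1 = X @ c # Y" using split_list by metis
        let ?N = "X @ c # rev P1 @ t # W2"
        have "path_edges (X @ [c]) \<subseteq> F" "path_edges (t # W2) \<subseteq> F"
          using W(6) path_edges_join[of X c "Y @ t # W2"] path_edges_join[of W1 t W2] w x by auto
        moreover have "path_edges ?N = path_edges (X @ [c]) \<union> (path_edges (rev (P1 @ [c])) \<union> insert {t', t} (path_edges (t # W2)))"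
          using path_edges_join[of X c "rev P1 @ t # W2"] path_edges_append[of "c # rev P1" "t # W2"]
             P1 P1ne by (simp add: last_rev)
        ultimately have "path_edges ?N \<subseteq> F" using pe t(4) unfolding path_edges_rev by (auto simp: insert_commute)
        moreover have "?N \<in> saws B a b"
          using W(1,3,4,5) p(3) PB unfolding saws_def w x by (cases X) auto
        moreover have "t' \<in> set ?N" using P1 P1ne by auto
        ultimately show ?thesis unfolding Z_def by blast
      qed
    qed
  qed
  then show ?thesis unfolding Z_def by blast
qed

section \<open>Cubes remain connected when a vertex is removed\<close>

definition cube :: "int ^ 'd \<Rightarrow> int \<Rightarrow> (int ^ 'd) set" where
  "cube c r = {x. \<forall>i. \<bar>x $ i - c $ i\<bar> \<le> r}"

definition coord_upd :: "int ^ 'd \<Rightarrow> 'd \<Rightarrow> int \<Rightarrow> int ^ 'd" where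
  "coord_upd x i s = (\<chi> j. if j = i then s else x $ j)"

lemma l1_norm_coord_upd: "l1_norm (coord_upd x i s - coord_upd x i r) = \<bar>s - r\<bar>"
proof -
  have "l1_norm (coord_upd x i s - coord_upd x i r) = (\<Sum>j\<in>UNIV. if j = i then \<bar>s - r\<bar> else 0)"
    unfolding l1_norm_def coord_upd_def by (rule sum.cong) auto
  then show ?thesis by simp
qed

lemma coord_upd_same [simp]: "coord_upd x i (x $ i) = x"
  by (simp add: coord_upd_def vec_eq_iff)

lemma conn_coord_upd_le:
  assumes nn: "\<And>x y. x \<in> A \<Longrightarrow> y \<in> A \<Longrightarrow> l1_norm (x - y) = 1 \<Longrightarrow> {x, y} \<in> F"
    and "r \<le> s" and "\<And>k. r \<le> k \<Longrightarrow> k \<le> s \<Longrightarrow> coord_upd x i k \<in> A"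
  shows "conn F A (coord_upd x i r) (coord_upd x i s)"
  using assms(2,3)
proof (induction s rule: int_ge_induct)
  case base
  then show ?case by (simp add: conn_refl)
next
  case (step s)
  have "conn F A (coord_upd x i r) (coord_upd x i s)" using step.IH step.prems by simp
  moreover have "{coord_upd x i s, coord_upd x i (s + 1)} \<in> F"
    using step.hyps step.prems by (intro nn) (auto simp: l1_norm_coord_upd)
  moreover have "coord_upd x i (s + 1) \<in> A" using step.hyps by (intro step.prems) auto
  ultimately show ?case using conn_step by metis
qed

lemma conn_coord_upd:
  assumes nn: "\<And>x y. x \<in> A \<Longrightarrow> y \<in> A \<Longrightarrow> l1_norm (x - y) = 1 \<Longrightarrow> {x, y} \<in> F"
    and A: "\<And>k. \<bar>k - c $ i\<bar> \<le> R \<Longrightarrow> coord_upd x i k \<in> A" and "\<bar>x $ i - c $ i\<bar> \<le> R" "\<bar>s - c $ i\<bar> \<le> R"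
  shows "conn F A x (coord_upd x i s)"
proof (cases "x $ i \<le> s")
  case True
  have "conn F A (coord_upd x i (x $ i)) (coord_upd x i s)"
    by (rule conn_coord_upd_le[OF nn True A]) (use assms(3,4) in auto)
  then show ?thesis by simp
next
  case False
  have "conn F A (coord_upd x i s) (coord_upd x i (x $ i))"
    by (rule conn_coord_upd_le[OF nn _ A]) (use assms(3,4) False in auto)
  then show ?thesis by (simp add: conn_sym)
qed

definition override :: "int ^ 'd \<Rightarrow> int ^ 'd \<Rightarrow> 'd set \<Rightarrow> int ^ 'd" where
  "override x q J = (\<chi> j. if j \<in> J then q $ j else x $ j)"

text \<open>Coordinates are changed one at a time. Coordinate \<open>k\<close>, in which
  \<open>x\<close> differs from \<open>t\<close>, is never touched, so the path cannot meet
  \<open>t\<close>.\<close>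

lemma conn_override:
  fixes c :: "int ^ 'd"
  assumes nn: "\<And>x y. x \<in> cube c R \<Longrightarrow> y \<in> cube c R \<Longrightarrow> l1_norm (x - y) = 1 \<Longrightarrow> {x, y} \<in> F"
    and "x \<in> cube c R" "q \<in> cube c R" "k \<notin> J" "x $ k \<noteq> t $ k"
  shows "conn F (cube c R - {t}) x (override x q J)"
  using finite[of J] assms(4)
proof (induction J rule: finite_induct)
  case empty
  have "override x q {} = x" by (simp add: override_def vec_eq_iff)
  then show ?case using assms by (auto intro: conn_refl)
next
  case (insert j J)
  let ?y = "override x q J"
  have eq: "override x q (insert j J) = coord_upd ?y j (q $ j)"
    by (auto simp: override_def coord_upd_def vec_eq_iff)
  have yb: "?y \<in> cube c R" using assms(2,3) by (auto simp: cube_def override_def)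
  have "conn F (cube c R - {t}) ?y (coord_upd ?y j (q $ j))"
  proof (rule conn_coord_upd[of _ _ c j R])
    show "{x, y} \<in> F" if "x \<in> cube c R - {t}" "y \<in> cube c R - {t}" "l1_norm (x - y) = 1" for x y
      using that nn by auto
    fix s assume s: "\<bar>s - c $ j\<bar> \<le> R"
    have "coord_upd ?y j s $ k \<noteq> t $ k" using insert assms(5) by (auto simp: coord_upd_def override_def)
    moreover have "coord_upd ?y j s \<in> cube c R" using yb s by (auto simp: cube_def coord_upd_def)
    ultimately show "coord_upd ?y j s \<in> cube c R - {t}" by auto
  qed (use yb assms(3) in \<open>auto simp: cube_def\<close>)
  moreover have "conn F (cube c R - {t}) x ?y" using insert by auto
  ultimately show ?case unfolding eq using conn_trans by metis
qed

text \<open>Every vertex is joined to a hub \<open>q\<close> that differs from \<open>t\<close> in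
  all coordinates: first all coordinates but one that differs from \<open>t\<close>, then that one,
  while some other coordinate already agrees with \<open>q\<close>. This needs two
  coordinates.\<close>

lemma cube_minus_point_connected:
  fixes c :: "int ^ 'd"
  assumes nn: "\<And>x y. x \<in> cube c R \<Longrightarrow> y \<in> cube c R \<Longrightarrow> l1_norm (x - y) = 1 \<Longrightarrow> {x, y} \<in> F"
    and "x \<in> cube c R" "y \<in> cube c R" "x \<noteq> t" "y \<noteq> t" "1 \<le> R" "1 < CARD('d)"
  shows "conn F (cube c R - {t}) x y"
proof -
  define q :: "int ^ 'd" where "q = (\<chi> i. if t $ i = c $ i then c $ i + 1 else c $ i)"
  have q: "q \<in> cube c R" "\<And>i. q $ i \<noteq> t $ i" using assms(6) by (auto simp: cube_def q_def)
  have "conn F (cube c R - {t}) x q" if x: "x \<in> cube c R" "x \<noteq> t" for x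
  proof -
    obtain k where k: "x $ k \<noteq> t $ k" using x(2) by (auto simp: vec_eq_iff)
    obtain j where j: "j \<noteq> k"
    proof (rule ccontr)
      assume "\<not> thesis"
      then have "(UNIV :: 'd set) \<subseteq> {k}" using that by auto
      then have "CARD('d) \<le> card {k}" by (intro card_mono) auto
      then show False using assms(7) by simp
    qed
    let ?y = "override x q (- {k})"
    have 1: "conn F (cube c R - {t}) x ?y"
      by (rule conn_override[OF nn x(1) q(1), of k]) (use k in auto)
    have yb: "?y \<in> cube c R" using x(1) q(1) by (auto simp: cube_def override_def)
    have "conn F (cube c R - {t}) ?y (override ?y q {k})"
      by (rule conn_override[OF nn yb q(1), of j]) (use j q(2) in \<open>auto simp: override_def\<close>)
    moreover have "override ?y q {k} = q" by (auto simp: override_def vec_eq_iff)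
    ultimately show ?thesis using 1 conn_trans by metis
  qed
  then show ?thesis using assms conn_sym conn_trans by metis
qed

lemma cube_saw_through:
  fixes c :: "int ^ 'd"
  assumes nn: "\<And>x y. x \<in> cube c R \<Longrightarrow> y \<in> cube c R \<Longrightarrow> l1_norm (x - y) = 1 \<Longrightarrow> {x, y} \<in> F"
    and "a \<in> cube c R" "b \<in> cube c R" "a \<noteq> b" "v \<in> cube c R" "1 \<le> R" "1 < CARD('d)"
  shows "\<exists>\<rho>. \<rho> \<noteq> [] \<and> distinct \<rho> \<and> hd \<rho> = a \<and> last \<rho> = b \<and> set \<rho> \<subseteq> cube c R \<and>
    path_edges \<rho> \<subseteq> F \<and> v \<in> set \<rho>"
proof -
  have "\<exists>\<rho>\<in>saws (cube c R) a b. path_edges \<rho> \<subseteq> F \<and> v \<in> set \<rho>"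
  proof (rule saw_through[OF assms(2-5)])
    show "conn F (cube c R - {t}) x y" if "x \<in> cube c R" "y \<in> cube c R" "x \<noteq> t" "y \<noteq> t" for t x y
      by (rule cube_minus_point_connected[OF nn that assms(6,7)])
    fix x y assume xy: "x \<in> cube c R" "y \<in> cube c R"
    \<comment> \<open>Removing a point outside the cube changes nothing, so plain connectedness is a
      special case.\<close>
    define t :: "int ^ 'd" where "t = (\<chi> i. c $ i + R + 1)"
    have t: "t \<notin> cube c R" using assms(6) by (auto simp: cube_def t_def)
    have "conn F (cube c R - {t}) x y"
      by (rule cube_minus_point_connected[OF nn xy _ _ assms(6,7)]) (use xy t in auto)
    then show "conn F (cube c R) x y" using t by simp
  qed
  then show ?thesis unfolding saws_def by blast
qed

section \<open>Lattice sums\<close>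

definition nrm :: "int ^ 'd \<Rightarrow> real" where
  "nrm z = real_of_int (max 1 (linf_norm z))"

lemma linf_norm_le_iff: "linf_norm z \<le> r \<longleftrightarrow> (\<forall>i. \<bar>z $ i\<bar> \<le> r)"
  unfolding linf_norm_def by (subst Max_le_iff) auto

lemma abs_le_linf_norm: "\<bar>z $ i\<bar> \<le> linf_norm z"
  using linf_norm_le_iff[of z "linf_norm z"] by simp

lemma linf_norm_triangle: "linf_norm (x + y) \<le> linf_norm x + linf_norm y"
  unfolding linf_norm_le_iff
proof
  fix i
  show "\<bar>(x + y) $ i\<bar> \<le> linf_norm x + linf_norm y"
    using abs_le_linf_norm[of x i] abs_le_linf_norm[of y i] by simp
qed

lemma linf_norm_minus [simp]: "linf_norm (- z) = linf_norm z"
  by (simp add: linf_norm_def)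

lemma nrm_ge_1 [simp]: "1 \<le> nrm z" by (simp add: nrm_def)

lemma nrm_pos [simp]: "0 < nrm z" using nrm_ge_1[of z] by linarith

lemma nrm_nonneg [simp]: "0 \<le> nrm z" using nrm_ge_1[of z] by linarith

lemma nrm_neq_0 [simp]: "nrm z \<noteq> 0" using nrm_pos[of z] by linarith

lemma nrm_minus_commute: "nrm (x - y) = nrm (y - x)"
  using linf_norm_minus[of "x - y"] by (simp add: nrm_def)

lemma nrm_triangle: "nrm (x - z) \<le> nrm (x - y) + nrm (y - z)"
  using linf_norm_triangle[of "x - y" "y - z"] by (simp add: nrm_def max_def)

lemma nrm_le_iff: "1 \<le> r \<Longrightarrow> nrm (x - c) \<le> r \<longleftrightarrow> x \<in> cube c \<lfloor>r\<rfloor>"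
  by (auto simp: nrm_def cube_def linf_norm_le_iff le_floor_iff[symmetric])

lemma card_cube:
  fixes c :: "int ^ 'd"
  assumes "0 \<le> r"
  shows "finite (cube c r)" "card (cube c r) = nat (2 * r + 1) ^ CARD('d)"
proof -
  let ?P = "\<Pi>\<^sub>E i\<in>(UNIV :: 'd set). {c $ i - r..c $ i + r}"
  have bij: "bij_betw vec_nth (cube c r) ?P"
  proof (rule bij_betwI[where g = vec_lambda])
    show "vec_nth \<in> cube c r \<rightarrow> ?P" by (auto simp: cube_def abs_le_iff algebra_simps)
    show "vec_lambda \<in> ?P \<rightarrow> cube c r" by (auto simp: cube_def abs_le_iff PiE_iff algebra_simps)
  qed (auto simp: vec_eq_iff)
  have fin: "finite ?P" by (intro finite_PiE) auto
  have "\<And>i. card {c $ i - r..c $ i + r} = nat (2 * r + 1)" by (simp add: algebra_simps)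
  then have card: "card ?P = nat (2 * r + 1) ^ CARD('d)" by (subst card_PiE) auto
  show "finite (cube c r)" using bij_betw_finite[OF bij] fin by blast
  show "card (cube c r) = nat (2 * r + 1) ^ CARD('d)" using bij_betw_same_card[OF bij] card by simp
qed

lemma card_nrm_ball:
  fixes c :: "int ^ 'd"
  assumes "1 \<le> r"
  shows "finite {z. nrm (z - c) \<le> r}" "real (card {z. nrm (z - c) \<le> r}) \<le> (3 * r) ^ CARD('d)"
    "r ^ CARD('d) \<le> real (card {z. nrm (z - c) \<le> r})"
proof -
  have eq: "{z. nrm (z - c) \<le> r} = cube c \<lfloor>r\<rfloor>" using nrm_le_iff[OF assms] by auto
  have f: "0 \<le> \<lfloor>r\<rfloor>" using assms by simp
  show "finite {z. nrm (z - c) \<le> r}" using card_cube(1)[OF f] eq by simp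
  have c: "real (card {z. nrm (z - c) \<le> r}) = (2 * of_int \<lfloor>r\<rfloor> + 1) ^ CARD('d)"
    unfolding eq card_cube(2)[OF f] using f by simp
  show "real (card {z. nrm (z - c) \<le> r}) \<le> (3 * r) ^ CARD('d)"
    unfolding c using assms f by (intro power_mono) linarith+
  show "r ^ CARD('d) \<le> real (card {z. nrm (z - c) \<le> r})"
    unfolding c using assms f by (intro power_mono) linarith+
qed

lemma dyadic_level:
  fixes r :: real
  assumes "1 \<le> r"
  obtains j :: nat where "2 ^ j \<le> r" "r < 2 ^ (j + 1)"
proof -
  define k where "k = nat \<lfloor>r\<rfloor>"
  have k: "1 \<le> k" "real k \<le> r" "r < real (k + 1)" unfolding k_def using assms by linarith+
  obtain j where j: "2 ^ j \<le> k" "k < 2 ^ (j + 1)" using ex_power_ivl1[of 2 k] k(1) by auto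
  have "real (2 ^ j) \<le> real k" using j(1) by (simp only: of_nat_le_iff)
  moreover have "k + 1 \<le> 2 ^ (j + 1)" using j(2) by simp
  then have "real (k + 1) \<le> real (2 ^ (j + 1))" by (simp only: of_nat_le_iff)
  ultimately have "2 ^ j \<le> r" "r < 2 ^ (j + 1)"
    using k unfolding of_nat_power of_nat_numeral by linarith+
  then show ?thesis by (rule that)
qed

text \<open>Split by dyadic shells, each of at most \<open>(3 * 2 ^ (j + 1)) ^ d\<close> points;
  \<open>J\<close> may be any finite set of levels that covers \<open>A\<close>.\<close>

lemma sum_dyadic:
  fixes c :: "int ^ 'd"
  assumes "finite A" "finite J"
    and "\<And>z j. z \<in> A \<Longrightarrow> 2 ^ j \<le> nrm (z - c) \<Longrightarrow> nrm (z - c) < 2 ^ (j + 1) \<Longrightarrow> j \<in> J"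
  shows "(\<Sum>z\<in>A. 1 / nrm (z - c) ^ s) \<le> (\<Sum>j\<in>J. 6 ^ CARD('d) * (2 ^ j) ^ CARD('d) / (2 ^ j) ^ s)"
proof -
  let ?L = "\<lambda>j z. 2 ^ j \<le> nrm (z - c) \<and> nrm (z - c) < 2 ^ (j + 1)"
  have "(\<Sum>z\<in>A. 1 / nrm (z - c) ^ s) \<le> (\<Sum>z\<in>A. \<Sum>j\<in>{j\<in>J. ?L j z}. 1 / nrm (z - c) ^ s)"
  proof (rule sum_mono)
    fix z assume z: "z \<in> A"
    obtain j where j: "2 ^ j \<le> nrm (z - c)" "nrm (z - c) < 2 ^ (j + 1)" by (rule dyadic_level[OF nrm_ge_1])
    have "(\<Sum>j\<in>{j}. 1 / nrm (z - c) ^ s) \<le> (\<Sum>j\<in>{j\<in>J. ?L j z}. 1 / nrm (z - c) ^ s)"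
      by (rule sum_mono2) (use assms(2) assms(3)[OF z j] j in auto)
    then show "1 / nrm (z - c) ^ s \<le> (\<Sum>j\<in>{j\<in>J. ?L j z}. 1 / nrm (z - c) ^ s)" by simp
  qed
  also have "\<dots> = (\<Sum>j\<in>J. \<Sum>z\<in>{z\<in>A. ?L j z}. 1 / nrm (z - c) ^ s)"
    by (rule sum.swap_restrict[OF assms(1,2)])
  also have "\<dots> \<le> (\<Sum>j\<in>J. 6 ^ CARD('d) * (2 ^ j) ^ CARD('d) / (2 ^ j) ^ s)"
  proof (rule sum_mono)
    fix j assume "j \<in> J"
    have "(\<Sum>z\<in>{z\<in>A. ?L j z}. 1 / nrm (z - c) ^ s) \<le> (\<Sum>z\<in>{z\<in>A. ?L j z}. 1 / (2 ^ j) ^ s)"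
      by (intro sum_mono divide_left_mono power_mono) auto
    also have "\<dots> = real (card {z\<in>A. ?L j z}) * (1 / (2 ^ j) ^ s)" by simp
    also have "\<dots> \<le> (3 * 2 ^ (j + 1)) ^ CARD('d) * (1 / (2 ^ j) ^ s)"
    proof (rule mult_right_mono)
      have "real (card {z\<in>A. ?L j z}) \<le> real (card {z. nrm (z - c) \<le> 2 ^ (j + 1)})"
        using card_nrm_ball(1)[of "2 ^ (j + 1)" c, OF one_le_power]
        by (intro of_nat_mono card_mono) auto
      also have "\<dots> \<le> (3 * 2 ^ (j + 1)) ^ CARD('d)"
        by (rule card_nrm_ball(2)) (rule one_le_power, simp)
      finally show "real (card {z\<in>A. ?L j z}) \<le> (3 * 2 ^ (j + 1)) ^ CARD('d)" .
    qed simp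
    also have "(3 * 2 ^ (j + 1) :: real) = 6 * 2 ^ j" by simp
    also have "(6 * 2 ^ j) ^ CARD('d) * (1 / (2 ^ j) ^ s) = 6 ^ CARD('d) * (2 ^ j) ^ CARD('d) / ((2::real) ^ j) ^ s"
      unfolding power_mult_distrib[of 6] by simp
    finally show "(\<Sum>z\<in>{z\<in>A. ?L j z}. 1 / nrm (z - c) ^ s) \<le> 6 ^ CARD('d) * (2 ^ j) ^ CARD('d) / (2 ^ j) ^ s" .
  qed
  finally show ?thesis .
qed

lemma geometric_le_double:
  assumes "2 \<le> (b::real)" shows "(\<Sum>j\<le>m. b ^ j) \<le> 2 * b ^ m"
proof (induction m)
  case (Suc m)
  have "2 * b ^ m \<le> b * b ^ m" using assms by (intro mult_right_mono) auto
  then show ?case using Suc by simp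
qed simp

lemma geometric_tail_le_double:
  assumes "0 \<le> b" "b \<le> (1 / 2 :: real)" shows "(\<Sum>j\<in>{k..m}. b ^ j) \<le> 2 * b ^ k"
proof -
  have half: "b ^ j * b \<le> b ^ j * (1 / 2)" for j
    using assms by (intro mult_left_mono) auto
  have "(\<Sum>j\<in>{k..m}. b ^ j) \<le> 2 * b ^ k - b ^ m" if "k \<le> m" for m
    using that
  proof (induction m rule: dec_induct)
    case (step m)
    then show ?case using half[of m] by (simp add: mult.commute)
  qed simp
  moreover have "0 \<le> b ^ m" "0 \<le> b ^ k" using assms by auto
  ultimately show ?thesis by (cases "k \<le> m") fastforce+
qed

text \<open>For an exponent below the dimension the shells grow geometrically, and the outermost one
  dominates.\<close>

lemma sum_nrm_ball:
  fixes c :: "int ^ 'd"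
  assumes "finite A" "s + t = CARD('d)" "1 \<le> t" "1 \<le> r"
  shows "(\<Sum>z\<in>{z\<in>A. nrm (z - c) \<le> r}. 1 / nrm (z - c) ^ s) \<le> 2 * 6 ^ CARD('d) * r ^ t"
proof -
  obtain J where J1: "2 ^ J \<le> r" and J2: "r < 2 ^ (J + 1)" by (rule dyadic_level[OF assms(4)])
  have "(\<Sum>z\<in>{z\<in>A. nrm (z - c) \<le> r}. 1 / nrm (z - c) ^ s)
     \<le> (\<Sum>j\<in>{..J}. 6 ^ CARD('d) * (2 ^ j) ^ CARD('d) / (2 ^ j) ^ s)"
  proof (rule sum_dyadic)
    fix z j assume "z \<in> {z\<in>A. nrm (z - c) \<le> r}" "2 ^ j \<le> nrm (z - c)"
    then have "(2::real) ^ j < 2 ^ (J + 1)" using J2 by auto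
    then have "j < J + 1" by (rule power_less_imp_less_exp[rotated]) simp
    then show "j \<in> {..J}" by simp
  qed (use assms in auto)
  also have "\<dots> = (\<Sum>j\<in>{..J}. 6 ^ CARD('d) * (2 ^ t) ^ j)"
  proof (rule sum.cong[OF refl])
    fix j
    have "((2::real) ^ j) ^ CARD('d) = (2 ^ j) ^ s * (2 ^ j) ^ t" using assms(2) by (metis power_add)
    then show "6 ^ CARD('d) * (2 ^ j) ^ CARD('d) / (2 ^ j) ^ s = 6 ^ CARD('d) * ((2::real) ^ t) ^ j"
      by (simp add: power_mult[symmetric] mult.commute)
  qed
  also have "\<dots> = 6 ^ CARD('d) * (\<Sum>j\<le>J. (2 ^ t) ^ j)" by (simp add: sum_distrib_left)
  also have "\<dots> \<le> 6 ^ CARD('d) * (2 * (2 ^ t) ^ J)"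
  proof (intro mult_left_mono geometric_le_double)
    show "2 \<le> (2::real) ^ t" using assms(3) power_increasing[of 1 t "2::real"] by simp
  qed simp
  also have "(2 ^ t) ^ J = ((2::real) ^ J) ^ t" by (simp add: power_mult[symmetric] mult.commute)
  also have "\<dots> \<le> r ^ t" using J1 by (rule power_mono) simp
  finally show ?thesis by simp
qed

text \<open>For an exponent above the dimension the shells decay geometrically. \<open>K\<close>
  merely makes the set of levels finite; \<open>2 ^ t\<close> is the price of rounding
  \<open>r\<close> down to a power of two.\<close>

lemma sum_nrm_tail:
  fixes c :: "int ^ 'd"
  assumes "finite A" "s = CARD('d) + t" "1 \<le> t" "1 \<le> r"
  shows "(\<Sum>z\<in>{z\<in>A. r \<le> nrm (z - c)}. 1 / nrm (z - c) ^ s) \<le> 2 * 6 ^ CARD('d) * 2 ^ t / r ^ t"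
proof -
  obtain J where J1: "2 ^ J \<le> r" and J2: "r < 2 ^ (J + 1)" by (rule dyadic_level[OF assms(4)])
  obtain K where K: "\<And>z. z \<in> A \<Longrightarrow> nrm (z - c) \<le> real K"
  proof -
    have "nrm (z - c) \<le> real (nat \<lceil>Max ((\<lambda>z. nrm (z - c)) ` A)\<rceil>)" if "z \<in> A" for z
    proof -
      have "nrm (z - c) \<le> Max ((\<lambda>z. nrm (z - c)) ` A)" using assms(1) that by simp
      then show ?thesis by linarith
    qed
    then show ?thesis using that by blast
  qed
  have "(\<Sum>z\<in>{z\<in>A. r \<le> nrm (z - c)}. 1 / nrm (z - c) ^ s)
     \<le> (\<Sum>j\<in>{J..K}. 6 ^ CARD('d) * (2 ^ j) ^ CARD('d) / (2 ^ j) ^ s)"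
  proof (rule sum_dyadic)
    fix z j assume z: "z \<in> {z\<in>A. r \<le> nrm (z - c)}" "2 ^ j \<le> nrm (z - c)" "nrm (z - c) < 2 ^ (j + 1)"
    have "(2::real) ^ J < 2 ^ (j + 1)" using J1 z by auto
    then have "J < j + 1" by (rule power_less_imp_less_exp[rotated]) simp
    moreover have "(2::real) ^ j \<le> real K" using z(1,2) K[of z] by (intro order_trans[OF z(2)]) simp
    then have "real (2 ^ j) \<le> real K" by (simp only: of_nat_power of_nat_numeral)
    then have "2 ^ j \<le> K" by (simp only: of_nat_le_iff)
    then have "j \<le> K" using less_exp[of j] by linarith
    ultimately show "j \<in> {J..K}" by simp
  qed (use assms in auto)
  also have "\<dots> = (\<Sum>j\<in>{J..K}. 6 ^ CARD('d) * (1 / 2 ^ t) ^ j)"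
  proof (rule sum.cong[OF refl])
    fix j
    have "((2::real) ^ j) ^ s = (2 ^ j) ^ CARD('d) * (2 ^ j) ^ t" using assms(2) by (metis power_add)
    then show "6 ^ CARD('d) * (2 ^ j) ^ CARD('d) / (2 ^ j) ^ s = 6 ^ CARD('d) * (1 / (2::real) ^ t) ^ j"
      by (simp add: power_mult[symmetric] mult.commute power_divide)
  qed
  also have "\<dots> = 6 ^ CARD('d) * (\<Sum>j\<in>{J..K}. (1 / 2 ^ t) ^ j)" by (simp add: sum_distrib_left)
  also have "\<dots> \<le> 6 ^ CARD('d) * (2 * (1 / 2 ^ t) ^ J)"
  proof (intro mult_left_mono geometric_tail_le_double)
    have "2 \<le> (2::real) ^ t" using assms(3) power_increasing[of 1 t "2::real"] by simp
    then show "1 / (2::real) ^ t \<le> 1 / 2" by (simp add: field_simps)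
  qed simp_all
  also have "(1 / 2 ^ t) ^ J = 1 / ((2::real) ^ J) ^ t" by (simp add: power_mult[symmetric] mult.commute power_divide)
  also have "\<dots> \<le> 2 ^ t / r ^ t"
  proof -
    have "r ^ t \<le> (2 * 2 ^ J) ^ t" using J2 assms(4) by (intro power_mono) auto
    also have "\<dots> = 2 ^ t * (2 ^ J) ^ t" by (rule power_mult_distrib)
    finally show ?thesis using assms(4) by (simp add: field_simps)
  qed
  finally show ?thesis by (simp add: mult_ac)
qed

section \<open>Convolutions of the two-point bound\<close>

lemma inverse_nrm_le:
  assumes "0 < r" "r \<le> nrm z" shows "1 / nrm z ^ s \<le> 1 / r ^ s"
  using assms by (intro divide_left_mono power_mono) auto

context
  assumes d: "CARD('d::finite) \<ge> 5"
begin

text \<open>Points closer to \<open>y\<close> have distance at least half of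
  \<open>\<bar>w - y\<bar>\<close> from \<open>w\<close>. Within that distance of \<open>y\<close>
  the first factor is frozen; beyond it both factors are at most the power at \<open>y\<close>, and
  \<open>2 * d - 4 > d\<close>.\<close>

lemma convolution_half:
  fixes w y :: "int ^ 'd"
  assumes "finite A"
  shows "(\<Sum>a\<in>{a\<in>A. nrm (a - y) \<le> nrm (a - w)}. 1 / nrm (a - w) ^ (CARD('d) - 2) * (1 / nrm (a - y) ^ (CARD('d) - 2)))
    \<le> 4 * 6 ^ CARD('d) * 2 ^ CARD('d) / nrm (w - y) ^ (CARD('d) - 4)"
proof -
  let ?d = "CARD('d)" and ?n = "nrm (w - y)"
  let ?A = "{a\<in>A. nrm (a - y) \<le> nrm (a - w)}"
  let ?f = "\<lambda>a. 1 / nrm (a - y) ^ (?d - 2)"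
  have far: "?n / 2 \<le> nrm (a - w)" if "a \<in> ?A" for a
    using that nrm_triangle[of w y a] nrm_minus_commute[of w a] by auto
  have split: "(\<Sum>a\<in>?A. 1 / nrm (a - w) ^ (?d - 2) * ?f a)
     = (\<Sum>a\<in>{a\<in>?A. nrm (a - y) \<le> ?n}. 1 / nrm (a - w) ^ (?d - 2) * ?f a)
     + (\<Sum>a\<in>{a\<in>?A. \<not> nrm (a - y) \<le> ?n}. 1 / nrm (a - w) ^ (?d - 2) * ?f a)"
    using assms by (subst sum.union_disjoint[symmetric]) (auto intro: sum.cong)
  have "(\<Sum>a\<in>{a\<in>?A. nrm (a - y) \<le> ?n}. 1 / nrm (a - w) ^ (?d - 2) * ?f a)
     \<le> (\<Sum>a\<in>{a\<in>?A. nrm (a - y) \<le> ?n}. 1 / (?n / 2) ^ (?d - 2) * ?f a)"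
    by (intro sum_mono mult_right_mono inverse_nrm_le) (use far in auto)
  also have "\<dots> \<le> 1 / (?n / 2) ^ (?d - 2) * (2 * 6 ^ ?d * ?n ^ 2)"
    unfolding sum_distrib_left[symmetric]
    by (intro mult_left_mono sum_nrm_ball) (use assms d in auto)
  also have "\<dots> = 2 * 6 ^ ?d * 2 ^ (?d - 2) / ?n ^ (?d - 4)"
  proof -
    have "?n ^ (?d - 2) = ?n ^ (?d - 4) * ?n ^ 2"
      unfolding power_add[symmetric] using d by (intro arg_cong2[where f = power]) auto
    then show ?thesis by (simp add: power_divide)
  qed
  finally have near: "(\<Sum>a\<in>{a\<in>?A. nrm (a - y) \<le> ?n}. 1 / nrm (a - w) ^ (?d - 2) * ?f a)
    \<le> 2 * 6 ^ ?d * 2 ^ (?d - 2) / ?n ^ (?d - 4)" .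
  have "(\<Sum>a\<in>{a\<in>?A. \<not> nrm (a - y) \<le> ?n}. 1 / nrm (a - w) ^ (?d - 2) * ?f a)
     \<le> (\<Sum>a\<in>{a\<in>?A. \<not> nrm (a - y) \<le> ?n}. 1 / nrm (a - y) ^ (2 * ?d - 4))"
  proof (rule sum_mono)
    fix a assume a: "a \<in> {a\<in>?A. \<not> nrm (a - y) \<le> ?n}"
    have "1 / nrm (a - w) ^ (?d - 2) * ?f a \<le> ?f a * ?f a"
      by (intro mult_right_mono inverse_nrm_le) (use a in auto)
    also have "\<dots> = 1 / nrm (a - y) ^ (2 * ?d - 4)"
      using d by (simp add: power_add[symmetric]) (simp add: mult_2)
    finally show "1 / nrm (a - w) ^ (?d - 2) * ?f a \<le> 1 / nrm (a - y) ^ (2 * ?d - 4)" .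
  qed
  also have "\<dots> \<le> (\<Sum>a\<in>{a\<in>A. ?n \<le> nrm (a - y)}. 1 / nrm (a - y) ^ (2 * ?d - 4))"
    by (rule sum_mono2) (use assms in auto)
  also have "\<dots> \<le> 2 * 6 ^ ?d * 2 ^ (?d - 4) / ?n ^ (?d - 4)"
    by (rule sum_nrm_tail) (use assms d in auto)
  finally have far': "(\<Sum>a\<in>{a\<in>?A. \<not> nrm (a - y) \<le> ?n}. 1 / nrm (a - w) ^ (?d - 2) * ?f a)
    \<le> 2 * 6 ^ ?d * 2 ^ (?d - 4) / ?n ^ (?d - 4)" .
  have *: "(\<Sum>a\<in>?A. 1 / nrm (a - w) ^ (?d - 2) * ?f a)
    \<le> 2 * 6 ^ ?d * 2 ^ (?d - 2) / ?n ^ (?d - 4) + 2 * 6 ^ ?d * 2 ^ (?d - 4) / ?n ^ (?d - 4)"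
    unfolding split by (rule add_mono[OF near far'])
  have "(2::real) ^ (?d - 2) \<le> 2 ^ ?d" "(2::real) ^ (?d - 4) \<le> 2 ^ ?d"
    by (intro power_increasing; simp)+
  then have "2 * 6 ^ ?d * 2 ^ (?d - 2) / ?n ^ (?d - 4) + 2 * 6 ^ ?d * 2 ^ (?d - 4) / ?n ^ (?d - 4)
    \<le> 2 * 6 ^ ?d * 2 ^ ?d / ?n ^ (?d - 4) + 2 * 6 ^ ?d * 2 ^ ?d / ?n ^ (?d - 4)"
    by (intro add_mono divide_right_mono mult_left_mono) auto
  also have "\<dots> = 4 * 6 ^ ?d * 2 ^ ?d / ?n ^ (?d - 4)" by simp
  finally show ?thesis using * by (rule order_trans[rotated])
qed

lemma convolution:
  fixes w y :: "int ^ 'd"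
  assumes "finite A"
  shows "(\<Sum>a\<in>A. 1 / nrm (a - w) ^ (CARD('d) - 2) * (1 / nrm (a - y) ^ (CARD('d) - 2)))
    \<le> 8 * 12 ^ CARD('d) / nrm (w - y) ^ (CARD('d) - 4)"
proof -
  let ?d = "CARD('d)"
  let ?g = "\<lambda>a. 1 / nrm (a - w) ^ (?d - 2) * (1 / nrm (a - y) ^ (?d - 2))"
  have split: "(\<Sum>a\<in>A. ?g a) = (\<Sum>a\<in>{a\<in>A. nrm (a - y) \<le> nrm (a - w)}. ?g a) + (\<Sum>a\<in>{a\<in>A. \<not> nrm (a - y) \<le> nrm (a - w)}. ?g a)"
    using assms by (subst sum.union_disjoint[symmetric]) (auto intro: sum.cong)
  let ?h = "\<lambda>a. 1 / nrm (a - y) ^ (?d - 2) * (1 / nrm (a - w) ^ (?d - 2))"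
  have "(\<Sum>a\<in>{a\<in>A. \<not> nrm (a - y) \<le> nrm (a - w)}. ?g a) = (\<Sum>a\<in>{a\<in>A. \<not> nrm (a - y) \<le> nrm (a - w)}. ?h a)"
    by (intro sum.cong refl mult.commute)
  also have "\<dots> \<le> (\<Sum>a\<in>{a\<in>A. nrm (a - w) \<le> nrm (a - y)}. ?h a)"
    by (rule sum_mono2) (use assms in auto)
  also have "\<dots> \<le> 4 * 6 ^ ?d * 2 ^ ?d / nrm (y - w) ^ (?d - 4)"
    by (rule convolution_half[OF assms])
  also have "nrm (y - w) = nrm (w - y)" by (rule nrm_minus_commute)
  finally have 1: "(\<Sum>a\<in>{a\<in>A. \<not> nrm (a - y) \<le> nrm (a - w)}. ?g a) \<le> 4 * 6 ^ ?d * 2 ^ ?d / nrm (w - y) ^ (?d - 4)" .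
  have "(\<Sum>a\<in>A. ?g a) \<le> 4 * 6 ^ ?d * 2 ^ ?d / nrm (w - y) ^ (?d - 4) + 4 * 6 ^ ?d * 2 ^ ?d / nrm (w - y) ^ (?d - 4)"
    unfolding split by (rule add_mono[OF convolution_half[OF assms] 1])
  then show ?thesis by (simp add: add_divide_distrib[symmetric] power_mult_distrib[symmetric])
qed

text \<open>Far from the cube all \<open>y\<close> are comparable. Near it the sum is of order
  \<open>R ^ 4\<close>, that is \<open>R ^ d\<close> times the cut-off kernel: averaging over
  \<open>y\<close> removes the singularity. \<open>162 = 2 * 3 ^ 4\<close> comes from enlarging the
  radius to \<open>3 * R\<close>.\<close>

lemma convolution_cube:
  fixes w u :: "int ^ 'd"
  assumes "finite A" "1 \<le> R"
  shows "(\<Sum>y\<in>{y\<in>A. nrm (y - u) \<le> R}. 1 / nrm (w - y) ^ (CARD('d) - 4))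
    \<le> 162 * 12 ^ CARD('d) * R ^ CARD('d) / max R (nrm (w - u)) ^ (CARD('d) - 4)"
proof -
  let ?d = "CARD('d)" and ?n = "nrm (w - u)" and ?B = "{y\<in>A. nrm (y - u) \<le> R}"
  show ?thesis
  proof (cases "2 * R \<le> ?n")
    case True
    have "?n / 2 \<le> nrm (w - y)" if "y \<in> ?B" for y
      using that nrm_triangle[of w u y] True by auto
    then have "(\<Sum>y\<in>?B. 1 / nrm (w - y) ^ (?d - 4)) \<le> (\<Sum>y\<in>?B. 1 / (?n / 2) ^ (?d - 4))"
      by (intro sum_mono inverse_nrm_le) auto
    also have "\<dots> = real (card ?B) * (1 / (?n / 2) ^ (?d - 4))" by simp
    also have "\<dots> \<le> (3 * R) ^ ?d * (1 / (?n / 2) ^ (?d - 4))"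
    proof (rule mult_right_mono)
      have "real (card ?B) \<le> real (card {z. nrm (z - u) \<le> R})"
        using card_nrm_ball(1)[OF assms(2), of u] by (intro of_nat_mono card_mono) auto
      then show "real (card ?B) \<le> (3 * R) ^ ?d" using card_nrm_ball(2)[OF assms(2), of u] by linarith
    qed simp
    also have "\<dots> = 3 ^ ?d * 2 ^ (?d - 4) * R ^ ?d / ?n ^ (?d - 4)"
      by (simp add: power_mult_distrib power_divide)
    also have "\<dots> \<le> 162 * 12 ^ ?d * R ^ ?d / ?n ^ (?d - 4)"
    proof (intro divide_right_mono mult_right_mono)
      have "(3::real) ^ ?d * 2 ^ (?d - 4) \<le> 3 ^ ?d * 2 ^ ?d"
        by (intro mult_left_mono power_increasing) auto
      also have "\<dots> = 6 ^ ?d" by (simp add: power_mult_distrib[symmetric])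
      also have "\<dots> \<le> 12 ^ ?d" by (rule power_mono) auto
      finally have "(3::real) ^ ?d * 2 ^ (?d - 4) \<le> 12 ^ ?d" .
      then show "(3::real) ^ ?d * 2 ^ (?d - 4) \<le> 162 * 12 ^ ?d"
        using zero_le_power[of "12::real" ?d] by linarith
    qed (use assms in auto)
    finally show ?thesis using True assms(2) by (simp add: max_def)
  next
    case False
    let ?m = "max R ?n"
    have "(\<Sum>y\<in>?B. 1 / nrm (w - y) ^ (?d - 4)) \<le> (\<Sum>y\<in>{y\<in>A. nrm (y - w) \<le> 3 * R}. 1 / nrm (w - y) ^ (?d - 4))"
    proof (rule sum_mono2)
      show "?B \<subseteq> {y\<in>A. nrm (y - w) \<le> 3 * R}"
      proof safe
        fix y assume "nrm (y - u) \<le> R"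
        then show "nrm (y - w) \<le> 3 * R"
          using nrm_triangle[of y w u] nrm_minus_commute[of u w] False by linarith
      qed
    qed (use assms in auto)
    also have "\<dots> = (\<Sum>y\<in>{y\<in>A. nrm (y - w) \<le> 3 * R}. 1 / nrm (y - w) ^ (?d - 4))"
      by (simp add: nrm_minus_commute)
    also have "\<dots> \<le> 2 * 6 ^ ?d * (3 * R) ^ 4"
      by (rule sum_nrm_ball) (use assms d in auto)
    also have "\<dots> = 162 * 6 ^ ?d * R ^ 4" by (simp add: power_mult_distrib)
    also have "\<dots> \<le> 162 * 6 ^ ?d * (2 ^ ?d * R ^ ?d / ?m ^ (?d - 4))"
    proof (rule mult_left_mono)
      have "?m ^ (?d - 4) \<le> (2 * R) ^ (?d - 4)" using False assms(2) by (intro power_mono) auto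
      then have "R ^ 4 * ?m ^ (?d - 4) \<le> R ^ 4 * (2 * R) ^ (?d - 4)"
        using assms(2) by (intro mult_left_mono) auto
      also have "\<dots> = 2 ^ (?d - 4) * (R ^ 4 * R ^ (?d - 4))" by (simp add: power_mult_distrib)
      also have "R ^ 4 * R ^ (?d - 4) = R ^ ?d" using d by (simp add: power_add[symmetric])
      also have "2 ^ (?d - 4) * R ^ ?d \<le> 2 ^ ?d * R ^ ?d"
        using assms(2) by (intro mult_right_mono power_increasing) auto
      finally show "R ^ 4 \<le> 2 ^ ?d * R ^ ?d / ?m ^ (?d - 4)"
        using assms(2) by (subst pos_le_divide_eq) auto
    qed simp
    also have "\<dots> = 162 * 12 ^ ?d * R ^ ?d / ?m ^ (?d - 4)"
      using power_mult_distrib[of "6::real" 2 ?d] by simp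
    finally show ?thesis .
  qed
qed

text \<open>Here \<open>x\<close> is the far target. Away from \<open>x\<close> the third factor is
  frozen and \<open>convolution\<close> applies; near \<open>x\<close> the other two are frozen,
  which gives the smaller second term.\<close>

lemma convolution_triple:
  fixes w y x :: "int ^ 'd"
  assumes "finite A" "nrm (w - c) \<le> nrm (x - c) / 4" "nrm (y - c) \<le> nrm (x - c) / 4"
  shows "(\<Sum>a\<in>A. 1 / nrm (a - w) ^ (CARD('d) - 2) * (1 / nrm (a - y) ^ (CARD('d) - 2)) * (1 / nrm (a - x) ^ (CARD('d) - 2)))
    \<le> 8 * 48 ^ CARD('d) / nrm (x - c) ^ (CARD('d) - 2) *
      (1 / nrm (w - y) ^ (CARD('d) - 4) + 1 / nrm (x - c) ^ (CARD('d) - 4))"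
proof -
  let ?d = "CARD('d)" and ?n = "nrm (x - c)"
  let ?f = "\<lambda>v a. 1 / nrm (a - v) ^ (?d - 2)"
  have split: "(\<Sum>a\<in>A. ?f w a * ?f y a * ?f x a)
     = (\<Sum>a\<in>{a\<in>A. ?n / 4 \<le> nrm (a - x)}. ?f w a * ?f y a * ?f x a) + (\<Sum>a\<in>{a\<in>A. \<not> ?n / 4 \<le> nrm (a - x)}. ?f w a * ?f y a * ?f x a)"
    using assms by (subst sum.union_disjoint[symmetric]) (auto intro: sum.cong)
  have "(\<Sum>a\<in>{a\<in>A. ?n / 4 \<le> nrm (a - x)}. ?f w a * ?f y a * ?f x a)
     \<le> (\<Sum>a\<in>{a\<in>A. ?n / 4 \<le> nrm (a - x)}. ?f w a * ?f y a * (1 / (?n / 4) ^ (?d - 2)))"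
    by (intro sum_mono mult_left_mono inverse_nrm_le) auto
  also have "\<dots> \<le> (\<Sum>a\<in>A. ?f w a * ?f y a * (1 / (?n / 4) ^ (?d - 2)))"
    by (rule sum_mono2) (use assms in auto)
  also have "\<dots> \<le> 8 * 12 ^ ?d / nrm (w - y) ^ (?d - 4) * (1 / (?n / 4) ^ (?d - 2))"
    unfolding sum_distrib_right[symmetric]
    by (rule mult_right_mono[OF convolution[OF assms(1)]]) simp
  also have "\<dots> = 8 * 12 ^ ?d * 4 ^ (?d - 2) * (1 / ?n ^ (?d - 2) * (1 / nrm (w - y) ^ (?d - 4)))"
    by (simp add: power_divide)
  also have "\<dots> \<le> 8 * 48 ^ ?d * (1 / ?n ^ (?d - 2) * (1 / nrm (w - y) ^ (?d - 4)))"
  proof (rule mult_right_mono)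
    have "(12::real) ^ ?d * 4 ^ (?d - 2) \<le> 12 ^ ?d * 4 ^ ?d"
      by (intro mult_left_mono power_increasing) auto
    then show "(8::real) * 12 ^ ?d * 4 ^ (?d - 2) \<le> 8 * 48 ^ ?d"
      using power_mult_distrib[of "12::real" 4 ?d] by simp
  qed simp
  finally have 1: "(\<Sum>a\<in>{a\<in>A. ?n / 4 \<le> nrm (a - x)}. ?f w a * ?f y a * ?f x a)
    \<le> 8 * 48 ^ ?d * (1 / ?n ^ (?d - 2) * (1 / nrm (w - y) ^ (?d - 4)))" .
  have "(\<Sum>a\<in>{a\<in>A. \<not> ?n / 4 \<le> nrm (a - x)}. ?f w a * ?f y a * ?f x a)
     \<le> (\<Sum>a\<in>{a\<in>A. \<not> ?n / 4 \<le> nrm (a - x)}. 1 / (?n / 2) ^ (?d - 2) * (1 / (?n / 2) ^ (?d - 2)) * ?f x a)"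
  proof (intro sum_mono mult_right_mono mult_mono inverse_nrm_le)
    fix a assume a: "a \<in> {a\<in>A. \<not> ?n / 4 \<le> nrm (a - x)}"
    show "?n / 2 \<le> nrm (a - w)"
      using a nrm_triangle[of x c a] nrm_triangle[of a c w] nrm_minus_commute[of a x] assms(2) by auto
    show "?n / 2 \<le> nrm (a - y)"
      using a nrm_triangle[of x c a] nrm_triangle[of a c y] nrm_minus_commute[of a x] assms(3) by auto
  qed auto
  also have "\<dots> \<le> (\<Sum>a\<in>{a\<in>A. nrm (a - x) \<le> ?n}. 1 / (?n / 2) ^ (?d - 2) * (1 / (?n / 2) ^ (?d - 2)) * ?f x a)"
  proof (rule sum_mono2)
    have "?n / 4 \<le> ?n" using nrm_pos[of "x - c"] by linarith
    then show "{a\<in>A. \<not> ?n / 4 \<le> nrm (a - x)} \<subseteq> {a\<in>A. nrm (a - x) \<le> ?n}"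
      by (auto simp del: divide_le_eq_numeral1)
  qed (use assms in auto)
  also have "\<dots> \<le> 1 / (?n / 2) ^ (?d - 2) * (1 / (?n / 2) ^ (?d - 2)) * (2 * 6 ^ ?d * ?n ^ 2)"
    unfolding sum_distrib_left[symmetric]
    by (intro mult_left_mono sum_nrm_ball) (use assms d in auto)
  also have "\<dots> = 2 * 6 ^ ?d * 2 ^ (?d - 2) * 2 ^ (?d - 2) * (1 / ?n ^ (?d - 2) * (1 / ?n ^ (?d - 4)))"
  proof -
    have "?n ^ (?d - 2) = ?n ^ (?d - 4) * ?n ^ 2"
      unfolding power_add[symmetric] using d by (intro arg_cong2[where f = power]) auto
    then show ?thesis by (simp add: power_divide field_simps power2_eq_square)
  qed
  also have "\<dots> \<le> 8 * 48 ^ ?d * (1 / ?n ^ (?d - 2) * (1 / ?n ^ (?d - 4)))"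
  proof (rule mult_right_mono)
    have "(6::real) ^ ?d * 2 ^ (?d - 2) * 2 ^ (?d - 2) \<le> 6 ^ ?d * 2 ^ ?d * 2 ^ ?d"
      by (intro mult_mono power_increasing) auto
    also have "\<dots> = 24 ^ ?d" by (simp add: power_mult_distrib[symmetric])
    also have "\<dots> \<le> 48 ^ ?d" by (rule power_mono) auto
    finally have "(6::real) ^ ?d * 2 ^ (?d - 2) * 2 ^ (?d - 2) \<le> 48 ^ ?d" .
    then have "2 * ((6::real) ^ ?d * 2 ^ (?d - 2) * 2 ^ (?d - 2)) \<le> 8 * 48 ^ ?d"
      using zero_le_power[of "48::real" ?d] by linarith
    then show "(2::real) * 6 ^ ?d * 2 ^ (?d - 2) * 2 ^ (?d - 2) \<le> 8 * 48 ^ ?d" by (simp only: mult.assoc)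
  qed simp
  finally have 2: "(\<Sum>a\<in>{a\<in>A. \<not> ?n / 4 \<le> nrm (a - x)}. ?f w a * ?f y a * ?f x a)
    \<le> 8 * 48 ^ ?d * (1 / ?n ^ (?d - 2) * (1 / ?n ^ (?d - 4)))" .
  show ?thesis unfolding split using add_mono[OF 1 2] by (simp add: distrib_left)
qed

text \<open>Beyond twice their distance \<open>w\<close> and \<open>v\<close> are indistinguishable
  up to a factor 2, so this is a tail with exponent \<open>2 * d - 4\<close>.\<close>

lemma convolution_far:
  fixes w v :: "int ^ 'd"
  assumes "finite A" "2 * nrm (w - v) \<le> r" "1 \<le> r"
  shows "(\<Sum>t\<in>{t\<in>A. r \<le> nrm (t - w)}. 1 / nrm (t - w) ^ (CARD('d) - 2) * (1 / nrm (t - v) ^ (CARD('d) - 2)))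
    \<le> 2 * 24 ^ CARD('d) / r ^ (CARD('d) - 4)"
proof -
  let ?d = "CARD('d)" and ?B = "{t\<in>A. r \<le> nrm (t - w)}"
  have "(\<Sum>t\<in>?B. 1 / nrm (t - w) ^ (?d - 2) * (1 / nrm (t - v) ^ (?d - 2)))
    \<le> (\<Sum>t\<in>?B. 2 ^ ?d * (1 / nrm (t - w) ^ (2 * ?d - 4)))"
  proof (rule sum_mono)
    fix t assume t: "t \<in> ?B"
    have "nrm (t - w) / 2 \<le> nrm (t - v)"
      using t assms(2) nrm_triangle[of t w v] nrm_minus_commute[of w v] by auto
    then have "1 / nrm (t - w) ^ (?d - 2) * (1 / nrm (t - v) ^ (?d - 2))
      \<le> 1 / nrm (t - w) ^ (?d - 2) * (1 / (nrm (t - w) / 2) ^ (?d - 2))"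
      by (intro mult_left_mono inverse_nrm_le) auto
    also have "\<dots> = 2 ^ (?d - 2) * (1 / (nrm (t - w) ^ (?d - 2) * nrm (t - w) ^ (?d - 2)))"
      by (simp add: power_divide)
    also have "nrm (t - w) ^ (?d - 2) * nrm (t - w) ^ (?d - 2) = nrm (t - w) ^ (2 * ?d - 4)"
      using d by (simp add: power_add[symmetric]) (simp add: mult_2)
    also have "2 ^ (?d - 2) * (1 / nrm (t - w) ^ (2 * ?d - 4)) \<le> 2 ^ ?d * (1 / nrm (t - w) ^ (2 * ?d - 4))"
      by (intro mult_right_mono power_increasing) auto
    finally show "1 / nrm (t - w) ^ (?d - 2) * (1 / nrm (t - v) ^ (?d - 2)) \<le> 2 ^ ?d * (1 / nrm (t - w) ^ (2 * ?d - 4))" .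
  qed
  also have "\<dots> \<le> 2 ^ ?d * (2 * 6 ^ ?d * 2 ^ (?d - 4) / r ^ (?d - 4))"
    unfolding sum_distrib_left[symmetric]
    by (intro mult_left_mono sum_nrm_tail) (use assms d in auto)
  also have "\<dots> \<le> 2 ^ ?d * (2 * 6 ^ ?d * 2 ^ ?d / r ^ (?d - 4))"
    using assms(3) by (intro mult_left_mono divide_right_mono power_increasing) auto
  also have "\<dots> = 2 * 24 ^ ?d / r ^ (?d - 4)"
    using power_mult_distrib[of "2::real" 12 ?d] power_mult_distrib[of "6::real" 2 ?d] by simp
  finally show ?thesis .
qed

end

section \<open>Finite-volume approximation\<close>

lemma pr_0: "finite F \<Longrightarrow> pr 0 F A = of_bool (A {})"
  by (induction F arbitrary: A rule: finite_induct) (auto simp: pr_insert)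

lemma pr_1: "finite F \<Longrightarrow> pr 1 F A = of_bool (A F)"
  by (induction F arbitrary: A rule: finite_induct) (auto simp: pr_insert)

definition open_edges :: "'v set set \<Rightarrow> ('v set \<Rightarrow> bool) \<Rightarrow> 'v set set" where
  "open_edges F \<omega> = {e \<in> F. \<omega> e}"

text \<open>The bridge from the product measure to \<open>pr\<close>: the event is a finite disjoint
  union of cylinders. \<open>pmf (bernoulli_pmf p) True\<close> stands in place of \<open>p\<close>,
  which is not assumed to lie in the unit interval.\<close>

lemma measure_open_edges:
  assumes "finite F" "F \<subseteq> E"
  shows "measure (percolation E p) {\<omega> \<in> space (percolation E p). A (open_edges F \<omega>)}
    = pr (pmf (bernoulli_pmf p) True) F A"
proof -
  let ?M = "\<lambda>e::'a set. measure_pmf (bernoulli_pmf p)" and ?q = "pmf (bernoulli_pmf p) True"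
  interpret product_prob_space ?M E by standard
  let ?P = "percolation E p"
  have PM: "?P = PiM E ?M" by (simp add: percolation_def)
  have fin_meas: "finite_measure ?P" unfolding PM by unfold_locales
  let ?cyl = "\<lambda>\<eta>. prod_emb E ?M F (\<Pi>\<^sub>E e\<in>F. {e \<in> \<eta>})"
  have cyl: "?cyl \<eta> = {\<omega> \<in> space ?P. open_edges F \<omega> = \<eta>}" if "\<eta> \<subseteq> F" for \<eta>
  proof -
    have sp: "space ?P = (\<Pi>\<^sub>E e\<in>E. UNIV)" unfolding PM by (simp add: space_PiM)
    have "\<omega> \<in> ?cyl \<eta> \<longleftrightarrow> \<omega> \<in> space ?P \<and> (\<forall>e\<in>F. \<omega> e = (e \<in> \<eta>))" for \<omega>
      unfolding prod_emb_def sp by (auto simp: PiE_iff restrict_def extensional_def)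
    moreover have "(\<forall>e\<in>F. \<omega> e = (e \<in> \<eta>)) \<longleftrightarrow> open_edges F \<omega> = \<eta>" for \<omega>
      using that by (auto simp: open_edges_def)
    ultimately show ?thesis by auto
  qed
  have one: "measure_pmf.prob (bernoulli_pmf p) {b} = (if b then ?q else 1 - ?q)" for b
  proof -
    have "?q + pmf (bernoulli_pmf p) False = 1"
      using sum_pmf_eq_1[OF finite subset_UNIV, of "bernoulli_pmf p"] by (simp add: UNIV_bool add.commute)
    then show ?thesis by (cases b) (auto simp: measure_pmf_single)
  qed
  have mcyl: "measure ?P (?cyl \<eta>) = (\<Prod>e\<in>F. if e \<in> \<eta> then ?q else 1 - ?q)" for \<eta>
    unfolding PM by (subst measure_PiM_emb[OF assms(2,1)]) (auto simp: one)
  have "{\<omega> \<in> space ?P. A (open_edges F \<omega>)} = (\<Union>\<eta>\<in>{\<eta>\<in>Pow F. A \<eta>}. ?cyl \<eta>)"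
    using cyl by (auto simp: open_edges_def)
  then have "measure ?P {\<omega> \<in> space ?P. A (open_edges F \<omega>)} = measure ?P (\<Union>\<eta>\<in>{\<eta>\<in>Pow F. A \<eta>}. ?cyl \<eta>)"
    by simp
  also have "\<dots> = (\<Sum>\<eta>\<in>{\<eta>\<in>Pow F. A \<eta>}. measure ?P (?cyl \<eta>))"
  proof (rule finite_measure.finite_measure_finite_Union[OF fin_meas])
    show "finite {\<eta>\<in>Pow F. A \<eta>}" using assms by simp
    show "?cyl ` {\<eta>\<in>Pow F. A \<eta>} \<subseteq> sets ?P"
    proof safe
      fix \<eta> show "?cyl \<eta> \<in> sets ?P" unfolding PM
        by (rule sets_PiM_I[OF assms(1,2)]) auto
    qed
    show "disjoint_family_on ?cyl {\<eta>\<in>Pow F. A \<eta>}"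
      unfolding disjoint_family_on_def
    proof (intro ballI impI)
      fix \<eta> \<eta>' assume "\<eta> \<in> {\<eta>\<in>Pow F. A \<eta>}" "\<eta>' \<in> {\<eta>\<in>Pow F. A \<eta>}" "\<eta> \<noteq> \<eta>'"
      then show "?cyl \<eta> \<inter> ?cyl \<eta>' = {}" using cyl[of \<eta>] cyl[of \<eta>'] by auto
    qed
  qed
  also have "\<dots> = pr ?q F A"
  proof -
    have "finite (Pow F)" using assms by simp
    then show ?thesis unfolding pr_def expect_def mcyl sum.inter_filter[OF \<open>finite (Pow F)\<close>]
      by (intro sum.cong) auto
  qed
  finally show ?thesis .
qed

lemma connected_in_iff_conn:
  assumes "F \<subseteq> E" "\<And>e. e \<in> E \<Longrightarrow> e \<subseteq> A \<Longrightarrow> e \<in> F"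
  shows "connected_in E A \<omega> x y \<longleftrightarrow> conn (open_edges F \<omega>) A x y"
proof -
  have "successively (\<lambda>u v. {u, v} \<in> E \<and> \<omega> {u, v}) \<gamma> \<longleftrightarrow> path_edges \<gamma> \<subseteq> open_edges F \<omega>"
    if "set \<gamma> \<subseteq> A" for \<gamma>
    using that assms by (induction \<gamma> rule: path_edges.induct) (auto simp: open_edges_def)
  then show ?thesis unfolding connected_in_def conn_def by blast
qed

lemma tau_eq_pr:
  assumes "finite F" "F \<subseteq> E" "\<And>e. e \<in> E \<Longrightarrow> e \<subseteq> A \<Longrightarrow> e \<in> F"
  shows "tau E A p x y = pr (pmf (bernoulli_pmf p) True) F (\<lambda>\<omega>. conn \<omega> A x y)"
proof -
  have "{\<omega> \<in> space (percolation E p). connected_in E A \<omega> x y}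
      = {\<omega> \<in> space (percolation E p). conn (open_edges F \<omega>) A x y}"
    using connected_in_iff_conn[OF assms(2,3)] by blast
  then show ?thesis unfolding tau_def by (simp only:) (rule measure_open_edges[OF assms(1,2), of p "\<lambda>\<omega>. conn \<omega> A x y"])
qed

lemma prob_space_percolation: "prob_space (percolation E p)"
  unfolding percolation_def by (intro prob_space_PiM) unfold_locales

lemma connected_in_mono: "connected_in E A \<omega> x y \<Longrightarrow> A \<subseteq> B \<Longrightarrow> connected_in E B \<omega> x y"
  unfolding connected_in_def by blast

lemma connected_in_event:
  fixes E :: "(int ^ 'd) set set"
  shows "{\<omega> \<in> space (percolation E p). connected_in E A \<omega> x y} \<in> sets (percolation E p)"
  using connected_in_measurable[where E = E and p = p and S = A and x = x and y = y] by (simp add: pred_def)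

lemma tau_mono:
  fixes E :: "(int ^ 'd) set set"
  assumes "A \<subseteq> B" shows "tau E A p x y \<le> tau E B p x y"
proof -
  interpret prob_space "percolation E p" by (rule prob_space_percolation)
  show ?thesis unfolding tau_def
    by (rule finite_measure_mono[OF _ connected_in_event]) (use connected_in_mono[OF _ assms] in auto)
qed

lemma tau_nonneg: "0 \<le> tau E A p x y"
  unfolding tau_def by simp

lemma tau_cube_tendsto:
  fixes E :: "(int ^ 'd) set set"
  shows "(\<lambda>n. tau E (cube 0 (int n)) p x y) \<longlonglongrightarrow> tau E UNIV p x y"
proof -
  interpret prob_space "percolation E p" by (rule prob_space_percolation)
  let ?A = "\<lambda>n. {\<omega> \<in> space (percolation E p). connected_in E (cube 0 (int n)) \<omega> x y}"
  have cube: "cube (0 :: int ^ 'd) (int m) \<subseteq> cube 0 (int n)" if "m \<le> n" for m n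
    using that by (auto simp: cube_def intro: order_trans)
  have "(\<lambda>n. measure (percolation E p) (?A n)) \<longlonglongrightarrow> measure (percolation E p) (\<Union>n. ?A n)"
  proof (rule finite_Lim_measure_incseq)
    show "range ?A \<subseteq> sets (percolation E p)" using connected_in_event by blast
    show "incseq ?A" unfolding incseq_def using connected_in_mono[OF _ cube] by blast
  qed
  moreover have "(\<Union>n. ?A n) = {\<omega> \<in> space (percolation E p). connected_in E UNIV \<omega> x y}"
  proof safe
    fix \<omega> assume \<omega>: "connected_in E UNIV \<omega> x y" "\<omega> \<in> space (percolation E p)"
    then obtain \<gamma> where \<gamma>: "\<gamma> \<noteq> []" "hd \<gamma> = x" "last \<gamma> = y"
      "successively (\<lambda>u v. {u, v} \<in> E \<and> \<omega> {u, v}) \<gamma>"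
      unfolding connected_in_def by blast
    define n where "n = nat (Max (linf_norm ` set \<gamma>))"
    have "set \<gamma> \<subseteq> cube 0 (int n)"
    proof
      fix z assume z: "z \<in> set \<gamma>"
      have "linf_norm z \<le> Max (linf_norm ` set \<gamma>)" using z by simp
      then have "linf_norm z \<le> int n" unfolding n_def by linarith
      then show "z \<in> cube 0 (int n)" unfolding linf_norm_le_iff cube_def by simp
    qed
    then have "connected_in E (cube 0 (int n)) \<omega> x y" unfolding connected_in_def using \<gamma> by blast
    then show "\<omega> \<in> (\<Union>n. ?A n)" using \<omega>(2) by blast
  qed (auto intro: connected_in_mono)
  ultimately show ?thesis unfolding tau_def by simp
qed

text \<open>The upper two-point bound passes to cubes by monotonicity. The lower one survives, up to
  a factor 2, only for finitely many pairs at a time, so the cube has to be chosen after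
  \<open>K\<close>.\<close>

lemma tau_cube_approx:
  fixes E :: "(int ^ 'd) set set"
  assumes "finite K" "\<And>x y. x \<in> K \<Longrightarrow> y \<in> K \<Longrightarrow> 0 < tau E UNIV p x y"
  obtains n :: nat where "K \<subseteq> cube 0 (int n)"
    "\<And>x y. x \<in> K \<Longrightarrow> y \<in> K \<Longrightarrow> tau E UNIV p x y / 2 \<le> tau E (cube 0 (int n)) p x y"
proof -
  have "\<forall>\<^sub>F n in sequentially. \<forall>z\<in>K\<times>K. tau E UNIV p (fst z) (snd z) / 2 \<le> tau E (cube 0 (int n)) p (fst z) (snd z)"
  proof (rule eventually_ball_finite)
    show "\<forall>z\<in>K\<times>K. \<forall>\<^sub>F n in sequentially. tau E UNIV p (fst z) (snd z) / 2 \<le> tau E (cube 0 (int n)) p (fst z) (snd z)"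
    proof
      fix z assume "z \<in> K \<times> K"
      then have "tau E UNIV p (fst z) (snd z) / 2 < tau E UNIV p (fst z) (snd z)"
        using assms(2)[of "fst z" "snd z"] by auto
      from order_tendstoD(1)[OF tau_cube_tendsto this]
      show "\<forall>\<^sub>F n in sequentially. tau E UNIV p (fst z) (snd z) / 2 \<le> tau E (cube 0 (int n)) p (fst z) (snd z)"
        by (rule eventually_mono) simp
    qed
  qed (use assms in simp)
  moreover have "\<forall>\<^sub>F n in sequentially. K \<subseteq> cube 0 (int n)"
    unfolding subset_iff Ball_def[symmetric]
  proof (rule eventually_ball_finite[OF assms(1)], rule ballI)
    fix z assume "z \<in> K"
    have "z \<in> cube 0 (int n)" if "nat (linf_norm z) \<le> n" for n
    proof -
      have "linf_norm z \<le> int n" using that by linarith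
      then show ?thesis unfolding linf_norm_le_iff cube_def by simp
    qed
    then show "\<forall>\<^sub>F n in sequentially. z \<in> cube 0 (int n)"
      unfolding eventually_sequentially by blast
  qed
  ultimately have "\<forall>\<^sub>F n in sequentially. (\<forall>z\<in>K\<times>K. tau E UNIV p (fst z) (snd z) / 2 \<le> tau E (cube 0 (int n)) p (fst z) (snd z)) \<and> K \<subseteq> cube 0 (int n)"
    by (rule eventually_conj)
  then obtain n where n: "\<forall>z\<in>K\<times>K. tau E UNIV p (fst z) (snd z) / 2 \<le> tau E (cube 0 (int n)) p (fst z) (snd z)" "K \<subseteq> cube 0 (int n)"
    unfolding eventually_sequentially by blast
  show ?thesis by (rule that[OF n(2)]) (use n(1) in auto)
qed

section \<open>The edge set and nontriviality of the parameter\<close>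

lemma nn_edge_in:
  assumes "percolation_edge_set E" "l1_norm (x - y) = 1" shows "{x, y} \<in> E"
  using assms unfolding percolation_edge_set_def nn_edges_def spread_out_edges_def
proof (elim disjE exE conjE)
  fix L :: real assume "1 \<le> L" "E = {{x, y} |x y. x \<noteq> y \<and> real_of_int (l1_norm (x - y)) \<le> L}"
  moreover have "x \<noteq> y" using assms(2) by (auto simp: l1_norm_def)
  ultimately show ?thesis using assms(2) by (simp, intro exI[of _ x] exI[of _ y]) simp
qed auto

lemma linf_le_l1: "linf_norm z \<le> l1_norm z"
  unfolding linf_norm_le_iff
proof
  fix i show "\<bar>z $ i\<bar> \<le> l1_norm z" unfolding l1_norm_def by (rule member_le_sum) auto
qed

lemma edge_form:
  assumes "percolation_edge_set E" "e \<in> E"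
  obtains u v where "e = {u, v}"
  using assms unfolding percolation_edge_set_def nn_edges_def spread_out_edges_def by auto

lemma edge_range:
  assumes "percolation_edge_set E"
  obtains L :: real where "1 \<le> L" "\<And>u v. {u, v} \<in> E \<Longrightarrow> nrm (u - v) \<le> L"
proof -
  obtain L :: real where L: "1 \<le> L" "\<And>u v. {u, v} \<in> E \<Longrightarrow> real_of_int (l1_norm (u - v)) \<le> L"
  proof (cases "E = nn_edges")
    case True
    then show ?thesis
      by (intro that[of 1]) (auto simp: nn_edges_def doubleton_eq_iff l1_norm_minus_commute)
  next
    case False
    then obtain L where L: "1 \<le> L" "E = spread_out_edges L"
      using assms unfolding percolation_edge_set_def by blast
    show ?thesis
      by (rule that[OF L(1)]) (auto simp: L(2) spread_out_edges_def doubleton_eq_iff l1_norm_minus_commute)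
  qed
  show ?thesis
  proof (rule that[OF L(1)])
    fix u v assume "{u, v} \<in> E"
    then show "nrm (u - v) \<le> L" using L(1) L(2)[of u v] linf_le_l1[of "u - v"] by (simp add: nrm_def)
  qed
qed

text \<open>\<open>bernoulli_pmf\<close> truncates its argument to the unit interval, so the statement has content for every
  real \<open>p\<close>.\<close>

lemma parameter_nontrivial:
  fixes E :: "(int ^ 'd) set set"
  assumes E: "percolation_edge_set E" and d: "2 < CARD('d)"
    and lower: "\<And>x y. 0 < tau E UNIV p x y"
    and upper: "\<And>x y. tau E UNIV p x y \<le> b / nrm (x - y) ^ (CARD('d) - 2)"
  shows "0 < p" "p < 1"
proof -
  let ?q = "pmf (bernoulli_pmf p) True"
  let ?F = "\<lambda>n. {e\<in>E. e \<subseteq> cube 0 (int n)}"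
  have finF: "finite (?F n)" for n
    by (rule finite_subset[of _ "Pow (cube 0 (int n))"]) (auto simp: card_cube)
  have tau: "tau E (cube 0 (int n)) p x y = pr ?q (?F n) (\<lambda>\<omega>. conn \<omega> (cube 0 (int n)) x y)" for n x y
    by (rule tau_eq_pr[OF finF]) auto
  define y :: "nat \<Rightarrow> int ^ 'd" where "y = (\<lambda>k. \<chi> i. int k)"
  have ny: "real k \<le> nrm (0 - y k)" for k
  proof -
    have "int k \<le> linf_norm (0 - y k)" using abs_le_linf_norm[of "0 - y k" undefined] by (simp add: y_def)
    then show ?thesis unfolding nrm_def by linarith
  qed
  \<comment> \<open>Without open edges distinct vertices are never connected, contrary to the lower
    bound.\<close>
  have q0: "?q \<noteq> 0"
  proof
    assume q: "?q = 0"
    have "\<not> conn {} A (0 :: int ^ 'd) (y 1)" for A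
    proof
      assume "conn {} A 0 (y 1)"
      then have "y 1 \<in> {0}" by (rule conn_closed) auto
      then show False by (auto simp: y_def vec_eq_iff)
    qed
    then have "tau E (cube 0 (int n)) p 0 (y 1) = 0" for n
      unfolding tau q pr_0[OF finF] by simp
    then have "(\<lambda>n. 0) \<longlonglongrightarrow> tau E UNIV p 0 (y 1)" using tau_cube_tendsto[of E p 0 "y 1"] by simp
    then have "tau E UNIV p 0 (y 1) = 0" by (simp add: LIMSEQ_const_iff)
    then show False using lower[of 0 "y 1"] by simp
  qed
  \<comment> \<open>With all edges open cubes are connected, so the two-point function is 1 at a
    distance above \<open>b\<close>, contrary to its decay.\<close>
  have q1: "?q \<noteq> 1"
  proof
    assume q: "?q = 1"
    obtain k :: nat where k: "b < real k" using reals_Archimedean2 by blast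
    define m where "m = Suc k"
    let ?B = "cube (0 :: int ^ 'd) (int m)"
    define t :: "int ^ 'd" where "t = (\<chi> i. int m + 1)"
    have t: "t \<notin> ?B" by (auto simp: cube_def t_def)
    have b: "0 \<in> ?B" "y m \<in> ?B" by (auto simp: cube_def y_def)
    have "conn (?F m) (?B - {t}) 0 (y m)"
    proof (rule cube_minus_point_connected)
      show "{x, y} \<in> ?F m" if "x \<in> ?B" "y \<in> ?B" "l1_norm (x - y) = 1" for x y
        using that nn_edge_in[OF E] by auto
    qed (use b t d m_def in auto)
    then have "conn (?F m) ?B 0 (y m)" using t by simp
    then have "tau E ?B p 0 (y m) = 1" unfolding tau q pr_1[OF finF] by simp
    then have "1 \<le> b / nrm (0 - y m) ^ (CARD('d) - 2)"
      using tau_mono[OF subset_UNIV, of E ?B p 0 "y m"] upper[of 0 "y m"] by linarith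
    then have "nrm (0 - y m) ^ (CARD('d) - 2) \<le> b"
      using nrm_pos[of "0 - y m"] by (simp add: pos_le_divide_eq)
    moreover have "nrm (0 - y m) ^ 1 \<le> nrm (0 - y m) ^ (CARD('d) - 2)"
      using d by (intro power_increasing) auto
    ultimately show False using ny[of m] k by (simp add: m_def)
  qed
  have "?q = min 1 (max 0 p)" by (simp add: bernoulli_pmf.rep_eq)
  then show "0 < p" "p < 1" using q0 q1 by (auto simp: min_def max_def split: if_splits)
qed

section \<open>Visits of the selected path near the boundary\<close>

text \<open>\<open>4\<close> gives \<open>4 * r \<le> r\<^sup>2\<close>, \<open>L\<close> keeps
  neighbours within distance \<open>r\<close>, the third entry beats the error in
  \<open>local_exit_lower_bound\<close>, and \<open>8 * d + 1\<close> is the order of the moment,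
  which must not exceed the truncation level in \<open>sum_visit_le\<close>.\<close>

definition scale_min :: "nat \<Rightarrow> real \<Rightarrow> real \<Rightarrow> real \<Rightarrow> real" where
  "scale_min d a b L = max (max 4 L) (max (4 * 48 ^ d * b\<^sup>2 / a) (real (8 * d + 1)))"

text \<open>\<open>1\<close> comes from the truncation level; the rest is the moment bound of order
  \<open>8 * d + 1\<close>, multiplied by the constant of \<open>sum_near_boundary\<close>.\<close>

definition visit_const :: "nat \<Rightarrow> real \<Rightarrow> real \<Rightarrow> real" where
  "visit_const d a b =
     1 + real (8 * d + 1) ^ (8 * d + 1) * (8 * 6 ^ d * b) ^ (8 * d) * (2 * 18 ^ d / a)"

text \<open>\<open>V\<close> is a finite box in place of the lattice. The upper bound holds on all
  of it, the lower bound only on the finite set \<open>K\<close>, which contains \<open>S\<close>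
  and its neighbours; this is what \<open>tau_cube_approx\<close> can provide.\<close>

locale lattice_percolation = finite_percolation p F V
  for p :: real and F :: "(int ^ 'd) set set" and V :: "(int ^ 'd) set" +
  fixes K S :: "(int ^ 'd) set" and root :: "int ^ 'd" and a b L :: real
  assumes dim: "7 \<le> CARD('d)" and p_pos: "0 < p" and p_less_1: "p < 1"
    and a_pos: "0 < a" and b_pos: "0 < b" and L_ge_1: "1 \<le> L"
    and K_sub: "K \<subseteq> V" and S_sub: "S \<subseteq> K" and root: "root \<in> S"
    and upper: "\<And>x y. T V x y \<le> b / nrm (x - y) ^ (CARD('d) - 2)"
    and lower: "\<And>x y. x \<in> K \<Longrightarrow> y \<in> K \<Longrightarrow> a / nrm (x - y) ^ (CARD('d) - 2) \<le> T V x y"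
    and range: "\<And>u v. {u, v} \<in> F \<Longrightarrow> nrm (u - v) \<le> L"
    and edges: "\<And>e. e \<in> F \<Longrightarrow> \<exists>u v. e = {u, v}"
    and nn: "\<And>x y. x \<in> V \<Longrightarrow> y \<in> V \<Longrightarrow> l1_norm (x - y) = 1 \<Longrightarrow> {x, y} \<in> F"
    and neighbours: "\<And>u v. u \<in> S \<Longrightarrow> {u, v} \<in> F \<Longrightarrow> v \<in> K"
begin

abbreviation "bd \<equiv> inner_boundary S"

definition \<phi> :: real where "\<phi> = (\<Sum>u\<in>bd. T S root u)"

lemma S_V: "S \<subseteq> V" using S_sub K_sub by blast

lemma finite_S: "finite S" using S_V finite_V finite_subset by blast

lemma bd_sub: "bd \<subseteq> S" by (auto simp: inner_boundary_def)

lemma finite_bd: "finite bd" using bd_sub finite_S finite_subset by blast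

lemma \<phi>_nonneg: "0 \<le> \<phi>" unfolding \<phi>_def by (intro sum_nonneg) simp

lemma bd_exit:
  assumes "u \<in> bd" obtains v where "v \<notin> S" "v \<in> K" "nrm (u - v) \<le> L"
  using assms neighbours range unfolding inner_boundary_def by blast

text \<open>A path from \<open>w\<close> to \<open>v\<close> must leave \<open>S\<close>. Leaving it
  farther than \<open>r\<^sup>2\<close> from \<open>w\<close> has probability of order
  \<open>r ^ (- 2 * (d - 4))\<close>, negligible against the two-point lower bound of order
  \<open>r ^ (- (d - 2))\<close>.\<close>

lemma local_exit_lower_bound:
  assumes r: "scale_min CARD('d) a b L \<le> r" and w: "w \<in> S" and v: "v \<in> K" "v \<notin> S" "nrm (w - v) \<le> 2 * r"
  shows "a / (2 * (2 * r) ^ (CARD('d) - 2)) \<le> (\<Sum>u\<in>{u\<in>bd. nrm (u - w) \<le> r\<^sup>2}. T S w u)"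
proof -
  let ?d = "CARD('d)"
  have r4: "4 \<le> r" and rc: "4 * 48 ^ ?d * b\<^sup>2 / a \<le> r" using r unfolding scale_min_def by auto
  have r2: "4 * r \<le> r\<^sup>2" using r4 by (simp add: power2_eq_square)
  have d5: "5 \<le> ?d" using dim by simp
  let ?D = "{u. nrm (u - w) \<le> r\<^sup>2}"
  have "a / (2 * r) ^ (?d - 2) \<le> a / nrm (w - v) ^ (?d - 2)"
    using v(3) a_pos r4 by (intro divide_left_mono power_mono mult_pos_pos) auto
  also have "\<dots> \<le> T V w v" using lower w v S_sub by blast
  also have "\<dots> \<le> (\<Sum>u\<in>bd \<inter> ?D. T S w u) + (\<Sum>t\<in>S - ?D. T V w t * T V t v)"
    by (rule T_first_exit[OF S_V w v(2)])
  finally have 1: "a / (2 * r) ^ (?d - 2) \<le> (\<Sum>u\<in>bd \<inter> ?D. T S w u) + (\<Sum>t\<in>S - ?D. T V w t * T V t v)" .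
  have "(\<Sum>t\<in>S - ?D. T V w t * T V t v)
    \<le> (\<Sum>t\<in>S - ?D. b\<^sup>2 * (1 / nrm (t - w) ^ (?d - 2) * (1 / nrm (t - v) ^ (?d - 2))))"
  proof (rule sum_mono)
    fix t
    have "T V w t * T V t v \<le> b / nrm (w - t) ^ (?d - 2) * (b / nrm (t - v) ^ (?d - 2))"
      using b_pos by (intro mult_mono upper) auto
    then show "T V w t * T V t v \<le> b\<^sup>2 * (1 / nrm (t - w) ^ (?d - 2) * (1 / nrm (t - v) ^ (?d - 2)))"
      by (simp add: power2_eq_square nrm_minus_commute[of w t])
  qed
  also have "\<dots> \<le> (\<Sum>t\<in>{t\<in>S. r\<^sup>2 \<le> nrm (t - w)}. b\<^sup>2 * (1 / nrm (t - w) ^ (?d - 2) * (1 / nrm (t - v) ^ (?d - 2))))"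
    by (rule sum_mono2) (use finite_S in auto)
  also have "\<dots> \<le> b\<^sup>2 * (2 * 24 ^ ?d / (r\<^sup>2) ^ (?d - 4))"
    unfolding sum_distrib_left[symmetric]
    by (intro mult_left_mono convolution_far[OF d5]) (use finite_S v(3) r2 r4 in auto)
  also have "\<dots> \<le> a / (2 * (2 * r) ^ (?d - 2))"
  proof -
    have "b\<^sup>2 * (2 * 24 ^ ?d) * (2 * (2 * r) ^ (?d - 2)) \<le> b\<^sup>2 * (2 * 24 ^ ?d) * (2 * (2 ^ ?d * r ^ (?d - 2)))"
    proof -
      have "(2 * r) ^ (?d - 2) = 2 ^ (?d - 2) * r ^ (?d - 2)" by (rule power_mult_distrib)
      also have "\<dots> \<le> 2 ^ ?d * r ^ (?d - 2)" using r4 by (intro mult_right_mono power_increasing) auto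
      finally show ?thesis by (intro mult_left_mono) auto
    qed
    also have "\<dots> = (4 * 48 ^ ?d * b\<^sup>2) * r ^ (?d - 2)"
      using power_mult_distrib[of "24::real" 2 ?d] by simp
    also have "\<dots> \<le> (r * a) * r ^ (?d - 2)"
      using rc a_pos r4 by (intro mult_right_mono) (auto simp: pos_divide_le_eq)
    also have "\<dots> = a * r ^ (?d - 1)" using dim by (simp add: power_Suc[symmetric] Suc_diff_Suc numeral_2_eq_2 del: power_Suc)
    \<comment> \<open>\<open>d - 1 \<le> 2 * (d - 4)\<close> says exactly \<open>d \<ge> 7\<close>;
      the spare factor \<open>r\<close> has already absorbed the constants.\<close>
    also have "\<dots> \<le> a * r ^ (2 * (?d - 4))"
      using r4 a_pos dim by (intro mult_left_mono power_increasing) auto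
    also have "\<dots> = a * (r\<^sup>2) ^ (?d - 4)" by (simp add: power_mult)
    finally show ?thesis using r4 a_pos by (simp add: field_simps)
  qed
  finally have 2: "(\<Sum>t\<in>S - ?D. T V w t * T V t v) \<le> a / (2 * (2 * r) ^ (?d - 2))" .
  have "bd \<inter> ?D = {u\<in>bd. nrm (u - w) \<le> r\<^sup>2}" by auto
  moreover have "a / (2 * r) ^ (?d - 2) = a / (2 * (2 * r) ^ (?d - 2)) + a / (2 * (2 * r) ^ (?d - 2))" by simp
  ultimately show ?thesis using order_trans[OF 1 add_left_mono[OF 2]] by (simp only: add_le_cancel_right)
qed

text \<open>Insert the local exit bound at \<open>w\<close>, extend the connection from
  \<open>root\<close> to \<open>u'\<close> by Harris, and count the pairs. The losses
  \<open>r ^ (d - 2)\<close>, \<open>r ^ d\<close> and \<open>r ^ (2 * d)\<close> together stay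
  below \<open>r ^ (4 * d)\<close>.\<close>

lemma sum_near_boundary:
  assumes r: "scale_min CARD('d) a b L \<le> r"
  shows "(\<Sum>u\<in>bd. \<Sum>w\<in>{w\<in>S. nrm (w - u) \<le> r}. T S root w) \<le> 2 * 18 ^ CARD('d) / a * r ^ (4 * CARD('d)) * \<phi>"
proof -
  let ?d = "CARD('d)"
  have r4: "4 \<le> r" and rL: "L \<le> r" using r unfolding scale_min_def by auto
  let ?c = "2 * (2 * r) ^ (?d - 2) / a"
  have c: "0 \<le> ?c" using a_pos r4 by auto
  have "(\<Sum>u\<in>bd. \<Sum>w\<in>{w\<in>S. nrm (w - u) \<le> r}. T S root w)
    \<le> (\<Sum>u\<in>bd. \<Sum>w\<in>{w\<in>S. nrm (w - u) \<le> r}. ?c * (\<Sum>u'\<in>{u'\<in>bd. nrm (u' - w) \<le> r\<^sup>2}. T S root u'))"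
  proof (intro sum_mono)
    fix u w assume u: "u \<in> bd" and w: "w \<in> {w\<in>S. nrm (w - u) \<le> r}"
    obtain v where v: "v \<notin> S" "v \<in> K" "nrm (u - v) \<le> L" using bd_exit[OF u] .
    have "nrm (w - v) \<le> 2 * r" using nrm_triangle[of w v u] w v(3) rL by auto
    then have "a / (2 * (2 * r) ^ (?d - 2)) \<le> (\<Sum>u\<in>{u\<in>bd. nrm (u - w) \<le> r\<^sup>2}. T S w u)"
      using w v by (intro local_exit_lower_bound[OF r, of w v]) auto
    then have "1 \<le> ?c * (\<Sum>u\<in>{u\<in>bd. nrm (u - w) \<le> r\<^sup>2}. T S w u)"
      using a_pos r4 by (simp add: field_simps)
    then have "T S root w * 1 \<le> T S root w * (?c * (\<Sum>u\<in>{u\<in>bd. nrm (u - w) \<le> r\<^sup>2}. T S w u))"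
      by (intro mult_left_mono) auto
    also have "\<dots> = ?c * (T S root w * (\<Sum>u\<in>{u\<in>bd. nrm (u - w) \<le> r\<^sup>2}. T S w u))"
      by (rule mult.left_commute)
    also have "\<dots> = ?c * (\<Sum>u\<in>{u\<in>bd. nrm (u - w) \<le> r\<^sup>2}. T S root w * T S w u)"
      by (simp only: sum_distrib_left)
    also have "\<dots> \<le> ?c * (\<Sum>u\<in>{u\<in>bd. nrm (u - w) \<le> r\<^sup>2}. T S root u)"
      by (intro mult_left_mono sum_mono T_harris c)
    finally show "T S root w \<le> ?c * (\<Sum>u'\<in>{u'\<in>bd. nrm (u' - w) \<le> r\<^sup>2}. T S root u')" by simp
  qed
  also have "\<dots> = ?c * (\<Sum>w\<in>S. \<Sum>u\<in>{u\<in>bd. nrm (w - u) \<le> r}. \<Sum>u'\<in>{u'\<in>bd. nrm (u' - w) \<le> r\<^sup>2}. T S root u')"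
    unfolding sum_distrib_left[symmetric]
    by (subst sum.swap_restrict[OF finite_bd finite_S]) (rule refl)
  also have "\<dots> \<le> ?c * (\<Sum>w\<in>S. (3 * r) ^ ?d * (\<Sum>u'\<in>{u'\<in>bd. nrm (u' - w) \<le> r\<^sup>2}. T S root u'))"
  proof (intro mult_left_mono sum_mono c)
    fix w
    have "real (card {u\<in>bd. nrm (w - u) \<le> r}) \<le> real (card {z. nrm (z - w) \<le> r})"
      using card_nrm_ball(1)[of r w] r4
      by (intro of_nat_mono card_mono) (auto simp: nrm_minus_commute)
    also have "\<dots> \<le> (3 * r) ^ ?d" using card_nrm_ball(2)[of r w] r4 by simp
    finally show "(\<Sum>u\<in>{u\<in>bd. nrm (w - u) \<le> r}. \<Sum>u'\<in>{u'\<in>bd. nrm (u' - w) \<le> r\<^sup>2}. T S root u')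
      \<le> (3 * r) ^ ?d * (\<Sum>u'\<in>{u'\<in>bd. nrm (u' - w) \<le> r\<^sup>2}. T S root u')"
      by (simp add: mult_right_mono sum_nonneg)
  qed
  also have "\<dots> = ?c * ((3 * r) ^ ?d * (\<Sum>u'\<in>bd. \<Sum>w\<in>{w\<in>S. nrm (u' - w) \<le> r\<^sup>2}. T S root u'))"
    unfolding sum_distrib_left[symmetric]
    by (subst sum.swap_restrict[OF finite_bd finite_S]) (rule refl)
  also have "\<dots> \<le> ?c * ((3 * r) ^ ?d * (\<Sum>u'\<in>bd. (3 * r\<^sup>2) ^ ?d * T S root u'))"
  proof (intro mult_left_mono sum_mono c)
    fix u'
    have r1: "1 \<le> r\<^sup>2" using r4 by (intro one_le_power) auto
    have "real (card {w\<in>S. nrm (u' - w) \<le> r\<^sup>2}) \<le> real (card {z. nrm (z - u') \<le> r\<^sup>2})"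
      using card_nrm_ball(1)[OF r1, of u']
      by (intro of_nat_mono card_mono) (auto simp: nrm_minus_commute)
    also have "\<dots> \<le> (3 * r\<^sup>2) ^ ?d" by (rule card_nrm_ball(2)[OF r1])
    finally show "(\<Sum>w\<in>{w\<in>S. nrm (u' - w) \<le> r\<^sup>2}. T S root u') \<le> (3 * r\<^sup>2) ^ ?d * T S root u'"
      by (simp add: mult_right_mono)
  qed (use r4 in auto)
  also have "\<dots> = ?c * (3 * r) ^ ?d * (3 * r\<^sup>2) ^ ?d * \<phi>"
    unfolding \<phi>_def by (simp add: sum_distrib_left mult.assoc)
  also have "\<dots> \<le> (2 * 18 ^ ?d / a * r ^ (4 * ?d)) * \<phi>"
  proof (rule mult_right_mono[OF _ \<phi>_nonneg])
    have "?c * (3 * r) ^ ?d * (3 * r\<^sup>2) ^ ?d \<le> (2 * (2 * r) ^ ?d / a) * (3 * r) ^ ?d * (3 * r\<^sup>2) ^ ?d"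
      using r4 a_pos by (intro mult_right_mono divide_right_mono mult_left_mono power_increasing) auto
    also have "\<dots> = 2 / a * ((2 * r) * (3 * r) * (3 * r\<^sup>2)) ^ ?d"
      unfolding power_mult_distrib by simp
    also have "(2 * r) * (3 * r) * (3 * r\<^sup>2) = 18 * r ^ 4"
      by (simp add: power2_eq_square power4_eq_xxxx)
    also have "(18 * r ^ 4) ^ ?d = 18 ^ ?d * r ^ (4 * ?d)" unfolding power_mult_distrib by (simp add: power_mult)
    finally show "?c * (3 * r) ^ ?d * (3 * r\<^sup>2) ^ ?d \<le> 2 * 18 ^ ?d / a * r ^ (4 * ?d)" by simp
  qed
  finally show ?thesis .
qed

text \<open>The moment of order \<open>8 d + 1\<close> of the number of visits to a cube of radius \<open>s\<^sup>2\<close>, compared with the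
  threshold \<open>s\<^sup>5\<close>, beats the polynomial loss in \<open>sum_near_boundary\<close>.\<close>

lemma sum_visit_cube:
  assumes s: "scale_min CARD('d) a b L \<le> s"
  shows "(\<Sum>u\<in>bd. \<Sum>w\<in>{w\<in>S. nrm (w - u) \<le> s\<^sup>2}. visit S root u w) \<le> visit_const CARD('d) a b * s ^ 5 * \<phi>"
proof -
  let ?d = "CARD('d)" and ?m = "8 * CARD('d) + 1"
  let ?B = "\<lambda>u. {w\<in>S. nrm (w - u) \<le> s\<^sup>2}"
  \<comment> \<open>Seen from one of its points the cube lies in one of radius
    \<open>2 * s\<^sup>2\<close>, so \<open>sum_nrm_ball\<close> bounds the cost of a link by
    \<open>\<kappa> * s ^ 4\<close>.\<close>
  define \<kappa> where "\<kappa> = 8 * 6 ^ ?d * b"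
  have \<kappa>: "0 \<le> \<kappa>" using b_pos by (simp add: \<kappa>_def)
  have s4: "4 \<le> s" and sm: "real ?m \<le> s" using s unfolding scale_min_def by auto
  have s2: "scale_min ?d a b L \<le> s\<^sup>2"
  proof -
    have "s * 1 \<le> s * s" using s4 by (intro mult_left_mono) auto
    then show ?thesis using s by (simp add: power2_eq_square)
  qed
  have s21: "1 \<le> s\<^sup>2" using s4 by (intro one_le_power) auto
  have mn: "real ?m \<le> s ^ 5"
  proof -
    have "s ^ 1 \<le> s ^ 5" using s4 by (intro power_increasing) auto
    then show ?thesis using sm by simp
  qed
  define c where "c = real ?m ^ ?m / (s ^ 5) ^ (?m - 1)"
  have c: "0 \<le> c" using s4 by (simp add: c_def)
  have one: "(\<Sum>w\<in>?B u. visit S root u w) \<le> s ^ 5 * T S root u + c * ((\<Sum>w\<in>?B u. T S root w) * (\<kappa> * s ^ 4) ^ (8 * ?d))" for u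
  proof -
    have Bs: "?B u \<subseteq> S" by auto
    have main: "(\<Sum>w\<in>?B u. visit S root u w) \<le> s ^ 5 * T S root u +
      c * (\<Sum>ws\<in>{ws. set ws \<subseteq> ?B u \<and> length ws = ?m}. pr p F (chain S root ws))"
      unfolding c_def by (rule sum_visit_le[OF finite_S Bs _ mn]) simp
    have "(\<Sum>ws\<in>{ws. set ws \<subseteq> ?B u \<and> length ws = ?m}. pr p F (chain S root ws))
      \<le> (\<Sum>w\<in>?B u. T S root w) * (\<kappa> * s ^ 4) ^ (8 * ?d)"
      unfolding Suc_eq_plus1[symmetric]
    proof (rule sum_chain_le)
      fix w assume w: "w \<in> ?B u"
      have "(\<Sum>z\<in>?B u. T S w z) \<le> (\<Sum>z\<in>?B u. b * (1 / nrm (z - w) ^ (?d - 2)))"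
      proof (rule sum_mono)
        fix z
        have "T S w z \<le> b / nrm (w - z) ^ (?d - 2)"
          using T_mono[OF S_V, of w z] upper[of w z] by linarith
        then show "T S w z \<le> b * (1 / nrm (z - w) ^ (?d - 2))" by (simp add: nrm_minus_commute)
      qed
      also have "\<dots> \<le> (\<Sum>z\<in>{z\<in>S. nrm (z - w) \<le> 2 * s\<^sup>2}. b * (1 / nrm (z - w) ^ (?d - 2)))"
      proof (rule sum_mono2)
        show "?B u \<subseteq> {z\<in>S. nrm (z - w) \<le> 2 * s\<^sup>2}"
        proof safe
          fix z assume "nrm (z - u) \<le> s\<^sup>2"
          then show "nrm (z - w) \<le> 2 * s\<^sup>2"
            using nrm_triangle[of z w u] nrm_minus_commute[of u w] w by auto
        qed
      qed (use finite_S b_pos in auto)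
      also have "\<dots> \<le> b * (2 * 6 ^ ?d * (2 * s\<^sup>2) ^ 2)"
        unfolding sum_distrib_left[symmetric]
        by (intro mult_left_mono sum_nrm_ball) (use finite_S dim s21 b_pos in auto)
      also have "\<dots> = \<kappa> * s ^ 4" by (simp add: \<kappa>_def power_mult_distrib power_mult[symmetric])
      finally show "(\<Sum>z\<in>?B u. T S w z) \<le> \<kappa> * s ^ 4" .
    qed (use \<kappa> s4 in auto)
    from mult_left_mono[OF this c] have "c * (\<Sum>ws\<in>{ws. set ws \<subseteq> ?B u \<and> length ws = ?m}. pr p F (chain S root ws))
      \<le> c * ((\<Sum>w\<in>?B u. T S root w) * (\<kappa> * s ^ 4) ^ (8 * ?d))" .
    with main show ?thesis by linarith
  qed
  have "(\<Sum>u\<in>bd. \<Sum>w\<in>?B u. visit S root u w)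
    \<le> (\<Sum>u\<in>bd. s ^ 5 * T S root u + c * ((\<Sum>w\<in>?B u. T S root w) * (\<kappa> * s ^ 4) ^ (8 * ?d)))"
    by (intro sum_mono one)
  also have "\<dots> = s ^ 5 * \<phi> + c * (\<kappa> * s ^ 4) ^ (8 * ?d) * (\<Sum>u\<in>bd. \<Sum>w\<in>?B u. T S root w)"
    unfolding \<phi>_def by (simp add: sum.distrib sum_distrib_left mult_ac)
  also have "\<dots> \<le> s ^ 5 * \<phi> + c * (\<kappa> * s ^ 4) ^ (8 * ?d) * (2 * 18 ^ ?d / a * (s\<^sup>2) ^ (4 * ?d) * \<phi>)"
    using c \<kappa> s4 by (intro add_left_mono mult_left_mono sum_near_boundary[OF s2]) auto
  also have "\<dots> = s ^ 5 * \<phi> + real ?m ^ ?m * \<kappa> ^ (8 * ?d) * (2 * 18 ^ ?d / a) * \<phi>"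
  proof -
    \<comment> \<open>Each of the \<open>8 * d\<close> links gains a factor \<open>s\<close> over
      the truncation level \<open>s ^ 5\<close>; together they cancel the loss
      \<open>(s\<^sup>2) ^ (4 * d)\<close> exactly, which fixes the order of the moment.\<close>
    have "(s ^ 4) ^ (8 * ?d) * (s\<^sup>2) ^ (4 * ?d) = (s ^ 5) ^ (8 * ?d)"
      by (simp add: power_mult[symmetric] power_add[symmetric])
    then have "(s ^ 4) ^ (8 * ?d) * (s\<^sup>2) ^ (4 * ?d) / (s ^ 5) ^ (8 * ?d) = 1" using s4 by simp
    moreover have "c * (\<kappa> * s ^ 4) ^ (8 * ?d) * (2 * 18 ^ ?d / a * (s\<^sup>2) ^ (4 * ?d) * \<phi>)
      = real ?m ^ ?m * \<kappa> ^ (8 * ?d) * (2 * 18 ^ ?d / a) * \<phi> * ((s ^ 4) ^ (8 * ?d) * (s\<^sup>2) ^ (4 * ?d) / (s ^ 5) ^ (8 * ?d))"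
      unfolding power_mult_distrib[of \<kappa>] c_def by (simp add: mult_ac)
    ultimately show ?thesis by simp
  qed
  also have "\<dots> \<le> s ^ 5 * \<phi> + s ^ 5 * (real ?m ^ ?m * \<kappa> ^ (8 * ?d) * (2 * 18 ^ ?d / a) * \<phi>)"
  proof (rule add_left_mono)
    have nn: "0 \<le> real ?m ^ ?m * \<kappa> ^ (8 * ?d) * (2 * 18 ^ ?d / a) * \<phi>"
      using \<kappa> a_pos \<phi>_nonneg by (intro mult_nonneg_nonneg) auto
    have "1 \<le> s ^ 5" using s4 by (intro one_le_power) auto
    from mult_right_mono[OF this nn]
    show "real ?m ^ ?m * \<kappa> ^ (8 * ?d) * (2 * 18 ^ ?d / a) * \<phi> \<le> s ^ 5 * (real ?m ^ ?m * \<kappa> ^ (8 * ?d) * (2 * 18 ^ ?d / a) * \<phi>)"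
      by simp
  qed
  also have "\<dots> = visit_const ?d a b * s ^ 5 * \<phi>"
    by (simp only: visit_const_def \<kappa>_def[symmetric] distrib_right mult_1_left) (simp only: mult_ac)
  finally show ?thesis .
qed

lemma visit_const_nonneg: "0 \<le> visit_const CARD('d) a b"
  unfolding visit_const_def using a_pos b_pos by auto

text \<open>Sum \<open>sum_visit_cube\<close> over the radii
  \<open>(2 ^ j * \<rho>)\<^sup>2\<close>. The scale \<open>s\<close> contributes at most
  \<open>s ^ 5 / s ^ 6\<close> times \<open>\<phi>\<close>, a geometric series of total order
  \<open>1 / \<rho>\<close>. Consecutive radii differ by the factor 4, whence
  \<open>4 ^ d\<close>.\<close>

lemma sum_visit_weighted:
  assumes \<rho>: "scale_min CARD('d) a b L \<le> \<rho>"
  shows "(\<Sum>u\<in>bd. \<Sum>w\<in>S. visit S root u w * (1 / max (\<rho>\<^sup>2) (nrm (w - u)) ^ (CARD('d) - 4)))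
    \<le> 2 * 4 ^ CARD('d) * visit_const CARD('d) a b * \<phi> / \<rho>"
proof -
  let ?d = "CARD('d)" and ?C = "visit_const CARD('d) a b"
  define s where "s = (\<lambda>j::nat. 2 ^ j * \<rho>)"
  have \<rho>4: "4 \<le> \<rho>" using \<rho> unfolding scale_min_def by auto
  have s\<rho>: "\<rho> \<le> s j" for j
    using \<rho>4 mult_right_mono[of 1 "2 ^ j" \<rho>] by (simp add: s_def)
  have s1: "1 \<le> s j" "0 < s j" for j using s\<rho>[of j] \<rho>4 by linarith+
  obtain J :: nat where J: "\<And>u w. u \<in> S \<Longrightarrow> w \<in> S \<Longrightarrow> nrm (w - u) \<le> (s J)\<^sup>2"
  proof -
    let ?M = "Max ((\<lambda>(u, w). nrm (w - u)) ` (S \<times> S))"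
    obtain J :: nat where J: "?M \<le> real J" using real_arch_simple by blast
    show ?thesis
    proof (rule that[of J])
      fix u w assume "u \<in> S" "w \<in> S"
      then have "nrm (w - u) \<le> ?M" using finite_S by (intro Max_ge) force+
      also have "\<dots> \<le> 2 ^ J" using J of_nat_less_two_power[of J, where 'a = real] by linarith
      also have "\<dots> \<le> s J * 1" using \<rho>4 by (simp add: s_def)
      also have "\<dots> \<le> s J * s J" using s1[of J] by (intro mult_left_mono) auto
      finally show "nrm (w - u) \<le> (s J)\<^sup>2" by (simp add: power2_eq_square)
    qed
  qed
  have term_le: "1 / max (\<rho>\<^sup>2) (nrm (w - u)) ^ (?d - 4)
    \<le> 4 ^ ?d * (\<Sum>j\<in>{j\<in>{..J}. nrm (w - u) \<le> (s j)\<^sup>2}. 1 / ((s j)\<^sup>2) ^ (?d - 4))"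
    if uw: "u \<in> S" "w \<in> S" for u w
  proof -
    let ?P = "\<lambda>j. nrm (w - u) \<le> (s j)\<^sup>2"
    define i where "i = (LEAST j. ?P j)"
    have i: "?P i" unfolding i_def by (rule LeastI[of ?P J]) (rule J[OF uw])
    have iJ: "i \<le> J" unfolding i_def by (rule Least_le) (rule J[OF uw])
    have lb: "(s i)\<^sup>2 / 4 \<le> max (\<rho>\<^sup>2) (nrm (w - u))"
    proof (cases i)
      case 0
      then have "(s i)\<^sup>2 = \<rho>\<^sup>2" by (simp add: s_def)
      moreover have "\<rho>\<^sup>2 / 4 \<le> \<rho>\<^sup>2" by simp
      ultimately show ?thesis by (simp add: le_max_iff_disj)
    next
      case (Suc k)
      then have "\<not> ?P k" using not_less_Least[of k ?P] unfolding i_def by auto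
      moreover have "s i = 2 * s k" using Suc by (simp add: s_def)
      ultimately show ?thesis by (simp add: power_mult_distrib)
    qed
    have "1 / max (\<rho>\<^sup>2) (nrm (w - u)) ^ (?d - 4) \<le> 1 / ((s i)\<^sup>2 / 4) ^ (?d - 4)"
      using lb s1[of i] by (intro divide_left_mono power_mono) (auto simp: less_max_iff_disj)
    also have "\<dots> = 4 ^ (?d - 4) * (1 / ((s i)\<^sup>2) ^ (?d - 4))" by (simp add: power_divide)
    also have "\<dots> \<le> 4 ^ ?d * (1 / ((s i)\<^sup>2) ^ (?d - 4))"
      by (intro mult_right_mono power_increasing) auto
    also have "1 / ((s i)\<^sup>2) ^ (?d - 4) = (\<Sum>j\<in>{i}. 1 / ((s j)\<^sup>2) ^ (?d - 4))" by simp
    also have "\<dots> \<le> (\<Sum>j\<in>{j\<in>{..J}. ?P j}. 1 / ((s j)\<^sup>2) ^ (?d - 4))"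
      by (rule sum_mono2) (use i iJ in auto)
    finally show ?thesis by simp
  qed
  have "(\<Sum>u\<in>bd. \<Sum>w\<in>S. visit S root u w * (1 / max (\<rho>\<^sup>2) (nrm (w - u)) ^ (?d - 4)))
    \<le> (\<Sum>u\<in>bd. \<Sum>w\<in>S. visit S root u w * (4 ^ ?d * (\<Sum>j\<in>{j\<in>{..J}. nrm (w - u) \<le> (s j)\<^sup>2}. 1 / ((s j)\<^sup>2) ^ (?d - 4))))"
    by (intro sum_mono mult_left_mono term_le) (use bd_sub in auto)
  also have "\<dots> = 4 ^ ?d * (\<Sum>u\<in>bd. \<Sum>w\<in>S. \<Sum>j\<in>{j\<in>{..J}. nrm (w - u) \<le> (s j)\<^sup>2}. visit S root u w / ((s j)\<^sup>2) ^ (?d - 4))"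
    by (simp add: sum_distrib_left mult_ac)
  also have "\<dots> = 4 ^ ?d * (\<Sum>u\<in>bd. \<Sum>j\<le>J. \<Sum>w\<in>{w\<in>S. nrm (w - u) \<le> (s j)\<^sup>2}. visit S root u w / ((s j)\<^sup>2) ^ (?d - 4))"
    by (subst sum.swap_restrict[OF finite_S finite_atMost]) (rule refl)
  also have "\<dots> = 4 ^ ?d * (\<Sum>j\<le>J. 1 / ((s j)\<^sup>2) ^ (?d - 4) * (\<Sum>u\<in>bd. \<Sum>w\<in>{w\<in>S. nrm (w - u) \<le> (s j)\<^sup>2}. visit S root u w))"
    by (subst sum.swap) (simp add: sum_distrib_left)
  also have "\<dots> \<le> 4 ^ ?d * (\<Sum>j\<le>J. 1 / ((s j)\<^sup>2) ^ (?d - 4) * (?C * s j ^ 5 * \<phi>))"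
    using \<rho> s\<rho> by (intro mult_left_mono sum_mono sum_visit_cube) (auto intro: order_trans)
  also have "\<dots> \<le> 4 ^ ?d * (\<Sum>j\<le>J. ?C * \<phi> * (1 / \<rho> * (1 / 2) ^ j))"
  proof (intro mult_left_mono sum_mono)
    fix j
    have "1 / ((s j)\<^sup>2) ^ (?d - 4) * (?C * s j ^ 5 * \<phi>) = ?C * \<phi> * (s j ^ 5 / ((s j)\<^sup>2) ^ (?d - 4))" by simp
    \<comment> \<open>\<open>2 * (d - 4) \<ge> 6\<close> is again \<open>d \<ge> 7\<close>.\<close>
    also have "s j ^ 5 / ((s j)\<^sup>2) ^ (?d - 4) \<le> s j ^ 5 / s j ^ 6"
      unfolding power_mult[symmetric] using s1[of j] dim
      by (intro divide_left_mono power_increasing) auto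
    also have "s j ^ 5 / s j ^ 6 = 1 / \<rho> * (1 / 2) ^ j"
      using s1(2)[of j] \<rho>4 by (simp add: s_def eval_nat_numeral power_one_over field_simps)
    finally show "1 / ((s j)\<^sup>2) ^ (?d - 4) * (?C * s j ^ 5 * \<phi>) \<le> ?C * \<phi> * (1 / \<rho> * (1 / 2) ^ j)"
      using visit_const_nonneg \<phi>_nonneg by (simp add: mult_left_mono)
  qed simp
  also have "\<dots> = 4 ^ ?d * ?C * \<phi> / \<rho> * (\<Sum>j\<le>J. (1 / 2) ^ j)"
    unfolding sum_distrib_left by (intro sum.cong refl) simp
  also have "\<dots> \<le> 4 ^ ?d * ?C * \<phi> / \<rho> * 2"
  proof (rule mult_left_mono)
    show "(\<Sum>j\<le>J. (1 / 2) ^ j) \<le> (2::real)"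
      using geometric_tail_le_double[of "1/2" 0 J] by (simp add: atMost_atLeast0)
    show "0 \<le> 4 ^ ?d * ?C * \<phi> / \<rho>"
      using visit_const_nonneg \<phi>_nonneg \<rho>4 by (intro divide_nonneg_nonneg mult_nonneg_nonneg) auto
  qed
  finally show ?thesis by (simp add: mult_ac)
qed

end

section \<open>Bounded boundary sums\<close>

text \<open>The product of the constants of \<open>convolution_triple\<close> with three factors
  \<open>b\<close>, of \<open>convolution_cube\<close> and of
  \<open>sum_visit_weighted\<close>.\<close>

definition loop_const :: "nat \<Rightarrow> real \<Rightarrow> real \<Rightarrow> real" where
  "loop_const d a b = 8 * 48 ^ d * b ^ 3 * (162 * 12 ^ d) * (2 * 4 ^ d * visit_const d a b)"

context lattice_percolation
begin

lemma visit_le_1: "visit S root u w \<le> 1"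
proof -
  have "visit S root u w \<le> pr p F (\<lambda>_. True)"
    unfolding visit_def by (rule selected_disjoint_union[OF finite_S, of _ root u]) auto
  then show ?thesis by (simp add: pr_True finite_F)
qed

text \<open>The loop vertex \<open>v\<close> sends arms to a vertex \<open>w\<close> of the selected
  path, to \<open>y\<close> and to \<open>z\<close>. The last term is harmless, as it vanishes when
  \<open>z\<close> recedes.\<close>

lemma loop_error:
  assumes "u \<in> bd" and far: "\<And>w. w \<in> S \<Longrightarrow> nrm (w - root) \<le> nrm (z - root) / 4" "nrm (y - root) \<le> nrm (z - root) / 4"
  shows "(\<Sum>v\<in>V. pr p F (\<lambda>\<omega>. conn \<omega> S root u \<and> conn \<omega> V root v) * (T V y v * T V v z))
    \<le> 8 * 48 ^ CARD('d) * b ^ 3 / nrm (z - root) ^ (CARD('d) - 2) *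
      (\<Sum>w\<in>S. visit S root u w * (1 / nrm (w - y) ^ (CARD('d) - 4) + 1 / nrm (z - root) ^ (CARD('d) - 4)))"
proof -
  let ?d = "CARD('d)"
  have d5: "5 \<le> ?d" using dim by simp
  let ?f = "\<lambda>x v. 1 / nrm (v - x) ^ (?d - 2)"
  have "(\<Sum>v\<in>V. pr p F (\<lambda>\<omega>. conn \<omega> S root u \<and> conn \<omega> V root v) * (T V y v * T V v z))
    \<le> (\<Sum>v\<in>V. (\<Sum>w\<in>S. visit S root u w * T V w v) * (T V y v * T V v z))"
    by (intro sum_mono mult_right_mono conn_both_le_visit[OF S_V]) auto
  also have "\<dots> = (\<Sum>v\<in>V. \<Sum>w\<in>S. visit S root u w * (T V w v * T V y v * T V v z))"
    unfolding sum_distrib_right by (intro sum.cong refl) (simp only: mult.assoc)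
  also have "\<dots> = (\<Sum>w\<in>S. \<Sum>v\<in>V. visit S root u w * (T V w v * T V y v * T V v z))" by (rule sum.swap)
  also have "\<dots> \<le> (\<Sum>w\<in>S. \<Sum>v\<in>V. visit S root u w * (b ^ 3 * (?f w v * ?f y v * ?f z v)))"
  proof (intro sum_mono mult_left_mono visit_nonneg)
    fix w v
    have u: "T V x v \<le> b * ?f x v" for x using upper[of x v] by (simp add: nrm_minus_commute[of x v])
    have "T V v z \<le> b * ?f z v" using upper[of v z] by simp
    then have "T V w v * T V y v * T V v z \<le> (b * ?f w v) * (b * ?f y v) * (b * ?f z v)"
      using b_pos by (intro mult_mono u) auto
    then show "T V w v * T V y v * T V v z \<le> b ^ 3 * (?f w v * ?f y v * ?f z v)"
      by (simp add: power3_eq_cube mult_ac)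
  qed
  also have "\<dots> = (\<Sum>w\<in>S. visit S root u w * (b ^ 3 * (\<Sum>v\<in>V. ?f w v * ?f y v * ?f z v)))"
    by (simp only: sum_distrib_left)
  also have "\<dots> \<le> (\<Sum>w\<in>S. visit S root u w * (b ^ 3 * (8 * 48 ^ ?d / nrm (z - root) ^ (?d - 2) *
      (1 / nrm (w - y) ^ (?d - 4) + 1 / nrm (z - root) ^ (?d - 4)))))"
    by (intro sum_mono mult_left_mono convolution_triple[OF d5 finite_V] far)
      (use b_pos in auto)
  also have "\<dots> = (\<Sum>w\<in>S. 8 * 48 ^ ?d * b ^ 3 / nrm (z - root) ^ (?d - 2) *
      (visit S root u w * (1 / nrm (w - y) ^ (?d - 4) + 1 / nrm (z - root) ^ (?d - 4))))"
    by (intro sum.cong refl) (simp add: mult_ac)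
  finally show ?thesis by (simp only: sum_distrib_left)
qed

text \<open>\<open>exploration\<close> summed over \<open>u\<close> and over \<open>y\<close> in the
  cube around \<open>u\<close>. The \<open>- 1\<close> bounds the error due to the finite distance
  of \<open>z\<close>, which \<open>large\<close> keeps below one.\<close>

lemma two_arm_lower_bound:
  assumes \<rho>: "scale_min CARD('d) a b L \<le> \<rho>" and z: "z \<in> K"
    and K: "\<And>u y. u \<in> bd \<Longrightarrow> nrm (y - u) \<le> \<rho>\<^sup>2 \<Longrightarrow> y \<in> K"
    and far: "\<And>w. w \<in> S \<Longrightarrow> nrm (w - root) \<le> nrm (z - root) / 4"
      "\<And>u y. u \<in> bd \<Longrightarrow> nrm (y - u) \<le> \<rho>\<^sup>2 \<Longrightarrow> nrm (y - root) \<le> nrm (z - root) / 4"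
    and large: "8 * 48 ^ CARD('d) * b ^ 3 * (3 * \<rho>\<^sup>2) ^ CARD('d) * (real (card S))\<^sup>2 \<le> nrm (z - root)"
  shows "((\<rho>\<^sup>2) ^ CARD('d) * \<phi> * (a / 2 ^ CARD('d) - loop_const CARD('d) a b / \<rho>) - 1) / nrm (z - root) ^ (CARD('d) - 2)
    \<le> (\<Sum>(u, y)\<in>(SIGMA u:bd. {y. nrm (y - u) \<le> \<rho>\<^sup>2}).
        pr p F (\<lambda>\<omega>. conn \<omega> S root u \<and> \<not> conn \<omega> V root y \<and> conn \<omega> V y z))"
proof -
  let ?d = "CARD('d)" and ?n = "nrm (z - root)" and ?R = "\<rho>\<^sup>2"
  let ?Y = "\<lambda>u. {y. nrm (y - u) \<le> ?R}"
  define X where "X = 1 / ?n ^ (?d - 2)"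
  have X: "0 < X" by (simp add: X_def)
  have d5: "5 \<le> ?d" using dim by simp
  have \<rho>4: "4 \<le> \<rho>" using \<rho> unfolding scale_min_def by auto
  have R1: "1 \<le> ?R" using \<rho>4 by (intro one_le_power) auto
  let ?c = "8 * 48 ^ ?d * b ^ 3"
  have c: "0 \<le> ?c" using b_pos by simp
  have finY: "finite (?Y u)" for u by (rule card_nrm_ball(1)[OF R1])
  note cardY = card_nrm_ball(2,3)[OF R1, where 'd = 'd]
  let ?G = "\<lambda>u y. pr p F (\<lambda>\<omega>. conn \<omega> S root u \<and> \<not> conn \<omega> V root y \<and> conn \<omega> V y z)"
  let ?v = "\<lambda>u w. visit S root u w"
  let ?W = "\<lambda>u y. \<Sum>w\<in>S. ?v u w * (1 / nrm (w - y) ^ (?d - 4) + 1 / ?n ^ (?d - 4))"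
  have one: "T S root u * (a / 2 ^ ?d * X) - ?c * X * ?W u y \<le> ?G u y"
    if u: "u \<in> bd" and y: "y \<in> ?Y u" for u y
  proof -
    have yK: "y \<in> K" using K u y by blast
    have "nrm (y - root) \<le> ?n / 4" using far(2)[OF u] y by blast
    then have "nrm (y - z) \<le> 2 * ?n"
      using nrm_triangle[of y z root] nrm_minus_commute[of root z] nrm_pos[of "z - root"] by linarith
    then have "a / (2 * ?n) ^ (?d - 2) \<le> a / nrm (y - z) ^ (?d - 2)"
      using a_pos by (intro divide_left_mono power_mono mult_pos_pos) auto
    also have "\<dots> \<le> T V y z" by (rule lower[OF yK z])
    finally have 1: "a / (2 * ?n) ^ (?d - 2) \<le> T V y z" .
    have "a / 2 ^ ?d * X \<le> a / 2 ^ (?d - 2) * X"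
      using a_pos X by (intro mult_right_mono divide_left_mono power_increasing mult_pos_pos) auto
    also have "\<dots> = a / (2 * ?n) ^ (?d - 2)" by (simp add: X_def power_mult_distrib)
    finally have "T S root u * (a / 2 ^ ?d * X) \<le> T S root u * T V y z"
      using 1 by (intro mult_left_mono) auto
    moreover have "(\<Sum>v\<in>V. pr p F (\<lambda>\<omega>. conn \<omega> S root u \<and> conn \<omega> V root v) * (T V y v * T V v z))
      \<le> ?c * X * ?W u y"
      using loop_error[OF u far(1) far(2)[OF u]] y by (simp add: X_def)
    moreover have "T S root u * T V y z - (\<Sum>v\<in>V. pr p F (\<lambda>\<omega>. conn \<omega> S root u \<and> conn \<omega> V root v) * (T V y v * T V v z)) \<le> ?G u y"
      using yK K_sub by (intro exploration[OF S_V root]) auto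
    ultimately show ?thesis by linarith
  qed
  have main: "?R ^ ?d * \<phi> * (a / 2 ^ ?d * X) \<le> (\<Sum>u\<in>bd. \<Sum>y\<in>?Y u. T S root u * (a / 2 ^ ?d * X))"
  proof -
    have "?R ^ ?d * \<phi> * (a / 2 ^ ?d * X) = (\<Sum>u\<in>bd. ?R ^ ?d * (T S root u * (a / 2 ^ ?d * X)))"
      unfolding \<phi>_def sum_distrib_left sum_distrib_right by (simp add: mult_ac)
    also have "\<dots> \<le> (\<Sum>u\<in>bd. real (card (?Y u)) * (T S root u * (a / 2 ^ ?d * X)))"
      using a_pos X by (intro sum_mono mult_right_mono cardY) auto
    finally show ?thesis by simp
  qed
  have inner: "(\<Sum>y\<in>?Y u. ?W u y)
    \<le> 162 * 12 ^ ?d * ?R ^ ?d * (\<Sum>w\<in>S. ?v u w * (1 / max ?R (nrm (w - u)) ^ (?d - 4))) + (3 * ?R) ^ ?d * real (card S) / ?n" for u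
  proof -
    have "(\<Sum>y\<in>?Y u. ?W u y)
      = (\<Sum>w\<in>S. ?v u w * (\<Sum>y\<in>?Y u. 1 / nrm (w - y) ^ (?d - 4) + 1 / ?n ^ (?d - 4)))"
      by (subst sum.swap) (simp only: sum_distrib_left)
    also have "\<dots> \<le> (\<Sum>w\<in>S. ?v u w * (162 * 12 ^ ?d * ?R ^ ?d / max ?R (nrm (w - u)) ^ (?d - 4) + (3 * ?R) ^ ?d / ?n))"
    proof (intro sum_mono mult_left_mono visit_nonneg)
      fix w
      have "(\<Sum>y\<in>?Y u. 1 / nrm (w - y) ^ (?d - 4)) \<le> 162 * 12 ^ ?d * ?R ^ ?d / max ?R (nrm (w - u)) ^ (?d - 4)"
        using convolution_cube[OF d5 finY[of u] R1, where w = w and u = u] by simp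
      moreover have "(\<Sum>y\<in>?Y u. 1 / ?n ^ (?d - 4)) \<le> (3 * ?R) ^ ?d / ?n"
      proof -
        have "(\<Sum>y\<in>?Y u. 1 / ?n ^ (?d - 4)) = real (card (?Y u)) * (1 / ?n ^ (?d - 4))" by simp
        also have "\<dots> \<le> (3 * ?R) ^ ?d * (1 / ?n ^ 1)"
          using dim cardY(1)[of u] by (intro mult_mono divide_left_mono power_increasing) auto
        finally show ?thesis by simp
      qed
      ultimately show "(\<Sum>y\<in>?Y u. 1 / nrm (w - y) ^ (?d - 4) + 1 / ?n ^ (?d - 4))
        \<le> 162 * 12 ^ ?d * ?R ^ ?d / max ?R (nrm (w - u)) ^ (?d - 4) + (3 * ?R) ^ ?d / ?n"
        unfolding sum.distrib by (rule add_mono)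
    qed
    also have "\<dots> = 162 * 12 ^ ?d * ?R ^ ?d * (\<Sum>w\<in>S. ?v u w * (1 / max ?R (nrm (w - u)) ^ (?d - 4))) + (3 * ?R) ^ ?d / ?n * (\<Sum>w\<in>S. ?v u w)"
      unfolding distrib_left sum.distrib sum_distrib_left
      by (intro arg_cong2[where f = "(+)"] sum.cong refl) simp_all
    also have "(3 * ?R) ^ ?d / ?n * (\<Sum>w\<in>S. ?v u w) \<le> (3 * ?R) ^ ?d / ?n * (\<Sum>w\<in>S. 1)"
      using R1 by (intro mult_left_mono sum_mono visit_le_1) auto
    finally show ?thesis by simp
  qed
  have err: "?c * X * (\<Sum>u\<in>bd. \<Sum>y\<in>?Y u. ?W u y)
    \<le> X * (?R ^ ?d * \<phi> * (loop_const ?d a b / \<rho>) + 1)"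
  proof -
    have "(\<Sum>u\<in>bd. \<Sum>y\<in>?Y u. ?W u y)
      \<le> (\<Sum>u\<in>bd. 162 * 12 ^ ?d * ?R ^ ?d * (\<Sum>w\<in>S. ?v u w * (1 / max ?R (nrm (w - u)) ^ (?d - 4))) + (3 * ?R) ^ ?d * real (card S) / ?n)"
      by (intro sum_mono inner)
    also have "\<dots> = 162 * 12 ^ ?d * ?R ^ ?d * (\<Sum>u\<in>bd. \<Sum>w\<in>S. ?v u w * (1 / max ?R (nrm (w - u)) ^ (?d - 4))) + real (card bd) * ((3 * ?R) ^ ?d * real (card S) / ?n)"
      by (simp add: sum.distrib sum_distrib_left)
    also have "\<dots> \<le> 162 * 12 ^ ?d * ?R ^ ?d * (2 * 4 ^ ?d * visit_const ?d a b * \<phi> / \<rho>) + real (card S) * ((3 * ?R) ^ ?d * real (card S) / ?n)"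
      using R1 card_mono[OF finite_S bd_sub]
      by (intro add_mono mult_left_mono mult_right_mono sum_visit_weighted[OF \<rho>]) auto
    finally have "?c * X * (\<Sum>u\<in>bd. \<Sum>y\<in>?Y u. ?W u y)
      \<le> ?c * X * (162 * 12 ^ ?d * ?R ^ ?d * (2 * 4 ^ ?d * visit_const ?d a b * \<phi> / \<rho>) + real (card S) * ((3 * ?R) ^ ?d * real (card S) / ?n))"
      using c X by (intro mult_left_mono) auto
    also have "\<dots> = X * (?R ^ ?d * \<phi> * (loop_const ?d a b / \<rho>) + (?c * (3 * ?R) ^ ?d * (real (card S))\<^sup>2) / ?n)"
      unfolding loop_const_def by (simp add: distrib_left power2_eq_square mult_ac)
    also have "\<dots> \<le> X * (?R ^ ?d * \<phi> * (loop_const ?d a b / \<rho>) + 1)"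
      using large X by (intro mult_left_mono add_left_mono) (auto simp: pos_divide_le_eq)
    finally show ?thesis .
  qed
  have "X * (?R ^ ?d * \<phi> * (a / 2 ^ ?d - loop_const ?d a b / \<rho>) - 1)
    = ?R ^ ?d * \<phi> * (a / 2 ^ ?d * X) - X * (?R ^ ?d * \<phi> * (loop_const ?d a b / \<rho>) + 1)"
    by (simp add: algebra_simps)
  also have "\<dots> \<le> (\<Sum>u\<in>bd. \<Sum>y\<in>?Y u. T S root u * (a / 2 ^ ?d * X))
     - ?c * X * (\<Sum>u\<in>bd. \<Sum>y\<in>?Y u. ?W u y)"
    by (rule diff_mono[OF main err])
  also have "\<dots> = (\<Sum>u\<in>bd. \<Sum>y\<in>?Y u. T S root u * (a / 2 ^ ?d * X)
     - ?c * X * ?W u y)"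
    by (simp only: sum_distrib_left sum_subtractf)
  also have "\<dots> \<le> (\<Sum>u\<in>bd. \<Sum>y\<in>?Y u. ?G u y)"
    by (intro sum_mono one)
  also have "\<dots> = (\<Sum>(u, y)\<in>(SIGMA u:bd. ?Y u). ?G u y)"
    by (rule sum.Sigma) (use finite_bd finY in auto)
  finally show ?thesis by (simp add: X_def)
qed

lemma card_edges_touching:
  assumes "1 \<le> r"
  shows "real (card {e\<in>F. e \<inter> {x. nrm (x - u) \<le> r} \<noteq> {}}) \<le> (3 * r) ^ CARD('d) * (3 * L) ^ CARD('d)"
proof -
  let ?B = "{x. nrm (x - u) \<le> r}" and ?N = "\<lambda>x. {y. nrm (y - x) \<le> L}"
  have fin: "finite (SIGMA x:?B. ?N x)"
    using card_nrm_ball(1)[OF assms] card_nrm_ball(1)[OF L_ge_1] by auto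
  have "{e\<in>F. e \<inter> ?B \<noteq> {}} \<subseteq> (\<lambda>(x, y). {x, y}) ` (SIGMA x:?B. ?N x)"
  proof
    fix e assume "e \<in> {e\<in>F. e \<inter> ?B \<noteq> {}}"
    then obtain x where e: "e \<in> F" "x \<in> e" "nrm (x - u) \<le> r" by blast
    obtain v w where vw: "e = {v, w}" using edges[OF e(1)] by blast
    define y where "y = (if x = v then w else v)"
    have "e = {x, y}" using vw e(2) by (auto simp: y_def)
    moreover have "nrm (y - x) \<le> L" using range[of x y] e(1) \<open>e = {x, y}\<close> nrm_minus_commute[of x y] by simp
    ultimately show "e \<in> (\<lambda>(x, y). {x, y}) ` (SIGMA x:?B. ?N x)"
      using e(3) by (intro image_eqI[of _ _ "(x, y)"]) auto
  qed
  then have "card {e\<in>F. e \<inter> ?B \<noteq> {}} \<le> card (SIGMA x:?B. ?N x)"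
    using surj_card_le[OF fin] by blast
  also have "\<dots> = (\<Sum>x\<in>?B. card (?N x))"
    by (rule card_SigmaI) (use card_nrm_ball(1)[OF assms] card_nrm_ball(1)[OF L_ge_1] in auto)
  finally have "real (card {e\<in>F. e \<inter> ?B \<noteq> {}}) \<le> real (\<Sum>x\<in>?B. card (?N x))"
    by (rule of_nat_mono)
  also have "\<dots> = (\<Sum>x\<in>?B. real (card (?N x)))" by (rule of_nat_sum)
  also have "\<dots> \<le> (\<Sum>x\<in>?B. (3 * L) ^ CARD('d))"
    by (intro sum_mono card_nrm_ball(2)[OF L_ge_1])
  also have "\<dots> = real (card ?B) * (3 * L) ^ CARD('d)" by simp
  also have "\<dots> \<le> (3 * r) ^ CARD('d) * (3 * L) ^ CARD('d)"
    using L_ge_1 by (intro mult_right_mono card_nrm_ball(2)[OF assms]) auto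
  finally show ?thesis .
qed

text \<open>\<open>surgery_sum\<close> for the pairs \<open>(u, y)\<close> with the cube around
  \<open>u\<close>: it touches boundedly many edges, and a vertex belongs to the cubes of boundedly
  many pairs.\<close>

lemma surgery_upper_bound:
  assumes \<rho>: "scale_min CARD('d) a b L \<le> \<rho>"
    and K: "\<And>u y. u \<in> bd \<Longrightarrow> nrm (y - u) \<le> \<rho>\<^sup>2 \<Longrightarrow> y \<in> K"
    and far: "\<And>u y. u \<in> bd \<Longrightarrow> nrm (y - u) \<le> \<rho>\<^sup>2 \<Longrightarrow> nrm (y - root) \<le> nrm (z - root) / 4"
  shows "min p (1 - p) ^ nat \<lfloor>(3 * \<rho>\<^sup>2) ^ CARD('d) * (3 * L) ^ CARD('d)\<rfloor> *
    (\<Sum>(u, y)\<in>(SIGMA u:bd. {y. nrm (y - u) \<le> \<rho>\<^sup>2}).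
        pr p F (\<lambda>\<omega>. conn \<omega> S root u \<and> \<not> conn \<omega> V root y \<and> conn \<omega> V y z))
    \<le> real (nat \<lfloor>(3 * \<rho>\<^sup>2) ^ CARD('d) * (3 * \<rho>\<^sup>2) ^ CARD('d)\<rfloor>) * T V root z"
proof -
  let ?d = "CARD('d)" and ?R = "\<rho>\<^sup>2"
  let ?Y = "\<lambda>u. {y. nrm (y - u) \<le> ?R}"
  have \<rho>4: "4 \<le> \<rho>" "L \<le> \<rho>" using \<rho> unfolding scale_min_def by auto
  have R\<rho>: "\<rho> \<le> ?R" using \<rho>4 mult_left_mono[of 1 \<rho> \<rho>] by (simp add: power2_eq_square)
  have R1: "1 \<le> ?R" using \<rho>4 R\<rho> by linarith
  have finY: "finite (?Y u)" for u by (rule card_nrm_ball(1)[OF R1])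
  let ?I = "SIGMA u:bd. ?Y u"
  have Ycube: "?Y u = cube u \<lfloor>?R\<rfloor>" for u using nrm_le_iff[OF R1] by auto
  show ?thesis
    unfolding case_prod_beta
  proof (rule surgery_sum[where cube = "\<lambda>i. ?Y (fst i)"])
    show "S \<subseteq> V" "root \<in> S" by (rule S_V, rule root)
    show "finite ?I" using finite_bd finY by auto
    show "0 < min p (1 - p)" "min p (1 - p) \<le> p" "min p (1 - p) \<le> 1 - p"
      using p_pos p_less_1 by auto
  next
    fix i assume i: "i \<in> ?I"
    then have u: "fst i \<in> bd" by auto
    show sub: "?Y (fst i) \<subseteq> V" using K[OF u] K_sub by auto
    show "z \<notin> ?Y (fst i)" using far[OF u, of z] nrm_pos[of "z - root"] by auto
    show "fst i \<in> ?Y (fst i)" using R1 by (simp add: nrm_def linf_norm_def)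
    show "snd i \<in> ?Y (fst i)" using i by auto
    obtain v where v: "v \<notin> S" "nrm (fst i - v) \<le> L" using bd_exit[OF u] by metis
    \<comment> \<open>The neighbour of the boundary point outside \<open>S\<close> serves as the
      vertex through which the surgery is routed; it lies in the cube because
      \<open>L \<le> \<rho> \<le> \<rho>\<^sup>2\<close>.\<close>
    have vY: "v \<in> ?Y (fst i)" using v(2) \<rho>4 R\<rho> nrm_minus_commute[of v "fst i"] by simp
    show "\<exists>v. v \<notin> S \<and> (\<forall>a\<in>?Y (fst i). \<forall>b\<in>?Y (fst i). a \<noteq> b \<longrightarrow> a \<noteq> v \<longrightarrow>
      (\<exists>\<rho>'. \<rho>' \<noteq> [] \<and> distinct \<rho>' \<and> hd \<rho>' = a \<and> last \<rho>' = b \<and> set \<rho>' \<subseteq> ?Y (fst i) \<and> path_edges \<rho>' \<subseteq> F \<and> v \<in> set \<rho>'))"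
    proof (intro exI[of _ v] conjI ballI impI v(1))
      fix a b assume ab: "a \<in> ?Y (fst i)" "b \<in> ?Y (fst i)" "a \<noteq> b"
      show "\<exists>\<rho>'. \<rho>' \<noteq> [] \<and> distinct \<rho>' \<and> hd \<rho>' = a \<and> last \<rho>' = b \<and> set \<rho>' \<subseteq> ?Y (fst i) \<and> path_edges \<rho>' \<subseteq> F \<and> v \<in> set \<rho>'"
        unfolding Ycube
      proof (rule cube_saw_through)
        show "{x, y} \<in> F" if "x \<in> cube (fst i) \<lfloor>?R\<rfloor>" "y \<in> cube (fst i) \<lfloor>?R\<rfloor>" "l1_norm (x - y) = 1" for x y
          using that sub unfolding Ycube by (intro nn) auto
        show "1 \<le> \<lfloor>?R\<rfloor>" using R1 by (simp add: le_floor_iff)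
      qed (use ab vY dim in \<open>auto simp: Ycube[symmetric]\<close>)
    qed
    show "card {e \<in> F. e \<inter> ?Y (fst i) \<noteq> {}} \<le> nat \<lfloor>(3 * ?R) ^ ?d * (3 * L) ^ ?d\<rfloor>"
      using card_edges_touching[OF R1] by (rule le_nat_floor)
  next
    fix v
    have "real (card {i\<in>?I. v \<in> ?Y (fst i)}) \<le> (3 * ?R) ^ ?d * (3 * ?R) ^ ?d"
    proof -
      have "{i\<in>?I. v \<in> ?Y (fst i)} \<subseteq> (SIGMA u:?Y v. ?Y u)" using nrm_minus_commute[of v] by auto
      then have "card {i\<in>?I. v \<in> ?Y (fst i)} \<le> card (SIGMA u:?Y v. ?Y u)"
        using finY by (intro card_mono) auto
      also have "\<dots> = (\<Sum>u\<in>?Y v. card (?Y u))" by (rule card_SigmaI) (use finY in auto)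
      finally have "real (card {i\<in>?I. v \<in> ?Y (fst i)}) \<le> real (\<Sum>u\<in>?Y v. card (?Y u))"
        by (rule of_nat_mono)
      also have "\<dots> = (\<Sum>u\<in>?Y v. real (card (?Y u)))" by (rule of_nat_sum)
      also have "\<dots> \<le> (\<Sum>u\<in>?Y v. (3 * ?R) ^ ?d)" by (intro sum_mono card_nrm_ball(2)[OF R1])
      also have "\<dots> = real (card (?Y v)) * (3 * ?R) ^ ?d" by simp
      also have "\<dots> \<le> (3 * ?R) ^ ?d * (3 * ?R) ^ ?d"
        using R1 by (intro mult_right_mono card_nrm_ball(2)[OF R1]) auto
      finally show ?thesis .
    qed
    then show "card {i\<in>?I. v \<in> ?Y (fst i)} \<le> nat \<lfloor>(3 * ?R) ^ ?d * (3 * ?R) ^ ?d\<rfloor>"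
      by (rule le_nat_floor)
  qed
qed

end

text \<open>The second entry makes the loop term at most half of the main term:
  \<open>loop_const / \<rho> \<le> a / (2 * 2 ^ d)\<close>.\<close>

definition radius :: "nat \<Rightarrow> real \<Rightarrow> real \<Rightarrow> real \<Rightarrow> real" where
  "radius d a b L = max (scale_min d a b L) (2 * 2 ^ d * loop_const d a b / a)"

definition boundary_const :: "nat \<Rightarrow> real \<Rightarrow> real \<Rightarrow> real \<Rightarrow> real \<Rightarrow> real" where
  "boundary_const d p a b L =
    (let R = (radius d a b L)\<^sup>2 in
     2 * 2 ^ d / a * (1 + real (nat \<lfloor>(3 * R) ^ d * (3 * R) ^ d\<rfloor>) * b / min p (1 - p) ^ nat \<lfloor>(3 * R) ^ d * (3 * L) ^ d\<rfloor>))"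

text \<open>Lower and upper bound on the same sum both carry the decay
  \<open>1 / nrm (z - root) ^ (d - 2)\<close>. It cancels, leaving a bound on \<open>\<phi>\<close>
  that depends neither on \<open>z\<close> nor on \<open>S\<close>.\<close>

lemma (in lattice_percolation) boundary_sum_le:
  assumes z: "z \<in> K"
    and K: "\<And>u y. u \<in> bd \<Longrightarrow> nrm (y - u) \<le> (radius CARD('d) a b L)\<^sup>2 \<Longrightarrow> y \<in> K"
    and far: "\<And>w. w \<in> S \<Longrightarrow> nrm (w - root) \<le> nrm (z - root) / 4"
      "\<And>u y. u \<in> bd \<Longrightarrow> nrm (y - u) \<le> (radius CARD('d) a b L)\<^sup>2 \<Longrightarrow> nrm (y - root) \<le> nrm (z - root) / 4"
    and large: "8 * 48 ^ CARD('d) * b ^ 3 * (3 * (radius CARD('d) a b L)\<^sup>2) ^ CARD('d) * (real (card S))\<^sup>2 \<le> nrm (z - root)"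
  shows "\<phi> \<le> boundary_const CARD('d) p a b L"
proof -
  let ?d = "CARD('d)" and ?C = "loop_const CARD('d) a b"
  define \<rho> where "\<rho> = radius ?d a b L"
  have \<rho>: "scale_min ?d a b L \<le> \<rho>" and \<rho>C: "2 * 2 ^ ?d * ?C / a \<le> \<rho>" unfolding \<rho>_def radius_def by auto
  have \<rho>4: "4 \<le> \<rho>" using \<rho> unfolding scale_min_def by auto
  define M where "M = nat \<lfloor>(3 * \<rho>\<^sup>2) ^ ?d * (3 * L) ^ ?d\<rfloor>"
  define N where "N = nat \<lfloor>(3 * \<rho>\<^sup>2) ^ ?d * (3 * \<rho>\<^sup>2) ^ ?d\<rfloor>"
  let ?q = "min p (1 - p)" and ?n = "nrm (z - root) ^ (?d - 2)"
  let ?G = "\<Sum>(u, y)\<in>(SIGMA u:bd. {y. nrm (y - u) \<le> \<rho>\<^sup>2}). pr p F (\<lambda>\<omega>. conn \<omega> S root u \<and> \<not> conn \<omega> V root y \<and> conn \<omega> V y z)"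
  have q: "0 < ?q ^ M" using p_pos p_less_1 by simp
  have n: "0 < ?n" by simp
  have h1: "((\<rho>\<^sup>2) ^ ?d * \<phi> * (a / 2 ^ ?d - ?C / \<rho>) - 1) / ?n \<le> ?G"
    by (rule two_arm_lower_bound[OF \<rho> z]) (use K far large in \<open>auto simp: \<rho>_def\<close>)
  have "?q ^ M * ?G \<le> real N * T V root z"
    unfolding M_def N_def by (rule surgery_upper_bound[OF \<rho>]) (use K far in \<open>auto simp: \<rho>_def\<close>)
  then have h2: "?G \<le> real N * T V root z / ?q ^ M" using q by (simp add: pos_le_divide_eq mult.commute)
  have h3: "real N * T V root z / ?q ^ M \<le> real N * (b / ?n) / ?q ^ M"
    using upper[of root z] q nrm_minus_commute[of root z] by (intro divide_right_mono mult_left_mono) auto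
  have h4: "real N * (b / ?n) / ?q ^ M = (real N * b / ?q ^ M) / ?n" by (simp add: mult.commute)
  have "((\<rho>\<^sup>2) ^ ?d * \<phi> * (a / 2 ^ ?d - ?C / \<rho>) - 1) / ?n \<le> (real N * b / ?q ^ M) / ?n"
    using order_trans[OF h1 order_trans[OF h2 h3]] unfolding h4 .
  then have 1: "(\<rho>\<^sup>2) ^ ?d * \<phi> * (a / 2 ^ ?d - ?C / \<rho>) \<le> 1 + real N * b / ?q ^ M"
    using n by (simp only: divide_le_cancel) auto
  have "?C / \<rho> \<le> a / (2 * 2 ^ ?d)"
    using \<rho>C \<rho>4 a_pos by (simp add: field_simps)
  then have 2: "a / (2 * 2 ^ ?d) \<le> a / 2 ^ ?d - ?C / \<rho>" by simp
  have "1 \<le> (\<rho>\<^sup>2) ^ ?d" using \<rho>4 by (intro one_le_power) auto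
  then have "1 * \<phi> * (a / (2 * 2 ^ ?d)) \<le> (\<rho>\<^sup>2) ^ ?d * \<phi> * (a / 2 ^ ?d - ?C / \<rho>)"
    using 2 a_pos \<phi>_nonneg by (intro mult_mono) auto
  then have "\<phi> * (a / (2 * 2 ^ ?d)) \<le> 1 + real N * b / ?q ^ M" using 1 by simp
  then have "\<phi> \<le> 2 * 2 ^ ?d / a * (1 + real N * b / ?q ^ M)"
    using a_pos by (simp add: field_simps)
  then show ?thesis unfolding boundary_const_def Let_def \<rho>_def[symmetric] M_def N_def .
qed

section \<open>The reversed Simon--Lieb inequality\<close>

lemma two_point_bounds:
  fixes E :: "(int ^ 'd) set set"
  assumes "two_point_assumption E" "CARD('d) > 6"
  obtains a b where "0 < a" "0 < b"
    "\<And>x y. a / nrm (x - y) ^ (CARD('d) - 2) \<le> tau E UNIV (p_crit E) x y"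
    "\<And>x y. tau E UNIV (p_crit E) x y \<le> b / nrm (x - y) ^ (CARD('d) - 2)"
proof -
  have eq: "real_of_int (max 1 (linf_norm z)) powr (- (real CARD('d) - 2)) = 1 / nrm z ^ (CARD('d) - 2)"
    for z :: "int ^ 'd"
  proof -
    have *: "real CARD('d) - 2 = real (CARD('d) - 2)" using assms(2) by simp
    have "nrm z powr (- (real CARD('d) - 2)) = 1 / nrm z powr real (CARD('d) - 2)"
      unfolding * by (rule powr_minus_divide)
    also have "nrm z powr real (CARD('d) - 2) = nrm z ^ (CARD('d) - 2)" by (rule powr_realpow[OF nrm_pos])
    finally show ?thesis unfolding nrm_def .
  qed
  from assms(1) obtain a b where ab: "0 < a" "a \<le> b"
    "\<And>x y. let r = real_of_int (max 1 (linf_norm (x - y))) powr (- (real CARD('d) - 2))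
       in a * r \<le> tau E UNIV (p_crit E) x y \<and> tau E UNIV (p_crit E) x y \<le> b * r"
    unfolding two_point_assumption_def by blast
  show ?thesis
  proof (rule that[of a b])
    fix x y
    show "a / nrm (x - y) ^ (CARD('d) - 2) \<le> tau E UNIV (p_crit E) x y"
      "tau E UNIV (p_crit E) x y \<le> b / nrm (x - y) ^ (CARD('d) - 2)"
      using ab(3)[of x y] unfolding eq Let_def by simp_all
  qed (use ab in auto)
qed

text \<open>The case \<open>x \<rightarrow> \<infinity>\<close> of the theorem, in which both factors involving \<open>x\<close> cancel.\<close>

lemma boundary_sum_bounded:
  fixes E :: "(int ^ 'd) set set" and root :: "int ^ 'd"
  assumes d: "CARD('d) > 6" and E: "percolation_edge_set E" and L: "1 \<le> L" "\<And>u v. {u, v} \<in> E \<Longrightarrow> nrm (u - v) \<le> L"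
    and ab: "0 < a" "0 < b"
    and lower: "\<And>x y. a / nrm (x - y) ^ (CARD('d) - 2) \<le> tau E UNIV p x y"
    and upper: "\<And>x y. tau E UNIV p x y \<le> b / nrm (x - y) ^ (CARD('d) - 2)"
    and p: "0 < p" "p < 1" and S: "finite S" "root \<in> S"
  shows "(\<Sum>u\<in>{u\<in>S. \<exists>v. v \<notin> S \<and> {u, v} \<in> E}. tau E S p root u) \<le> boundary_const CARD('d) p (a / 2) b L"
proof -
  let ?d = "CARD('d)" and ?R = "(radius CARD('d) (a / 2) b L)\<^sup>2"
  have R1: "1 \<le> ?R" unfolding radius_def scale_min_def by (intro one_le_power) auto
  \<comment> \<open>Besides \<open>z\<close>, these are the vertices at which the two-point lower
    bound is needed: \<open>S\<close>, its neighbours and the surgery cubes.\<close>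
  let ?N = "S \<union> (\<Union>u\<in>S. {v. {u, v} \<in> E}) \<union> (\<Union>u\<in>S. {y. nrm (y - u) \<le> ?R})"
  have finN: "finite ?N" using S finite_neighbours[OF E] card_nrm_ball(1)[OF R1] by auto
  let ?Q = "8 * 48 ^ ?d * b ^ 3 * (3 * ?R) ^ ?d * (real (card S))\<^sup>2"
  \<comment> \<open>\<open>z\<close> is shifted by \<open>k\<close> in every coordinate: at least
    four times farther from \<open>root\<close> than any point of \<open>?N\<close>, and beyond
    \<open>?Q\<close>, which makes the finite-distance error at most one.\<close>
  obtain k :: nat where k: "4 * Max ((\<lambda>w. nrm (w - root)) ` ?N) + ?Q + 1 \<le> real k" using real_arch_simple by blast
  define z :: "int ^ 'd" where "z = (\<chi> i. root $ i + int k)"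
  have nz: "real k \<le> nrm (z - root)"
  proof -
    have "int k \<le> linf_norm (z - root)" using abs_le_linf_norm[of "z - root" undefined] by (simp add: z_def)
    then show ?thesis unfolding nrm_def by linarith
  qed
  have Q: "0 \<le> ?Q" using ab by simp
  have far: "nrm (w - root) \<le> nrm (z - root) / 4" if "w \<in> ?N" for w
  proof -
    have "nrm (w - root) \<le> Max ((\<lambda>w. nrm (w - root)) ` ?N)" using finN that by (intro Max_ge) auto
    then show ?thesis using k nz Q by linarith
  qed
  have M: "0 \<le> Max ((\<lambda>w. nrm (w - root)) ` ?N)"
  proof -
    have "nrm (root - root) \<le> Max ((\<lambda>w. nrm (w - root)) ` ?N)" using finN S(2) by (intro Max_ge imageI finite_imageI) auto
    then show ?thesis using nrm_pos[of "root - root"] by linarith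
  qed
  let ?K = "insert z ?N"
  have pos: "0 < tau E UNIV p x y" for x y
    using lower[of x y] ab(1) nrm_pos[of "x - y"] by (smt (verit) divide_pos_pos zero_less_power)
  obtain m :: nat where m: "?K \<subseteq> cube 0 (int m)"
    "\<And>x y. x \<in> ?K \<Longrightarrow> y \<in> ?K \<Longrightarrow> tau E UNIV p x y / 2 \<le> tau E (cube 0 (int m)) p x y"
    using tau_cube_approx[of ?K E p] finN pos by (metis finite_insert)
  let ?V = "cube (0 :: int ^ 'd) (int m)"
  let ?F = "{e\<in>E. e \<subseteq> ?V}"
  have finV: "finite ?V" by (simp add: card_cube)
  have finF: "finite ?F" by (rule finite_subset[of _ "Pow ?V"]) (use finV in auto)
  interpret fp: finite_percolation p ?F ?V
    by unfold_locales (use p finF finV in auto)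
  have pmf: "pmf (bernoulli_pmf p) True = p" using p by simp
  have T: "fp.T A x y = tau E A p x y" if "A \<subseteq> ?V" for A x y
    unfolding fp.T_def tau_eq_pr[of ?F E A, OF finF] pmf
    by (subst tau_eq_pr[of ?F E A]) (use that finF pmf in auto)
  interpret lattice_percolation p ?F ?V ?K S root "a / 2" b L
  proof unfold_locales
    show "fp.T ?V x y \<le> b / nrm (x - y) ^ (?d - 2)" for x y
      using tau_mono[OF subset_UNIV, of E ?V p x y] upper[of x y] unfolding T[OF order_refl] by linarith
    show "a / 2 / nrm (x - y) ^ (?d - 2) \<le> fp.T ?V x y" if "x \<in> ?K" "y \<in> ?K" for x y
    proof -
      have "a / 2 / nrm (x - y) ^ (?d - 2) = a / nrm (x - y) ^ (?d - 2) / 2" by simp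
      then show ?thesis using m(2)[OF that] lower[of x y] unfolding T[OF order_refl] by linarith
    qed
    show "\<exists>u v. e = {u, v}" if "e \<in> ?F" for e using that edge_form[OF E, of e] by blast
    show "{x, y} \<in> ?F" if "x \<in> ?V" "y \<in> ?V" "l1_norm (x - y) = 1" for x y
      using that nn_edge_in[OF E] by auto
  qed (use d p ab L m(1) S in auto)
  have bd: "fp.inner_boundary S = {u\<in>S. \<exists>v. v \<notin> S \<and> {u, v} \<in> E}"
  proof -
    have "{u, v} \<in> ?F" if "u \<in> S" "{u, v} \<in> E" for u v
      using that m(1) by auto
    then show ?thesis unfolding fp.inner_boundary_def by blast
  qed
  have bN: "y \<in> ?N" if "u \<in> fp.inner_boundary S" "nrm (y - u) \<le> ?R" for u y
  proof -
    have "u \<in> S" using that(1) bd_sub by blast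
    then show ?thesis using that(2) by auto
  qed
  have "\<phi> \<le> boundary_const ?d p (a / 2) b L"
  proof (rule boundary_sum_le)
    show "?Q \<le> nrm (z - root)" using k nz M by linarith
  qed (use bN far in auto)
  then show ?thesis unfolding \<phi>_def bd using T[OF S_V] by simp
qed

text \<open>On the range of summation the last factor is at most a constant times
  \<open>\<tau>(y, x)\<close>, where \<open>y\<close> plays the role of \<open>o\<close>. Each
  \<open>u\<close> has at most \<open>(3 * L) ^ d\<close> partners \<open>v\<close>, and what
  remains is the boundary sum.\<close>

theorem proposition1p3:
  fixes E :: "(int ^ 'd) set set" and \<epsilon> :: real
  assumes "CARD('d) > 6"
    and "percolation_edge_set E"
    and "two_point_assumption E"
    and "\<epsilon> > 0"
  shows "\<exists>c>0. \<forall>(S :: (int ^ 'd) set) y x. finite S \<longrightarrow> y \<in> S \<longrightarrow>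
    tau E UNIV (p_crit E) y x \<ge>
      c * (\<Sum>(u, v) \<in> {(u, v) \<in> boundary_pairs E S.
              real_of_int (linf_norm (x - u)) \<ge> \<epsilon> * real_of_int (linf_norm (x - y))}.
            tau E S (p_crit E) y u * p_crit E * tau E UNIV (p_crit E) v x)"
proof -
  let ?d = "CARD('d)" and ?p = "p_crit E"
  obtain a b where ab: "0 < a" "0 < b"
    and lower: "\<And>x y. a / nrm (x - y) ^ (?d - 2) \<le> tau E UNIV ?p x y"
    and upper: "\<And>x y. tau E UNIV ?p x y \<le> b / nrm (x - y) ^ (?d - 2)"
    using two_point_bounds[OF assms(3,1)] by blast
  obtain L where L: "1 \<le> L" "\<And>u v. {u, v} \<in> E \<Longrightarrow> nrm (u - v) \<le> L"
    using edge_range[OF assms(2)] by blast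
  have pos: "0 < tau E UNIV ?p x y" for x y
  proof -
    have "0 < a / nrm (x - y) ^ (?d - 2)" using ab by simp
    then show ?thesis using lower[of x y] by linarith
  qed
  have p: "0 < ?p" "?p < 1"
    using parameter_nontrivial[OF assms(2) _ pos upper] assms(1) by auto
  \<comment> \<open>The maximum spares a discussion of the sign of the constant; likewise the
    summand 1 in \<open>C\<close> keeps it positive.\<close>
  define B where "B = max 0 (boundary_const ?d ?p (a / 2) b L)"
  \<comment> \<open>\<open>min 1 \<epsilon>\<close> accounts for the distance of \<open>u\<close>
    from \<open>x\<close>, and \<open>1 + L\<close> for the step from \<open>u\<close> to
    \<open>v\<close>, of length at most \<open>L \<le> L * nrm (v - x)\<close>.\<close>
  define \<kappa> where "\<kappa> = min 1 \<epsilon> / (1 + L)"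
  have \<kappa>: "0 < \<kappa>" using assms(4) L(1) by (simp add: \<kappa>_def)
  define A where "A = b / (\<kappa> ^ (?d - 2) * a)"
  have A: "0 < A" using ab \<kappa> by (simp add: A_def)
  define C where "C = (3 * L) ^ ?d * B * A + 1"
  have C: "0 < C" using L(1) A by (auto simp: C_def B_def intro!: add_nonneg_pos mult_nonneg_nonneg)
  have "tau E UNIV ?p y x \<ge> 1 / C * (\<Sum>(u, v) \<in> {(u, v) \<in> boundary_pairs E S.
      real_of_int (linf_norm (x - u)) \<ge> \<epsilon> * real_of_int (linf_norm (x - y))}.
      tau E S ?p y u * ?p * tau E UNIV ?p v x)" if S: "finite S" "y \<in> S" for S y x
  proof -
    let ?D = "{u\<in>S. \<exists>v. v \<notin> S \<and> {u, v} \<in> E}"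
    let ?P = "{(u, v) \<in> boundary_pairs E S. real_of_int (linf_norm (x - u)) \<ge> \<epsilon> * real_of_int (linf_norm (x - y))}"
    let ?t = "tau E UNIV ?p y x"
    have far: "tau E UNIV ?p v x \<le> A * ?t" if "(u, v) \<in> ?P" for u v
    proof -
      have uv: "{u, v} \<in> E" "\<epsilon> * real_of_int (linf_norm (x - y)) \<le> real_of_int (linf_norm (x - u))"
        using that by (auto simp: boundary_pairs_def)
      \<comment> \<open>At \<open>x = y\<close> the hypothesis on \<open>u\<close> is void, but
        there the truncated norm is 1 and \<open>min 1 \<epsilon> \<le> 1\<close> is enough.\<close>
      have "min 1 \<epsilon> * nrm (y - x) \<le> nrm (x - u)"
      proof (cases "1 \<le> linf_norm (x - y)")
        case True
        then have "min 1 \<epsilon> * nrm (y - x) = min 1 \<epsilon> * real_of_int (linf_norm (x - y))"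
          by (simp add: nrm_minus_commute[of y x]) (simp add: nrm_def)
        also have "\<dots> \<le> \<epsilon> * real_of_int (linf_norm (x - y))" using True by (intro mult_right_mono) auto
        also have "\<dots> \<le> nrm (x - u)" using uv(2) by (simp add: nrm_def)
        finally show ?thesis .
      next
        case False
        then have "nrm (y - x) = 1" by (simp add: nrm_minus_commute[of y x]) (simp add: nrm_def)
        moreover have "min 1 \<epsilon> \<le> nrm (x - u)" using nrm_ge_1[of "x - u"] by linarith
        ultimately show ?thesis by simp
      qed
      also have "nrm (x - u) \<le> nrm (v - x) + L"
        using nrm_triangle[of x u v] L(2)[OF uv(1)] nrm_minus_commute[of u v] nrm_minus_commute[of x v] by simp
      also have "\<dots> \<le> (1 + L) * nrm (v - x)"
        using mult_left_mono[OF nrm_ge_1[of "v - x"], of L] L(1) by (simp add: distrib_right)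
      finally have "\<kappa> * nrm (y - x) \<le> nrm (v - x)" using L(1) by (simp add: \<kappa>_def field_simps)
      then have "b / nrm (v - x) ^ (?d - 2) \<le> b / (\<kappa> * nrm (y - x)) ^ (?d - 2)"
        using ab \<kappa> by (intro divide_left_mono power_mono mult_pos_pos) auto
      also have "\<dots> = A * (a / nrm (y - x) ^ (?d - 2))"
        using ab by (simp add: A_def power_mult_distrib)
      also have "\<dots> \<le> A * ?t" using A by (intro mult_left_mono lower) auto
      finally show ?thesis using upper[of v x] by linarith
    qed
    have finP: "finite ?P" using finite_boundary_pairs[OF assms(2) S(1)] by (rule rev_finite_subset) auto
    have finS: "finite (SIGMA u:?D. {v. nrm (v - u) \<le> L})"
      by (rule finite_SigmaI) (use S(1) card_nrm_ball(1)[OF L(1)] in auto)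
    have "(\<Sum>(u, v)\<in>?P. tau E S ?p y u * ?p * tau E UNIV ?p v x) \<le> (\<Sum>(u, v)\<in>?P. tau E S ?p y u * 1 * (A * ?t))"
    proof (rule sum_mono, clarify)
      fix u v assume uv: "(u, v) \<in> boundary_pairs E S"
        "\<epsilon> * real_of_int (linf_norm (x - y)) \<le> real_of_int (linf_norm (x - u))"
      have "tau E UNIV ?p v x \<le> A * ?t" by (rule far) (use uv in auto)
      then show "tau E S ?p y u * ?p * tau E UNIV ?p v x \<le> tau E S ?p y u * 1 * (A * ?t)"
        using p by (intro mult_mono mult_left_mono) (auto simp: tau_nonneg)
    qed
    also have "\<dots> \<le> (\<Sum>(u, v)\<in>(SIGMA u:?D. {v. nrm (v - u) \<le> L}). tau E S ?p y u * 1 * (A * ?t))"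
    proof (rule sum_mono2[OF finS])
      show "?P \<subseteq> (SIGMA u:?D. {v. nrm (v - u) \<le> L})"
      proof
        fix i assume "i \<in> ?P"
        then have i: "fst i \<in> S" "snd i \<notin> S" "{fst i, snd i} \<in> E" by (auto simp: boundary_pairs_def)
        then have "nrm (snd i - fst i) \<le> L" using L(2) nrm_minus_commute[of "snd i" "fst i"] by simp
        then have "(fst i, snd i) \<in> (SIGMA u:?D. {v. nrm (v - u) \<le> L})" using i by blast
        then show "i \<in> (SIGMA u:?D. {v. nrm (v - u) \<le> L})" by simp
      qed
      show "0 \<le> (case i of (u, v) \<Rightarrow> tau E S ?p y u * 1 * (A * ?t))" for i
        using A by (simp add: case_prod_beta tau_nonneg)
    qed
    also have "\<dots> = (\<Sum>u\<in>?D. \<Sum>v\<in>{v. nrm (v - u) \<le> L}. tau E S ?p y u * 1 * (A * ?t))"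
      by (rule sum.Sigma[symmetric]) (use S(1) card_nrm_ball(1)[OF L(1)] in auto)
    also have "\<dots> = (\<Sum>u\<in>?D. real (card {v. nrm (v - u) \<le> L}) * (tau E S ?p y u * (A * ?t)))" by simp
    also have "\<dots> \<le> (\<Sum>u\<in>?D. (3 * L) ^ ?d * (tau E S ?p y u * (A * ?t)))"
      using A by (intro sum_mono mult_right_mono card_nrm_ball(2)[OF L(1)]) (auto simp: tau_nonneg)
    also have "\<dots> = (3 * L) ^ ?d * (\<Sum>u\<in>?D. tau E S ?p y u) * A * ?t"
      by (simp add: sum_distrib_left sum_distrib_right mult.assoc)
    also have "\<dots> \<le> (3 * L) ^ ?d * B * A * ?t"
    proof -
      have "(\<Sum>u\<in>?D. tau E S ?p y u) \<le> B"
        using boundary_sum_bounded[OF assms(1,2) L ab lower upper p S] unfolding B_def by simp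
      then show ?thesis using A L(1) by (intro mult_right_mono mult_left_mono) (auto simp: tau_nonneg)
    qed
    also have "\<dots> \<le> C * ?t" by (intro mult_right_mono) (auto simp: C_def tau_nonneg)
    finally show ?thesis using C by (simp add: field_simps)
  qed
  then show ?thesis using C by (intro exI[of _ "1 / C"]) auto
qed

end
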